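(* Let $w\in\mathbf{F}_r$ and let $G=\mathrm{O}$ or $G=\mathrm{Sp}$. Then $$\mathcal{T}r^{G}_{w}(n)=O\left(n^{\,1-\min(\mathrm{sql}(w),\,2\mathrm{cl}(w))}\right)\quad\text{as } n\to\infty,$$ where the right hand side is interpreted as $0$ when $\mathrm{sql}(w)=\infty$.
   Context: $\mathbf{F}_r$ is the free group with basis $\{x_1,\ldots,x_r\}$; $w(g_1,\ldots,g_r)$ is obtained by substituting $g_i$ for $x_i$. $\mathrm{O}(n)$ is the group of real orthogonal $n\times n$ matrices and $\mathrm{Sp}(n)=\{A\in M_{2n}(\mathbb{C}): A^*A=\mathrm{Id}_{2n},\ A^TJA=J\}$, $J=\begin{pmatrix}0_n&\mathrm{Id}_n\\-\mathrm{Id}_n&0_n\end{pmatrix}$. With $\mu_n$ the Haar probability measure on $G(n)$, $\mathcal{T}r^{G}_{w}(n)=\int_{G(n)^r}\mathrm{tr}(w(g_1,\ldots,g_r))\,d\mu_n(g_1)\cdots d\mu_n(g_r)$. The square length $\mathrm{sql}(w)$ is the minimum $s$ such that $w$ is a product of $s$ squares in $\mathbf{F}_r$ ($\infty$ if $w$ is not a product of squares). The commutator length $\mathrm{cl}(w)$ is the minimum $g$ such that $w$ is a product of $g$ commutators in $\mathbf{F}_r$ ($\infty$ if there is none). One has $\mathrm{sql}(w)\le 2\mathrm{cl}(w)+1$, so $\mathrm{sql}(w)=\infty$ implies $\mathrm{cl}(w)=\infty$. *)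

theory Defs
  imports
    "HOL-Probability.Probability"
    "HOL-Algebra.Generated_Groups"
    "HOL-Library.Landau_Symbols"
    "Jordan_Normal_Form.Schur_Decomposition"
begin

section \<open>Free groups\<close>

text \<open>The letter \<open>(i, True)\<close> stands for the \<open>i\<close>-th basis element, \<open>(i, False)\<close> for its inverse.
  Elements of the free group are reduced words, and the basis of the free group of rank \<open>r\<close> is
  indexed by \<open>0, \<dots>, r - 1\<close>.\<close>

type_synonym letter = "nat \<times> bool"

definition inv_letter :: "letter \<Rightarrow> letter" where
  "inv_letter a = (fst a, \<not> snd a)"

definition reduced_word :: "letter list \<Rightarrow> bool" where
  "reduced_word w \<longleftrightarrow> (\<forall>k. Suc k < length w \<longrightarrow> w ! Suc k \<noteq> inv_letter (w ! k))"

fun cons_red :: "letter \<Rightarrow> letter list \<Rightarrow> letter list" where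
  "cons_red a [] = [a]"
| "cons_red a (b # w) = (if b = inv_letter a then w else a # b # w)"

definition free_group :: "nat \<Rightarrow> letter list monoid" where
  "free_group r =
     \<lparr>carrier = {w. reduced_word w \<and> (\<forall>a\<in>set w. fst a < r)}, mult = foldr cons_red, one = []\<rparr>"

lemma inv_letter_inv_letter [simp]: "inv_letter (inv_letter a) = a"
  by (simp add: inv_letter_def)

lemma fst_inv_letter [simp]: "fst (inv_letter a) = fst a"
  by (simp add: inv_letter_def)

lemma reduced_word_Nil [simp]: "reduced_word []"
  by (simp add: reduced_word_def)

lemma reduced_word_Cons:
  "reduced_word (a # w) \<longleftrightarrow> reduced_word w \<and> (w \<noteq> [] \<longrightarrow> hd w \<noteq> inv_letter a)"
proof
  assume *: "reduced_word (a # w)"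
  have "reduced_word w"
    unfolding reduced_word_def
  proof (intro allI impI)
    fix k assume "Suc k < length w"
    then show "w ! Suc k \<noteq> inv_letter (w ! k)"
      using *[unfolded reduced_word_def, rule_format, of "Suc k"] by simp
  qed
  moreover have "w \<noteq> [] \<longrightarrow> hd w \<noteq> inv_letter a"
    using *[unfolded reduced_word_def, rule_format, of 0] by (auto simp: hd_conv_nth)
  ultimately show "reduced_word w \<and> (w \<noteq> [] \<longrightarrow> hd w \<noteq> inv_letter a)" by simp
next
  assume *: "reduced_word w \<and> (w \<noteq> [] \<longrightarrow> hd w \<noteq> inv_letter a)"
  show "reduced_word (a # w)"
    unfolding reduced_word_def
  proof (intro allI impI)
    fix k assume "Suc k < length (a # w)"
    then show "(a # w) ! Suc k \<noteq> inv_letter ((a # w) ! k)"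
      using * by (cases k) (auto simp: reduced_word_def hd_conv_nth)
  qed
qed

lemma reduced_cons_red: "reduced_word w \<Longrightarrow> reduced_word (cons_red a w)"
  by (cases w) (auto simp: reduced_word_Cons)

lemma cons_red_cancel: "reduced_word w \<Longrightarrow> cons_red a (cons_red (inv_letter a) w) = w"
  by (cases w; cases "tl w") (auto simp: reduced_word_Cons)

lemma cons_red_reduced: "reduced_word (a # w) \<Longrightarrow> cons_red a w = a # w"
  by (cases w) (auto simp: reduced_word_Cons)

lemma set_cons_red: "set (cons_red a w) \<subseteq> insert a (set w)"
  by (cases w) auto

lemma reduced_foldr_cons_red: "reduced_word v \<Longrightarrow> reduced_word (foldr cons_red u v)"
  by (induction u) (auto intro: reduced_cons_red)

lemma set_foldr_cons_red: "set (foldr cons_red u v) \<subseteq> set u \<union> set v"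
  by (induction u) (use set_cons_red in fastforce)+

lemma foldr_cons_red_Nil: "reduced_word u \<Longrightarrow> foldr cons_red u [] = u"
  by (induction u) (auto simp: reduced_word_Cons cons_red_reduced)

lemma foldr_cons_red_cons_red:
  assumes "reduced_word v" "reduced_word w"
  shows "foldr cons_red (cons_red a v) w = cons_red a (foldr cons_red v w)"
proof (cases v)
  case (Cons b v')
  then show ?thesis
    using cons_red_cancel[of "foldr cons_red v' w" a] reduced_foldr_cons_red[OF assms(2), of v']
    by auto
qed simp

lemma foldr_cons_red_assoc:
  assumes "reduced_word v" "reduced_word w"
  shows "foldr cons_red (foldr cons_red u v) w = foldr cons_red u (foldr cons_red v w)"
  by (induction u)
    (use assms in \<open>auto simp: foldr_cons_red_cons_red reduced_foldr_cons_red\<close>)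

lemma foldr_cons_red_inverse:
  assumes "reduced_word v"
  shows "foldr cons_red (rev (map inv_letter u)) (foldr cons_red u v) = v"
  using assms
proof (induction u arbitrary: v)
  case (Cons a u)
  then show ?case
    using cons_red_cancel[of "foldr cons_red u v" "inv_letter a"]
      reduced_foldr_cons_red[of v u] by simp
qed simp

lemma group_free_group: "group (free_group r)"
proof (rule groupI)
  fix w assume w: "w \<in> carrier (free_group r)"
  let ?v = "foldr cons_red (rev (map inv_letter w)) []"
  have v: "?v \<in> carrier (free_group r)"
    using w set_foldr_cons_red[of "rev (map inv_letter w)" "[]"]
    by (fastforce simp: free_group_def reduced_foldr_cons_red)
  have "foldr cons_red ?v w = foldr cons_red (rev (map inv_letter w)) (foldr cons_red w [])"
    using w foldr_cons_red_assoc[of "[]" w "rev (map inv_letter w)"]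
    by (simp add: free_group_def foldr_cons_red_Nil)
  then have "?v \<otimes>\<^bsub>free_group r\<^esub> w = \<one>\<^bsub>free_group r\<^esub>"
    using foldr_cons_red_inverse[of "[]" w] by (simp add: free_group_def)
  then show "\<exists>v\<in>carrier (free_group r). v \<otimes>\<^bsub>free_group r\<^esub> w = \<one>\<^bsub>free_group r\<^esub>"
    using v by blast
next
  fix u v assume "u \<in> carrier (free_group r)" "v \<in> carrier (free_group r)"
  then show "u \<otimes>\<^bsub>free_group r\<^esub> v \<in> carrier (free_group r)"
    using set_foldr_cons_red[of u v] by (auto simp: free_group_def reduced_foldr_cons_red)
qed (auto simp: free_group_def foldr_cons_red_assoc)

text \<open>The value \<open>w(g\<^sub>0, \<dots>, g\<^sub>r\<^sub>-\<^sub>1)\<close> of a word in a group.\<close>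

definition word_eval :: "'a monoid \<Rightarrow> letter list \<Rightarrow> (nat \<Rightarrow> 'a) \<Rightarrow> 'a" where
  "word_eval G w g =
     foldr (\<lambda>(i, b) x. (if b then g i else inv\<^bsub>G\<^esub> (g i)) \<otimes>\<^bsub>G\<^esub> x) w \<one>\<^bsub>G\<^esub>"

section \<open>Square length and commutator length\<close>

text \<open>The infimum of the empty set is \<open>\<infinity>\<close>; the identity is the empty product.\<close>

definition product_length :: "'a monoid \<Rightarrow> 'a set \<Rightarrow> 'a \<Rightarrow> enat" where
  "product_length G S x =
     Inf {enat (length us) | us. set us \<subseteq> S \<and> foldr (\<otimes>\<^bsub>G\<^esub>) us \<one>\<^bsub>G\<^esub> = x}"

definition sql :: "nat \<Rightarrow> letter list \<Rightarrow> enat" where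
  "sql r w = product_length (free_group r)
     {u \<otimes>\<^bsub>free_group r\<^esub> u | u. u \<in> carrier (free_group r)} w"

definition cl :: "nat \<Rightarrow> letter list \<Rightarrow> enat" where
  "cl r w = product_length (free_group r)
     (derived_set (free_group r) (carrier (free_group r))) w"

section \<open>The orthogonal and the compact symplectic groups\<close>

definition trace_mat :: "'a::comm_monoid_add mat \<Rightarrow> 'a" where
  "trace_mat A = (\<Sum>i<dim_row A. A $$ (i, i))"

definition orthogonal_group :: "nat \<Rightarrow> real mat monoid" where
  "orthogonal_group n =
     \<lparr>carrier = {A \<in> carrier_mat n n. transpose_mat A * A = 1\<^sub>m n}, mult = (*), one = 1\<^sub>m n\<rparr>"

lemma group_orthogonal_group: "group (orthogonal_group n)"
proof (rule groupI)
  fix A B :: "real mat"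
  assume "A \<in> carrier (orthogonal_group n)" "B \<in> carrier (orthogonal_group n)"
  then have AB: "A \<in> carrier_mat n n" "B \<in> carrier_mat n n"
    "transpose_mat A * A = 1\<^sub>m n" "transpose_mat B * B = 1\<^sub>m n"
    by (auto simp: orthogonal_group_def)
  have "transpose_mat (A * B) * (A * B) = transpose_mat B * (transpose_mat A * A) * B"
    using AB(1,2) by (simp add: transpose_mult[OF AB(1,2)] assoc_mult_mat[of _ n n _ n _ n])
  then show "A \<otimes>\<^bsub>orthogonal_group n\<^esub> B \<in> carrier (orthogonal_group n)"
    using AB by (simp add: orthogonal_group_def)
next
  fix A :: "real mat" assume "A \<in> carrier (orthogonal_group n)"
  then have A: "A \<in> carrier_mat n n" "transpose_mat A * A = 1\<^sub>m n"
    by (auto simp: orthogonal_group_def)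
  then have "A * transpose_mat A = 1\<^sub>m n"
    using mat_mult_left_right_inverse[of "transpose_mat A" n A] by simp
  with A show "\<exists>B\<in>carrier (orthogonal_group n). B \<otimes>\<^bsub>orthogonal_group n\<^esub> A = \<one>\<^bsub>orthogonal_group n\<^esub>"
    by (intro bexI[of _ "transpose_mat A"]) (auto simp: orthogonal_group_def)
qed (auto simp: orthogonal_group_def)

definition J_mat :: "nat \<Rightarrow> complex mat" where
  "J_mat n = four_block_mat (0\<^sub>m n n) (1\<^sub>m n) (- 1\<^sub>m n) (0\<^sub>m n n)"

definition symplectic_group :: "nat \<Rightarrow> complex mat monoid" where
  "symplectic_group n =
     \<lparr>carrier = {A \<in> carrier_mat (2 * n) (2 * n).
        mat_adjoint A * A = 1\<^sub>m (2 * n) \<and> transpose_mat A * J_mat n * A = J_mat n},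
      mult = (*), one = 1\<^sub>m (2 * n)\<rparr>"

lemma J_mat_carrier: "J_mat n \<in> carrier_mat (2 * n) (2 * n)"
  by (simp add: J_mat_def mult_2)

lemma mat_adjoint_carrier: "A \<in> carrier_mat m n \<Longrightarrow> mat_adjoint A \<in> carrier_mat n m"
  unfolding mat_adjoint_def by (metis carrier_matD cols_length length_map mat_of_rows_carrier(1))

lemma mat_adjoint_index:
  assumes "A \<in> carrier_mat m n" "i < n" "j < m"
  shows "mat_adjoint A $$ (i, j) = conjugate (A $$ (j, i))"
  using assms by (simp add: mat_adjoint_def mat_of_rows_index)

lemma mat_adjoint_mult:
  assumes A: "A \<in> carrier_mat n n" and B: "B \<in> carrier_mat n n"
  shows "mat_adjoint (A * B) = mat_adjoint B * mat_adjoint A"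
proof (rule eq_matI)
  have C: "mat_adjoint A \<in> carrier_mat n n" "mat_adjoint B \<in> carrier_mat n n"
    "mat_adjoint (A * B) \<in> carrier_mat n n"
    using A B by (auto intro!: mat_adjoint_carrier)
  then show "dim_row (mat_adjoint (A * B)) = dim_row (mat_adjoint B * mat_adjoint A)"
    "dim_col (mat_adjoint (A * B)) = dim_col (mat_adjoint B * mat_adjoint A)"
    by auto
  fix i j assume "i < dim_row (mat_adjoint B * mat_adjoint A)"
    "j < dim_col (mat_adjoint B * mat_adjoint A)"
  then have ij: "i < n" "j < n" using C by auto
  have "mat_adjoint (A * B) $$ (i, j) = conjugate (\<Sum>k<n. A $$ (j, k) * B $$ (k, i))"
    using A B ij
    by (simp add: mat_adjoint_index[of _ n n] scalar_prod_def atLeast0LessThan)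
  also have "\<dots> = (\<Sum>k<n. conjugate (B $$ (k, i)) * conjugate (A $$ (j, k)))"
    by (simp add: sum_conjugate conjugate_dist_mul mult.commute)
  also have "\<dots> = (mat_adjoint B * mat_adjoint A) $$ (i, j)"
    using A B C ij
    by (simp add: scalar_prod_def atLeast0LessThan mat_adjoint_index[of _ n n])
  finally show "mat_adjoint (A * B) $$ (i, j) = (mat_adjoint B * mat_adjoint A) $$ (i, j)" .
qed

lemma mat_adjoint_mat_adjoint: "A \<in> carrier_mat n n \<Longrightarrow> mat_adjoint (mat_adjoint A) = A"
  using mat_adjoint_carrier[of A n n] mat_adjoint_carrier[of "mat_adjoint A" n n]
  by (intro eq_matI) (auto simp: mat_adjoint_index[of _ n n])

lemma mat_adjoint_one: "mat_adjoint (1\<^sub>m n :: complex mat) = 1\<^sub>m n"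
  using mat_adjoint_carrier[of "1\<^sub>m n :: complex mat" n n]
  by (intro eq_matI) (auto simp: mat_adjoint_index[of _ n n])

lemma group_symplectic_group: "group (symplectic_group n)"
proof (rule groupI)
  fix A B :: "complex mat"
  assume "A \<in> carrier (symplectic_group n)" "B \<in> carrier (symplectic_group n)"
  then have AB: "A \<in> carrier_mat (2 * n) (2 * n)" "B \<in> carrier_mat (2 * n) (2 * n)"
    "mat_adjoint A * A = 1\<^sub>m (2 * n)" "mat_adjoint B * B = 1\<^sub>m (2 * n)"
    "transpose_mat A * J_mat n * A = J_mat n" "transpose_mat B * J_mat n * B = J_mat n"
    by (auto simp: symplectic_group_def)
  note C = AB(1,2) AB(1,2)[THEN mat_adjoint_carrier] J_mat_carrier[of n]
  have "mat_adjoint (A * B) * (A * B) = mat_adjoint B * (mat_adjoint A * A) * B"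
    using C by (simp add: mat_adjoint_mult[OF AB(1,2)]
        assoc_mult_mat[of _ "2 * n" "2 * n" _ "2 * n" _ "2 * n"])
  moreover have "transpose_mat (A * B) * J_mat n * (A * B)
      = transpose_mat B * (transpose_mat A * J_mat n * A) * B"
    using C by (simp add: transpose_mult[OF AB(1,2)]
        assoc_mult_mat[of _ "2 * n" "2 * n" _ "2 * n" _ "2 * n"])
  ultimately show "A \<otimes>\<^bsub>symplectic_group n\<^esub> B \<in> carrier (symplectic_group n)"
    using AB C by (simp add: symplectic_group_def)
next
  fix A :: "complex mat" assume "A \<in> carrier (symplectic_group n)"
  then have A: "A \<in> carrier_mat (2 * n) (2 * n)" "mat_adjoint A * A = 1\<^sub>m (2 * n)"
    "transpose_mat A * J_mat n * A = J_mat n"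
    by (auto simp: symplectic_group_def)
  define X where "X = mat_adjoint A"
  note C = A(1) mat_adjoint_carrier[OF A(1), folded X_def] J_mat_carrier[of n]
  have AX: "A * X = 1\<^sub>m (2 * n)"
    using mat_mult_left_right_inverse[of X "2 * n" A] A C by (simp add: X_def)
  have "transpose_mat X * J_mat n * X
      = transpose_mat X * (transpose_mat A * J_mat n * A) * X"
    by (simp add: A(3))
  also have "\<dots> = transpose_mat X * transpose_mat A * J_mat n * (A * X)"
    using C by (simp add: assoc_mult_mat[of _ "2 * n" "2 * n" _ "2 * n" _ "2 * n"])
  also have "\<dots> = transpose_mat (A * X) * J_mat n * (A * X)"
    using transpose_mult[OF C(1,2)] by simp
  also have "\<dots> = J_mat n" using C by (simp add: AX)
  finally show "\<exists>B\<in>carrier (symplectic_group n). B \<otimes>\<^bsub>symplectic_group n\<^esub> A = \<one>\<^bsub>symplectic_group n\<^esub>"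
    using A C AX
    by (intro bexI[of _ X]) (auto simp: symplectic_group_def X_def mat_adjoint_mat_adjoint)
qed (auto simp: symplectic_group_def mat_adjoint_one J_mat_carrier
      intro: assoc_mult_mat left_mult_one_mat right_mult_one_mat
      simp: left_mult_one_mat[OF J_mat_carrier] right_mult_one_mat[OF J_mat_carrier])

section \<open>Haar measure and expected traces\<close>

text \<open>The Borel sets of the space of \<open>N \<times> N\<close> matrices, identified with a product of
  \<open>N\<^sup>2\<close> copies of the scalars by means of the matrix entries.\<close>

definition borel_mat :: "nat \<Rightarrow> 'a::topological_space mat measure" where
  "borel_mat N = vimage_algebra (carrier_mat N N)
     (\<lambda>A. \<lambda>ij\<in>{..<N} \<times> {..<N}. A $$ ij) (\<Pi>\<^sub>M ij\<in>{..<N} \<times> {..<N}. borel)"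

text \<open>A Haar probability measure on a group \<open>G\<close> of \<open>N \<times> N\<close> matrices: a left-invariant Borel
  probability measure. For compact \<open>G\<close> this determines the measure.\<close>

definition haar_prob :: "nat \<Rightarrow> 'a::topological_space mat monoid \<Rightarrow> 'a mat measure \<Rightarrow> bool" where
  "haar_prob N G \<mu> \<longleftrightarrow> prob_space \<mu> \<and> sets \<mu> = sets (restrict_space (borel_mat N) (carrier G)) \<and>
     (\<forall>h\<in>carrier G. distr \<mu> \<mu> (\<lambda>g. h \<otimes>\<^bsub>G\<^esub> g) = \<mu>)"

definition expected_trace ::
  "'a::{banach, second_countable_topology} mat monoid \<Rightarrow> 'a mat measure \<Rightarrow> nat
     \<Rightarrow> letter list \<Rightarrow> 'a" where
  "expected_trace G \<mu> r w = (LINT g | (\<Pi>\<^sub>M i\<in>{..<r}. \<mu>). trace_mat (word_eval G w g))"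

end

(* The expectations E[tr(w_1) ... tr(w_k)] satisfy loop equations, obtained by differentiating
   along Cayley transforms of Lie algebra elements: up to a factor of order N, such an expectation
   is a signed sum of expectations for families in which two words have been merged, or a word has
   been split or twisted at two occurrences of a generator. Each term of the equation is a way to
   attach a 1-handle: if its family bounds a surface of Euler characteristic e, then the original
   family bounds a surface of Euler characteristic e - 1. Splitting words lowers the sum of the
   squares of the lengths, merging and twisting gain a power of N over the trivial bound N^k, so
   the equations can be iterated, and E[tr(w_1) ... tr(w_k)] = O(N^e) for the largest Euler
   characteristic e of a surface bounded by the family. For a single word w this is
   e = 1 - min(sql w, 2 cl w). If w is not a product of squares, then some generator occurs in it an
   odd number of times and the invariance under g_i -> - g_i makes the integral vanish. *)

theory Submission
  imports Defs
begin

text \<open>The factor of order N has a concrete source: normalize a word so that it begins with a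
  generator, and cut in front of that letter. Splitting there produces an empty word, of trace N;
  twisting there produces the inverse word, of equal trace, with sign \<open>- eps\<close>. Together
  they contribute N - eps times the original expectation. The functions differentiated are
  \<open>w_ab tr(v_1) ... tr(v_k)\<close>, in the direction of the matrix unit at (a, b) minus its
  adjoint for the form, summed over all a and b. Such directions in general lie only in the
  complexified Lie algebra, whereas curves in the group exist only for real directions. The
  derivative is therefore kept as an explicit linear form in the direction, whose coefficients are
  integrated once and for all. A Cayley transform satisfies \<open>h = 1 + H + h H\<close>.
  Inserting this equation into itself gives an expansion with a uniform quadratic remainder, so the
  derivative can be integrated by elementary estimates. Surfaces enter as relations in the free
  group: a connected piece says that a product of conjugated boundary words is a product of squares
  or of commutators, and each 1-handle is an identity between words.\<close>

section \<open>Products of squares and commutators\<close>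

locale monoid_group = group G for G :: "'a monoid" (structure)
begin

lemma inv_mult_cancel: "x \<in> carrier G \<Longrightarrow> y \<in> carrier G \<Longrightarrow> inv x \<otimes> (x \<otimes> y) = y"
  by (simp flip: m_assoc)

lemma mult_inv_cancel: "x \<in> carrier G \<Longrightarrow> y \<in> carrier G \<Longrightarrow> x \<otimes> (inv x \<otimes> y) = y"
  by (simp flip: m_assoc)

lemmas group_simps = m_assoc inv_mult_group inv_mult_cancel mult_inv_cancel

primrec prods :: "'a set \<Rightarrow> nat \<Rightarrow> 'a set" where
  "prods S 0 = {\<one>}"
| "prods S (Suc n) = {s \<otimes> x | s x. s \<in> S \<and> x \<in> prods S n}"

lemma product_length_le:
  assumes "x \<in> prods S n"
  shows "product_length G S x \<le> enat n"
proof -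
  have "\<exists>us. set us \<subseteq> S \<and> length us = n \<and> foldr (\<otimes>) us \<one> = x"
    using assms
  proof (induction n arbitrary: x)
    case (Suc n)
    then obtain s y where sy: "x = s \<otimes> y" "s \<in> S" "y \<in> prods S n" by auto
    obtain us where "set us \<subseteq> S" "length us = n" "foldr (\<otimes>) us \<one> = y"
      using Suc.IH[OF sy(3)] by auto
    with sy show ?case by (intro exI[of _ "s # us"]) auto
  qed auto
  then show ?thesis
    unfolding product_length_def by (auto intro!: Inf_lower)
qed

definition conj_inv_closed :: "'a set \<Rightarrow> bool" where
  "conj_inv_closed S \<longleftrightarrow> S \<subseteq> carrier G \<and>
     (\<forall>s\<in>S. inv s \<in> S \<and> (\<forall>c\<in>carrier G. c \<otimes> s \<otimes> inv c \<in> S))"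

lemma prods_carrier: "conj_inv_closed S \<Longrightarrow> x \<in> prods S n \<Longrightarrow> x \<in> carrier G"
  by (induction n arbitrary: x) (auto simp: conj_inv_closed_def)

lemma prods_conj:
  assumes S: "conj_inv_closed S" and c: "c \<in> carrier G" and x: "x \<in> prods S n"
  shows "c \<otimes> x \<otimes> inv c \<in> prods S n"
  using x
proof (induction n arbitrary: x)
  case (Suc n)
  then obtain s y where sy: "x = s \<otimes> y" "s \<in> S" "y \<in> prods S n" by auto
  have "c \<otimes> x \<otimes> inv c = (c \<otimes> s \<otimes> inv c) \<otimes> (c \<otimes> y \<otimes> inv c)"
    using S c sy prods_carrier[OF S sy(3)] by (auto simp: group_simps conj_inv_closed_def)
  moreover have "c \<otimes> s \<otimes> inv c \<in> S" using S c sy by (auto simp: conj_inv_closed_def)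
  ultimately show ?case using Suc.IH[OF sy(3)] by auto
qed (use c in auto)

lemma prods_mult:
  assumes S: "conj_inv_closed S" and "x \<in> prods S m" "y \<in> prods S n"
  shows "x \<otimes> y \<in> prods S (m + n)"
  using assms(2)
proof (induction m arbitrary: x)
  case 0
  then show ?case using assms(3) prods_carrier[OF S] by auto
next
  case (Suc m)
  then obtain s z where sz: "x = s \<otimes> z" "s \<in> S" "z \<in> prods S m" by auto
  then have "x \<otimes> y = s \<otimes> (z \<otimes> y)"
    using prods_carrier[OF S] assms(3) S by (auto simp: m_assoc conj_inv_closed_def)
  then show ?case using Suc.IH[OF sz(3)] sz by auto
qed

lemma prods_one: "conj_inv_closed S \<Longrightarrow> s \<in> S \<Longrightarrow> s \<in> prods S 1"
  by (auto simp: conj_inv_closed_def subset_iff intro!: exI[of _ s])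

lemma prods_inv:
  assumes S: "conj_inv_closed S" and "x \<in> prods S m"
  shows "inv x \<in> prods S m"
  using assms(2)
proof (induction m arbitrary: x)
  case (Suc m)
  then obtain s z where sz: "x = s \<otimes> z" "s \<in> S" "z \<in> prods S m" by auto
  then have "inv x = inv z \<otimes> inv s"
    using prods_carrier[OF S] S by (auto simp: inv_mult_group conj_inv_closed_def)
  moreover have "inv s \<in> prods S 1"
    using prods_one[OF S] S sz by (auto simp: conj_inv_closed_def)
  ultimately show ?case using prods_mult[OF S Suc.IH[OF sz(3)], of "inv s" 1] by simp
qed auto

definition squares :: "'a set" where
  "squares = {u \<otimes> u | u. u \<in> carrier G}"

definition commutators :: "'a set" where
  "commutators = derived_set G (carrier G)"

lemma squares_closed: "conj_inv_closed squares"
proof -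
  have "\<exists>v. c \<otimes> (u \<otimes> u) \<otimes> inv c = v \<otimes> v \<and> v \<in> carrier G"
    if "c \<in> carrier G" "u \<in> carrier G" for c u
    using that by (intro exI[of _ "c \<otimes> u \<otimes> inv c"]) (simp add: group_simps)
  moreover have "\<exists>v. inv (u \<otimes> u) = v \<otimes> v \<and> v \<in> carrier G" if "u \<in> carrier G" for u
    using that by (intro exI[of _ "inv u"]) (simp add: group_simps)
  ultimately show ?thesis by (auto simp: conj_inv_closed_def squares_def)
qed

lemma commutatorsI:
  "a \<in> carrier G \<Longrightarrow> b \<in> carrier G \<Longrightarrow> x = a \<otimes> b \<otimes> inv a \<otimes> inv b \<Longrightarrow> x \<in> commutators"
  by (auto simp: commutators_def)

lemma commutatorsE:
  assumes "x \<in> commutators"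
  obtains a b where "a \<in> carrier G" "b \<in> carrier G" "x = a \<otimes> b \<otimes> inv a \<otimes> inv b"
  using assms by (auto simp: commutators_def)

lemma commutators_closed: "conj_inv_closed commutators"
  unfolding conj_inv_closed_def
proof (intro conjI ballI subsetI)
  fix x assume x: "x \<in> commutators"
  then obtain a b where ab: "a \<in> carrier G" "b \<in> carrier G" "x = a \<otimes> b \<otimes> inv a \<otimes> inv b"
    by (elim commutatorsE)
  show "x \<in> carrier G" using ab by simp
  show "inv x \<in> commutators"
    by (rule commutatorsI[of b a]) (use ab in \<open>simp_all add: group_simps\<close>)
  fix c assume c: "c \<in> carrier G"
  show "c \<otimes> x \<otimes> inv c \<in> commutators"
    by (rule commutatorsI[of "c \<otimes> a \<otimes> inv c" "c \<otimes> b \<otimes> inv c"])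
      (use ab c in \<open>simp_all add: group_simps\<close>)
qed

text \<open>Dyck's relation: a handle next to a crosscap is the same as three crosscaps.\<close>

lemma commutator_mult_square:
  assumes "k \<in> commutators" "s \<in> squares"
  shows "k \<otimes> s \<in> prods squares 3"
proof -
  obtain a b where ab: "a \<in> carrier G" "b \<in> carrier G" "k = a \<otimes> b \<otimes> inv a \<otimes> inv b"
    using assms(1) by (elim commutatorsE)
  obtain c where c: "c \<in> carrier G" "s = c \<otimes> c" using assms(2) by (auto simp: squares_def)
  \<comment> \<open>With \<open>t = c \<otimes> inv a\<close>, the three roots are
    \<open>k t\<close>, \<open>inv t b\<close> and \<open>inv b c\<close>. Then
    \<open>u v = a b (inv a)\<close> and \<open>v x = a\<close>, so the product
    \<open>u (u v) (v x) x\<close> collapses to \<open>u a c = k c c\<close>.\<close>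
  define u where "u = a \<otimes> b \<otimes> inv a \<otimes> inv b \<otimes> c \<otimes> inv a"
  define v where "v = a \<otimes> inv c \<otimes> b"
  define x where "x = inv b \<otimes> c"
  have C: "u \<in> carrier G" "v \<in> carrier G" "x \<in> carrier G" using ab c by (simp_all add: u_def v_def x_def)
  have "k \<otimes> s = (u \<otimes> u) \<otimes> ((v \<otimes> v) \<otimes> ((x \<otimes> x) \<otimes> \<one>))"
    using ab c by (simp add: u_def v_def x_def group_simps)
  moreover have "u \<otimes> u \<in> squares" "v \<otimes> v \<in> squares" "x \<otimes> x \<in> squares"
    using C by (auto simp: squares_def)
  ultimately show ?thesis unfolding numeral_3_eq_3 prods.simps by blast
qed

text \<open>Each commutator is traded for two additional squares by Dyck's relation. The relation
  consumes and returns a neighbouring square, which is why one must be present from the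
  start.\<close>

lemma commutators_mult_squares:
  assumes "k \<in> prods commutators g" "s \<in> prods squares h" "h \<ge> 1"
  shows "k \<otimes> s \<in> prods squares (2 * g + h)"
  using assms(1)
proof (induction g arbitrary: k)
  case 0
  then show ?case using assms(2) prods_carrier[OF squares_closed assms(2)] by simp
next
  case (Suc g)
  then obtain a k' where k: "k = a \<otimes> k'" "a \<in> commutators" "k' \<in> prods commutators g" by auto
  have C: "a \<in> carrier G" "k' \<in> carrier G" "s \<in> carrier G"
    using k commutators_closed prods_carrier[OF commutators_closed k(3)]
      prods_carrier[OF squares_closed assms(2)] by (auto simp: conj_inv_closed_def)
  have "k' \<otimes> s \<in> prods squares (Suc (2 * g + h - 1))" using Suc.IH[OF k(3)] assms(3) by simp
  then obtain c y where y: "k' \<otimes> s = c \<otimes> y" "c \<in> squares" "y \<in> prods squares (2 * g + h - 1)"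
    by auto
  have C': "c \<in> carrier G" "y \<in> carrier G"
    using y squares_closed prods_carrier[OF squares_closed y(3)] by (auto simp: conj_inv_closed_def)
  have "k \<otimes> s = (a \<otimes> c) \<otimes> y" using C C' y k by (simp add: m_assoc)
  also have "\<dots> \<in> prods squares (3 + (2 * g + h - 1))"
    by (intro prods_mult[OF squares_closed] commutator_mult_square k y)
  finally show ?case using assms(3) by (simp add: numeral_3_eq_3)
qed

text \<open>The boundary words of a connected surface of Euler characteristic \<open>1 - m\<close> with one
  boundary circle.\<close>

definition disc_boundary :: "nat \<Rightarrow> 'a set" where
  "disc_boundary m = {x. (m \<ge> 1 \<and> x \<in> prods squares m) \<or> (\<exists>g. m = 2 * g \<and> x \<in> prods commutators g)}"

lemma disc_boundary_carrier: "x \<in> disc_boundary m \<Longrightarrow> x \<in> carrier G"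
  using prods_carrier squares_closed commutators_closed by (auto simp: disc_boundary_def)

lemma disc_boundary_conj:
  "x \<in> disc_boundary m \<Longrightarrow> c \<in> carrier G \<Longrightarrow> c \<otimes> x \<otimes> inv c \<in> disc_boundary m"
  using prods_conj squares_closed commutators_closed by (auto simp: disc_boundary_def)

lemma disc_boundary_inv: "x \<in> disc_boundary m \<Longrightarrow> inv x \<in> disc_boundary m"
  using prods_inv squares_closed commutators_closed by (auto simp: disc_boundary_def)

text \<open>Boundary connected sum: the genus is additive. If exactly one of the two surfaces is
  given by squares, its crosscaps absorb the handles of the other.\<close>

lemma disc_boundary_mult:
  assumes "x \<in> disc_boundary m" "y \<in> disc_boundary n"
  shows "x \<otimes> y \<in> disc_boundary (m + n)"
proof -
  have C: "x \<in> carrier G" "y \<in> carrier G" using assms by (auto intro: disc_boundary_carrier)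
  consider "m \<ge> 1" "x \<in> prods squares m" "n \<ge> 1" "y \<in> prods squares n"
    | g where "m = 2 * g" "x \<in> prods commutators g" "n \<ge> 1" "y \<in> prods squares n"
    | g where "m \<ge> 1" "x \<in> prods squares m" "n = 2 * g" "y \<in> prods commutators g"
    | g h where "m = 2 * g" "x \<in> prods commutators g" "n = 2 * h" "y \<in> prods commutators h"
    using assms by (auto simp: disc_boundary_def)
  then show ?thesis
  proof cases
    case 1
    then show ?thesis by (auto simp: disc_boundary_def intro: prods_mult[OF squares_closed])
  next
    case 2
    then show ?thesis using commutators_mult_squares by (auto simp: disc_boundary_def)
  next
    case 3
    \<comment> \<open>Conjugation moves the commutators to the left of the squares, where they can
      be absorbed.\<close>
    have "x \<otimes> y = (x \<otimes> y \<otimes> inv x) \<otimes> x" using C by (simp add: group_simps)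
    also have "\<dots> \<in> prods squares (2 * g + m)"
      by (intro commutators_mult_squares prods_conj[OF commutators_closed] C 3)
    finally show ?thesis using 3 by (auto simp: disc_boundary_def add.commute)
  next
    case 4
    then have "x \<otimes> y \<in> prods commutators (g + h)" by (auto intro: prods_mult[OF commutators_closed])
    moreover have "m + n = 2 * (g + h)" using 4 by simp
    ultimately show ?thesis unfolding disc_boundary_def by blast
  qed
qed

lemma product_length_le_if_disc_boundary:
  assumes "x \<in> disc_boundary m"
  shows "min (product_length G squares x) (2 * product_length G commutators x) \<le> enat m"
proof -
  consider "x \<in> prods squares m" | g where "m = 2 * g" "x \<in> prods commutators g"
    using assms by (auto simp: disc_boundary_def)
  then show ?thesis
  proof cases
    case 1
    then show ?thesis using product_length_le by (auto simp: min_le_iff_disj)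
  next
    case 2
    have "2 * product_length G commutators x \<le> 2 * enat g"
      by (intro mult_left_mono product_length_le 2) auto
    also have "\<dots> = enat m" using 2 by (simp add: numeral_eq_enat)
    finally show ?thesis by (auto simp: min_le_iff_disj)
  qed
qed

section \<open>Families of boundary words of surfaces\<close>

definition conj_inv_rel :: "'a \<Rightarrow> 'a \<Rightarrow> bool" where
  "conj_inv_rel a b \<longleftrightarrow> a \<in> carrier G \<and>
     (\<exists>c\<in>carrier G. b = c \<otimes> a \<otimes> inv c \<or> b = c \<otimes> inv a \<otimes> inv c)"

lemma conj_inv_rel_carrier: "conj_inv_rel a b \<Longrightarrow> a \<in> carrier G \<and> b \<in> carrier G"
  by (auto simp: conj_inv_rel_def)

lemma conj_inv_rel_conjI: "a \<in> carrier G \<Longrightarrow> c \<in> carrier G \<Longrightarrow> b = c \<otimes> a \<otimes> inv c \<Longrightarrow> conj_inv_rel a b"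
  by (auto simp: conj_inv_rel_def)

lemma conj_inv_rel_invI: "a \<in> carrier G \<Longrightarrow> c \<in> carrier G \<Longrightarrow> b = c \<otimes> inv a \<otimes> inv c \<Longrightarrow> conj_inv_rel a b"
  by (auto simp: conj_inv_rel_def)

lemma conj_inv_rel_refl: "a \<in> carrier G \<Longrightarrow> conj_inv_rel a a"
  by (rule conj_inv_rel_conjI[of _ \<one>]) auto

lemma conj_inv_rel_inv: "conj_inv_rel a b \<Longrightarrow> conj_inv_rel a (inv b)"
  unfolding conj_inv_rel_def by (auto simp: group_simps)

lemma conj_inv_rel_sym:
  assumes "conj_inv_rel a b"
  shows "conj_inv_rel b a"
proof -
  obtain c where c: "a \<in> carrier G" "c \<in> carrier G" "b = c \<otimes> a \<otimes> inv c \<or> b = c \<otimes> inv a \<otimes> inv c"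
    using assms by (auto simp: conj_inv_rel_def)
  then have "a = inv c \<otimes> b \<otimes> inv (inv c) \<or> a = inv c \<otimes> inv b \<otimes> inv (inv c)"
    by (auto simp: group_simps)
  moreover have "b \<in> carrier G" using c by auto
  ultimately show ?thesis using c(2) inv_closed unfolding conj_inv_rel_def by blast
qed

lemma conj_inv_rel_conj:
  assumes "conj_inv_rel a b" "d \<in> carrier G"
  shows "conj_inv_rel a (d \<otimes> b \<otimes> inv d)"
proof -
  obtain c where c: "a \<in> carrier G" "c \<in> carrier G" "b = c \<otimes> a \<otimes> inv c \<or> b = c \<otimes> inv a \<otimes> inv c"
    using assms by (auto simp: conj_inv_rel_def)
  then have "d \<otimes> b \<otimes> inv d = (d \<otimes> c) \<otimes> a \<otimes> inv (d \<otimes> c) \<or> d \<otimes> b \<otimes> inv d = (d \<otimes> c) \<otimes> inv a \<otimes> inv (d \<otimes> c)"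
    using assms(2) by (auto simp: group_simps)
  then show ?thesis using c assms(2) unfolding conj_inv_rel_def by blast
qed

lemma conj_inv_rel_trans:
  assumes "conj_inv_rel a b" "conj_inv_rel b c"
  shows "conj_inv_rel a c"
proof -
  obtain d where "d \<in> carrier G" "c = d \<otimes> b \<otimes> inv d \<or> c = d \<otimes> inv b \<otimes> inv d"
    using assms(2) by (auto simp: conj_inv_rel_def)
  then show ?thesis
    using conj_inv_rel_conj[OF assms(1)] conj_inv_rel_conj[OF conj_inv_rel_inv[OF assms(1)]] by auto
qed

text \<open>One representative is chosen from each class in \<open>C\<close>, up to conjugation and
  inversion. A multiset suffices, because exchanging two factors only conjugates one of
  them.\<close>

inductive conj_prod :: "'a multiset \<Rightarrow> 'a \<Rightarrow> bool" where
  empty: "conj_prod {#} \<one>"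
| add: "conj_prod C y \<Longrightarrow> conj_inv_rel a b \<Longrightarrow> conj_prod (add_mset a C) (b \<otimes> y)"

lemma conj_prod_carrier: "conj_prod C y \<Longrightarrow> y \<in> carrier G"
  by (induction rule: conj_prod.induct) (auto dest: conj_inv_rel_carrier)

text \<open>Any chosen class can be brought to the front:
  \<open>b c z = (b c (inv b)) (b z)\<close>, and the conjugate of \<open>c\<close> represents the
  same class.\<close>

lemma conj_prod_add_msetE:
  assumes "conj_prod (add_mset a C) y"
  obtains b z where "conj_inv_rel a b" "conj_prod C z" "y = b \<otimes> z"
proof -
  have "\<exists>b z. conj_inv_rel a b \<and> conj_prod C z \<and> y = b \<otimes> z"
    using assms
  proof (induction "add_mset a C" y arbitrary: C rule: conj_prod.induct)
    case (add D y a' b)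
    show ?case
    proof (cases "a' = a")
      case True
      then show ?thesis using add by auto
    next
      case False
      then obtain E where E: "D = add_mset a E" "C = add_mset a' E"
        using add(4) by (auto simp: add_eq_conv_ex)
      then obtain c z where c: "conj_inv_rel a c" "conj_prod E z" "y = c \<otimes> z"
        using add(2) by blast
      have carr: "b \<in> carrier G" "c \<in> carrier G" "z \<in> carrier G"
        using c add(3) conj_inv_rel_carrier conj_prod_carrier by auto
      have "b \<otimes> y = (b \<otimes> c \<otimes> inv b) \<otimes> (b \<otimes> z)" using carr c by (simp add: group_simps)
      moreover have "conj_inv_rel a (b \<otimes> c \<otimes> inv b)" using conj_inv_rel_conj c carr by blast
      moreover have "conj_prod C (b \<otimes> z)" using E c add(3) conj_prod.add by blast
      ultimately show ?thesis by blast
    qed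
  qed auto
  then show thesis using that by blast
qed

lemma conj_prod_conj:
  assumes "conj_prod C y" "d \<in> carrier G"
  shows "conj_prod C (d \<otimes> y \<otimes> inv d)"
  using assms(1)
proof (induction rule: conj_prod.induct)
  case empty
  then show ?case using assms(2) conj_prod.empty by auto
next
  case (add C y a b)
  have carr: "b \<in> carrier G" "y \<in> carrier G"
    using add conj_inv_rel_carrier conj_prod_carrier by auto
  have "d \<otimes> (b \<otimes> y) \<otimes> inv d = (d \<otimes> b \<otimes> inv d) \<otimes> (d \<otimes> y \<otimes> inv d)"
    using carr assms(2) by (simp add: group_simps)
  then show ?case using conj_prod.add[OF add(3) conj_inv_rel_conj[OF add(2) assms(2)]] by simp
qed

lemma conj_prod_mult:
  assumes "conj_prod C y" "conj_prod D z"
  shows "conj_prod (C + D) (y \<otimes> z)"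
  using assms(1)
proof (induction rule: conj_prod.induct)
  case empty
  then show ?case using assms(2) conj_prod_carrier by auto
next
  case (add C y a b)
  then show ?case
    using conj_prod.add[OF add(3) add(2)] conj_prod_carrier conj_inv_rel_carrier assms(2)
    by (auto simp: m_assoc)
qed

lemma conj_prod_single: "conj_inv_rel a b \<Longrightarrow> conj_prod {#a#} b"
  using conj_prod.add[OF conj_prod.empty, of a b] conj_inv_rel_carrier by auto

lemma conj_prod_inv: "conj_prod C y \<Longrightarrow> conj_prod C (inv y)"
proof (induction rule: conj_prod.induct)
  case empty
  then show ?case using conj_prod.empty by auto
next
  case (add C y a b)
  have "conj_prod (C + {#a#}) (inv y \<otimes> inv b)"
    by (intro conj_prod_mult add conj_prod_single conj_inv_rel_inv)
  then show ?case
    using add conj_inv_rel_carrier conj_prod_carrier by (auto simp: inv_mult_group)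
qed

text \<open>A map of a connected compact surface into a space with fundamental group
  \<open>G\<close>, read on the standard presentation: the product of the boundary loops, suitably
  conjugated and oriented, is a product of \<open>m\<close> squares or of \<open>m / 2\<close>
  commutators. The Euler characteristic of the surface is \<open>2 - size C - m\<close>.\<close>

definition bounds_connected :: "'a multiset \<Rightarrow> nat \<Rightarrow> bool" where
  "bounds_connected C m \<longleftrightarrow> (\<exists>y \<in> disc_boundary m. conj_prod C y)"

text \<open>The whole relation may be conjugated, and inverted if the orientation is wrong. So one
  boundary circle can be given a prescribed representative in front, at the cost of changing the
  product of the others.\<close>

lemma bounds_connected_normalize:
  assumes "bounds_connected (add_mset a C) m" "conj_inv_rel a b"
  obtains y where "conj_prod C y" "b \<otimes> y \<in> disc_boundary m"
proof -
  obtain z where z: "z \<in> disc_boundary m" "conj_prod (add_mset a C) z"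
    using assms(1) by (auto simp: bounds_connected_def)
  obtain a' y where a': "conj_inv_rel a a'" "conj_prod C y" "z = a' \<otimes> y"
    using z(2) by (elim conj_prod_add_msetE)
  have "conj_inv_rel b a'" using a' assms(2) conj_inv_rel_sym conj_inv_rel_trans by blast
  then obtain c where c: "b \<in> carrier G" "c \<in> carrier G"
      "a' = c \<otimes> b \<otimes> inv c \<or> a' = c \<otimes> inv b \<otimes> inv c"
    by (auto simp: conj_inv_rel_def)
  define d where "d = inv c"
  have d: "d \<in> carrier G" using c by (simp add: d_def)
  have yC: "y \<in> carrier G" using a' conj_prod_carrier by auto
  show thesis using c(3)
  proof
    assume e: "a' = c \<otimes> b \<otimes> inv c"
    have "d \<otimes> z \<otimes> inv d = b \<otimes> (d \<otimes> y \<otimes> inv d)"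
      unfolding a' e using c yC by (simp add: d_def group_simps)
    then show thesis using that[OF conj_prod_conj[OF a'(2) d]] disc_boundary_conj[OF z(1) d] by simp
  next
    assume e: "a' = c \<otimes> inv b \<otimes> inv c"
    \<comment> \<open>Inverting \<open>z\<close> puts the factor containing \<open>b\<close> last;
      conjugating by \<open>b d\<close> carries it to the front.\<close>
    define x where "x = b \<otimes> d"
    have x: "x \<in> carrier G" using c d by (simp add: x_def)
    have "x \<otimes> inv z \<otimes> inv x = b \<otimes> (d \<otimes> inv y \<otimes> inv d)"
      unfolding a' e x_def using c yC by (simp add: d_def group_simps)
    then show thesis
      using that[OF conj_prod_conj[OF conj_prod_inv[OF a'(2)] d]]
        disc_boundary_conj[OF disc_boundary_inv[OF z(1)] x] by simp
  qed
qed

lemma bounds_connectedI: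
  assumes "conj_prod C y" "b \<otimes> y \<in> disc_boundary m" "conj_inv_rel a b"
  shows "bounds_connected (add_mset a C) m"
  using assms conj_prod.add unfolding bounds_connected_def by blast

text \<open>A strip between two different components: the genus terms add, and two boundary circles
  become one.\<close>

lemma bounds_connected_join:
  assumes "bounds_connected (add_mset a C) m" "bounds_connected (add_mset b D) n"
    and a: "a \<in> carrier G" and b: "b \<in> carrier G"
  shows "bounds_connected (add_mset (a \<otimes> b) (C + D)) (m + n)"
proof -
  obtain y where y: "conj_prod C y" "a \<otimes> y \<in> disc_boundary m"
    using assms(1) conj_inv_rel_refl[OF a] by (elim bounds_connected_normalize)
  obtain z where z: "conj_prod D z" "b \<otimes> z \<in> disc_boundary n"
    using assms(2) conj_inv_rel_refl[OF b] by (elim bounds_connected_normalize)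
  have C: "y \<in> carrier G" "z \<in> carrier G" using y z conj_prod_carrier by auto
  have "(b \<otimes> z) \<otimes> (b \<otimes> (inv b \<otimes> (a \<otimes> y) \<otimes> b) \<otimes> inv b) \<in> disc_boundary (n + m)"
    using disc_boundary_mult[OF z(2) disc_boundary_conj[OF disc_boundary_conj[OF y(2), of "inv b"], of b]]
      a b C by (simp add: group_simps)
  then have "inv (b \<otimes> z) \<otimes> ((b \<otimes> z) \<otimes> (a \<otimes> y)) \<otimes> inv (inv (b \<otimes> z)) \<in> disc_boundary (n + m)"
    using a b C by (intro disc_boundary_conj) (simp_all add: group_simps)
  then have "(a \<otimes> y) \<otimes> (b \<otimes> z) \<in> disc_boundary (n + m)"
    using a b C by (simp add: group_simps)
  \<comment> \<open>Moving \<open>b\<close> to the left past \<open>y\<close> conjugates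
    \<open>y\<close>, which is still a product for the same classes.\<close>
  then have "(a \<otimes> b) \<otimes> ((inv b \<otimes> y \<otimes> inv (inv b)) \<otimes> z) \<in> disc_boundary (m + n)"
    using a b C by (simp add: group_simps add.commute)
  moreover have "conj_prod (C + D) ((inv b \<otimes> y \<otimes> inv (inv b)) \<otimes> z)"
    by (intro conj_prod_mult conj_prod_conj y z) (use b in auto)
  ultimately show ?thesis using a b by (intro bounds_connectedI) (auto intro: conj_inv_rel_refl)
qed

text \<open>A strip between two boundary circles of the same component creates a handle if their
  orientations agree, and two crosscaps otherwise. This is the factor \<open>k\<close>, by which the
  representative of \<open>b\<close> in the relation differs from \<open>b\<close>; it costs 2 in
  either case.\<close>

lemma bounds_connected_self_join:
  assumes "bounds_connected (add_mset a (add_mset b C)) m"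
    and a: "a \<in> carrier G" and b: "b \<in> carrier G"
  shows "bounds_connected (add_mset (a \<otimes> b) C) (m + 2)"
proof -
  obtain y where y: "conj_prod (add_mset b C) y" "a \<otimes> y \<in> disc_boundary m"
    using assms(1) conj_inv_rel_refl[OF a] by (elim bounds_connected_normalize)
  obtain b' z where z: "conj_inv_rel b b'" "conj_prod C z" "y = b' \<otimes> z"
    using y(1) by (elim conj_prod_add_msetE)
  obtain d where d: "d \<in> carrier G" "b' = d \<otimes> b \<otimes> inv d \<or> b' = d \<otimes> inv b \<otimes> inv d"
    using z(1) by (auto simp: conj_inv_rel_def)
  define k where "k = inv b \<otimes> b'"
  have zC: "z \<in> carrier G" using z conj_prod_carrier by auto
  have k: "k \<in> disc_boundary 2"
    using d(2)
  proof
    assume e: "b' = d \<otimes> b \<otimes> inv d"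
    have "k \<in> commutators"
      by (rule commutatorsI[of "inv b" d]) (use b d in \<open>simp_all add: k_def e group_simps\<close>)
    then have "k \<in> prods commutators 1" by (rule prods_one[OF commutators_closed])
    moreover have "2 = 2 * (1::nat)" by simp
    ultimately show ?thesis unfolding disc_boundary_def by blast
  next
    assume e: "b' = d \<otimes> inv b \<otimes> inv d"
    \<comment> \<open>The Klein bottle relation, rewritten as two squares.\<close>
    have "k = ((inv b \<otimes> d) \<otimes> (inv b \<otimes> d)) \<otimes> (inv d \<otimes> inv d)"
      using b d by (simp add: k_def e group_simps)
    also have "\<dots> \<in> prods squares (1 + 1)"
      by (intro prods_mult[OF squares_closed] prods_one[OF squares_closed])
        (use b d in \<open>auto simp: squares_def\<close>)
    finally have "k \<in> prods squares 2" by (simp only: one_add_one)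
    then show ?thesis by (simp add: disc_boundary_def)
  qed
  have kC: "k \<in> carrier G" using k disc_boundary_carrier by auto
  \<comment> \<open>Since \<open>y = b k z\<close>, the unwanted \<open>k\<close> is removed by
    multiplying on the right with a conjugate of its inverse.\<close>
  have "a \<otimes> b \<otimes> z = (a \<otimes> y) \<otimes> (inv z \<otimes> inv k \<otimes> inv (inv z))"
    using a b zC kC z(3) d by (auto simp: k_def group_simps)
  also have "\<dots> \<in> disc_boundary (m + 2)"
    by (intro disc_boundary_mult disc_boundary_conj disc_boundary_inv y k) (use zC in auto)
  finally show ?thesis using a b z by (intro bounds_connectedI) (auto intro: conj_inv_rel_refl)
qed

text \<open>A half-twisted strip attached to a single circle; the square
  \<open>v \<otimes> v\<close> is the crosscap that it adds.\<close>

lemma bounds_connected_crosscap: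
  assumes "bounds_connected (add_mset a C) m" "conj_inv_rel a b" "v \<in> carrier G"
  shows "bounds_connected (add_mset (v \<otimes> v \<otimes> b) C) (m + 1)"
proof -
  obtain y where y: "conj_prod C y" "b \<otimes> y \<in> disc_boundary m"
    using assms(1,2) by (elim bounds_connected_normalize)
  have C: "b \<in> carrier G" "y \<in> carrier G" using assms y conj_inv_rel_carrier conj_prod_carrier by auto
  have "v \<otimes> v \<in> disc_boundary 1"
    using prods_one[OF squares_closed, of "v \<otimes> v"] assms(3)
    by (auto simp: squares_def disc_boundary_def)
  from disc_boundary_mult[OF this y(2)]
  have "(v \<otimes> v \<otimes> b) \<otimes> y \<in> disc_boundary (m + 1)" using C assms(3) by (simp add: m_assoc)
  then show ?thesis using y(1) C assms(3) by (intro bounds_connectedI) (auto intro: conj_inv_rel_refl)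
qed

text \<open>An untwisted strip attached to a single circle cuts it in two. The genus term stays, and
  the additional circle lowers the Euler characteristic by one.\<close>

lemma bounds_connected_split:
  assumes "bounds_connected (add_mset (a \<otimes> b) C) m" "conj_inv_rel a' a" "conj_inv_rel b' b"
  shows "bounds_connected (add_mset a' (add_mset b' C)) m"
proof -
  have C: "a \<in> carrier G" "b \<in> carrier G" using assms conj_inv_rel_carrier by auto
  obtain y where y: "conj_prod C y" "(a \<otimes> b) \<otimes> y \<in> disc_boundary m"
    using assms(1) conj_inv_rel_refl[of "a \<otimes> b"] C by (elim bounds_connected_normalize) auto
  have "a \<otimes> (b \<otimes> y) \<in> disc_boundary m" using y C conj_prod_carrier by (simp add: m_assoc)
  then show ?thesis using conj_prod.add[OF y(1) assms(3)] assms(2) by (intro bounds_connectedI)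
qed

lemma bounds_connected_cong:
  assumes "bounds_connected (add_mset a C) m" "conj_inv_rel a b"
  shows "bounds_connected (add_mset b C) m"
proof -
  obtain y where "conj_prod C y" "b \<otimes> y \<in> disc_boundary m"
    using assms by (elim bounds_connected_normalize)
  then show ?thesis
    using assms(2) conj_inv_rel_carrier by (intro bounds_connectedI) (auto intro: conj_inv_rel_refl)
qed

text \<open>\<open>bounds W e\<close>: the family \<open>W\<close> of words bounds a surface of Euler characteristic \<open>e\<close>, each
  component of which has nonempty boundary. Words matter up to conjugation and inversion, since
  boundary circles have neither a base point nor a preferred orientation.\<close>

inductive bounds :: "'a multiset \<Rightarrow> int \<Rightarrow> bool" where
  empty: "bounds {#} 0"
| add: "bounds W e \<Longrightarrow> bounds_connected C m \<Longrightarrow> C \<noteq> {#} \<Longrightarrow>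
    bounds (C + W) (e + (2 - int (size C) - int m))"

lemma bounds_component:
  assumes "bounds W e" "a \<in># W"
  obtains C m W' e' where "bounds_connected (add_mset a C) m" "bounds W' e'"
    "W = add_mset a C + W'" "e = e' + (1 - int (size C) - int m)"
proof -
  have "\<exists>C m W' e'. bounds_connected (add_mset a C) m \<and> bounds W' e' \<and>
    W = add_mset a C + W' \<and> e = e' + (1 - int (size C) - int m)"
    using assms
  proof (induction rule: bounds.induct)
    case (add W e C m)
    show ?case
    proof (cases "a \<in># C")
      case True
      then obtain D where "C = add_mset a D" by (auto dest: multi_member_split)
      then show ?thesis using add by (intro exI[of _ D] exI[of _ m] exI[of _ W] exI[of _ e]) auto
    next
      case False
      then obtain D n W' e' where *: "bounds_connected (add_mset a D) n" "bounds W' e'"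
        "W = add_mset a D + W'" "e = e' + (1 - int (size D) - int n)"
        using add by auto
      then show ?thesis
        using bounds.add[OF *(2) add(2,3)]
        by (intro exI[of _ D] exI[of _ n] exI[of _ "C + W'"] exI[of _ "e' + (2 - int (size C) - int m)"])
          auto
    qed
  qed auto
  then show thesis using that by blast
qed

lemma bounds_addI:
  "bounds W e \<Longrightarrow> bounds_connected (add_mset a C) m \<Longrightarrow> V = add_mset a C + W \<Longrightarrow>
    e' = e + (1 - int (size C) - int m) \<Longrightarrow> bounds V e'"
  using bounds.add[of W e "add_mset a C" m] by (auto simp: algebra_simps elim: back_subst)

text \<open>The circles of \<open>a\<close> and \<open>b\<close> lie either on one component or on
  two; the strip lowers the Euler characteristic by one both times, through the genus in the first
  case and through the loss of a component in the second.\<close>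

lemma bounds_join:
  assumes "bounds (add_mset a (add_mset b W)) e" and a: "a \<in> carrier G" and b: "b \<in> carrier G"
  shows "bounds (add_mset (a \<otimes> b) W) (e - 1)"
proof -
  obtain C m W' e' where C: "bounds_connected (add_mset a C) m" "bounds W' e'"
    "add_mset a (add_mset b W) = add_mset a C + W'" "e = e' + (1 - int (size C) - int m)"
    by (rule bounds_component[OF assms(1), of a]) auto
  then have W: "add_mset b W = C + W'" by simp
  show ?thesis
  proof (cases "b \<in># C")
    case True
    then obtain D where D: "C = add_mset b D" by (auto dest: multi_member_split)
    have "bounds_connected (add_mset (a \<otimes> b) D) (m + 2)"
      using bounds_connected_self_join C(1) a b D by auto
    then show ?thesis
      by (rule bounds_addI[OF C(2)]) (use C D W in auto)
  next
    case False
    then have "b \<in># W'" using W by (metis union_iff union_single_eq_member)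
    then obtain D n V f where D: "bounds_connected (add_mset b D) n" "bounds V f"
      "W' = add_mset b D + V" "e' = f + (1 - int (size D) - int n)"
      using bounds_component[OF C(2)] by metis
    show ?thesis
      by (rule bounds_addI[OF D(2) bounds_connected_join[OF C(1) D(1) a b]]) (use C D W in auto)
  qed
qed

lemma bounds_crosscap:
  assumes "bounds (add_mset a W) e" "conj_inv_rel a b" "v \<in> carrier G"
  shows "bounds (add_mset (v \<otimes> v \<otimes> b) W) (e - 1)"
proof -
  obtain C m W' e' where C: "bounds_connected (add_mset a C) m" "bounds W' e'"
    "add_mset a W = add_mset a C + W'" "e = e' + (1 - int (size C) - int m)"
    by (rule bounds_component[OF assms(1), of a]) auto
  show ?thesis
    by (rule bounds_addI[OF C(2) bounds_connected_crosscap[OF C(1) assms(2,3)]]) (use C in auto)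
qed

lemma bounds_split:
  assumes "bounds (add_mset (a \<otimes> b) W) e" "conj_inv_rel a' a" "conj_inv_rel b' b"
  shows "bounds (add_mset a' (add_mset b' W)) (e - 1)"
proof -
  obtain C m W' e' where C: "bounds_connected (add_mset (a \<otimes> b) C) m" "bounds W' e'"
    "add_mset (a \<otimes> b) W = add_mset (a \<otimes> b) C + W'" "e = e' + (1 - int (size C) - int m)"
    by (rule bounds_component[OF assms(1), of "a \<otimes> b"]) auto
  show ?thesis
    by (rule bounds_addI[OF C(2) bounds_connected_split[OF C(1) assms(2,3)]]) (use C in auto)
qed

lemma bounds_cong:
  assumes "bounds (add_mset a W) e" "conj_inv_rel a b"
  shows "bounds (add_mset b W) e"
proof -
  obtain C m W' e' where C: "bounds_connected (add_mset a C) m" "bounds W' e'"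
    "add_mset a W = add_mset a C + W'" "e = e' + (1 - int (size C) - int m)"
    by (rule bounds_component[OF assms(1), of a]) auto
  show ?thesis
    by (rule bounds_addI[OF C(2) bounds_connected_cong[OF C(1) assms(2)]]) (use C in auto)
qed

lemma bounds_ones: "bounds (replicate_mset k \<one>) (int k)"
proof (induction k)
  case (Suc k)
  have "\<one> \<otimes> \<one> \<in> disc_boundary 0" by (auto simp: disc_boundary_def)
  then have "bounds_connected {#\<one>#} 0"
    by (intro bounds_connectedI[OF conj_prod.empty]) (auto intro: conj_inv_rel_refl)
  then show ?case using bounds.add[OF Suc, of "{#\<one>#}" 0] by (auto simp: add.commute)
qed (auto intro: bounds.empty)

text \<open>Every component has a boundary circle, so a surface with a single boundary circle is
  connected.\<close>

lemma bounds_single: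
  assumes "bounds {#w#} e"
  obtains m where "w \<in> disc_boundary m" "e = 1 - int m"
proof -
  obtain C m W' e' where C: "bounds_connected (add_mset w C) m" "bounds W' e'"
    "{#w#} = add_mset w C + W'" "e = e' + (1 - int (size C) - int m)"
    by (rule bounds_component[OF assms, of w]) auto
  then have e: "C = {#}" "W' = {#}" by auto
  have "e' = 0" using C(2) unfolding e by (cases rule: bounds.cases) auto
  obtain y where y: "conj_prod {#w#} y" "y \<in> disc_boundary m"
    using C(1) by (auto simp: e bounds_connected_def)
  then obtain b z where bz: "conj_inv_rel w b" "conj_prod {#} z" by (elim conj_prod_add_msetE) auto
  then have "w \<in> carrier G" using conj_inv_rel_carrier by auto
  obtain z where z: "conj_prod {#} z" "w \<otimes> z \<in> disc_boundary m"
    using C(1) conj_inv_rel_refl[OF \<open>w \<in> carrier G\<close>] unfolding e by (elim bounds_connected_normalize)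
  have "z = \<one>" using z(1) by (cases rule: conj_prod.cases) auto
  then show thesis using that[of m] z(2) \<open>w \<in> carrier G\<close> C(4) \<open>e' = 0\<close> e by simp
qed

end

section \<open>Words in the free group\<close>

interpretation free_group: monoid_group "free_group r" for r
  by (simp add: monoid_group_def group_free_group)

definition word_in :: "nat \<Rightarrow> letter list \<Rightarrow> bool" where
  "word_in r w \<longleftrightarrow> (\<forall>l\<in>set w. fst l < r)"

definition word_inv :: "letter list \<Rightarrow> letter list" where
  "word_inv w = rev (map inv_letter w)"

definition reduce :: "letter list \<Rightarrow> letter list" where
  "reduce w = foldr cons_red w []"

lemma word_in_simps [simp]:
  "word_in r []" "word_in r (l # w) \<longleftrightarrow> fst l < r \<and> word_in r w"
  "word_in r (u @ v) \<longleftrightarrow> word_in r u \<and> word_in r v" "word_in r (word_inv w) \<longleftrightarrow> word_in r w"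
  by (auto simp: word_in_def word_inv_def)

lemma word_inv_simps [simp]:
  "word_inv [] = []" "word_inv (l # w) = word_inv w @ [inv_letter l]"
  "word_inv (u @ v) = word_inv v @ word_inv u" "length (word_inv w) = length w"
  "word_inv (word_inv w) = w"
  by (auto simp: word_inv_def rev_map comp_def)

lemma reduce_carrier: "word_in r w \<Longrightarrow> reduce w \<in> carrier (free_group r)"
  using set_foldr_cons_red[of w "[]"] by (auto simp: reduce_def free_group_def word_in_def reduced_foldr_cons_red)

lemma reduce_Nil: "reduce [] = \<one>\<^bsub>free_group r\<^esub>"
  by (simp add: reduce_def free_group_def)

lemma reduce_append: "reduce (u @ v) = reduce u \<otimes>\<^bsub>free_group r\<^esub> reduce v"
  using foldr_cons_red_assoc[of "[]" "foldr cons_red v []" u]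
  by (simp add: reduce_def free_group_def reduced_foldr_cons_red)

lemma reduce_inv:
  assumes "word_in r w"
  shows "reduce (word_inv w) = inv\<^bsub>free_group r\<^esub> reduce w"
proof (rule free_group.inv_equality[symmetric])
  show "reduce (word_inv w) \<otimes>\<^bsub>free_group r\<^esub> reduce w = \<one>\<^bsub>free_group r\<^esub>"
    using foldr_cons_red_inverse[of "[]" w]
    unfolding reduce_append[symmetric] by (simp add: reduce_def word_inv_def free_group_def)
qed (use assms in \<open>auto intro: reduce_carrier\<close>)

lemma reduce_reduced: "w \<in> carrier (free_group r) \<Longrightarrow> reduce w = w"
  by (simp add: free_group_def reduce_def foldr_cons_red_Nil)

abbreviation square_prods :: "nat \<Rightarrow> nat \<Rightarrow> letter list set" where
  "square_prods r \<equiv> free_group.prods r (free_group.squares r)"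

text \<open>Pair the first letter \<open>a\<close> with another occurrence of its generator:
  \<open>a p a q = (a p)^2 (p^{-1} q)\<close> and
  \<open>a p a^{-1} q = (a p)^2 (p^{-1} a^{-1} p)^2 (p^{-1} q)\<close>. The remaining word
  \<open>p^{-1} q\<close> is two letters shorter, and every generator keeps its parity in
  it.\<close>

lemma prods_squares_if_even:
  assumes "word_in r w" "\<And>i. even (length (filter (\<lambda>l. fst l = i) w))"
  shows "\<exists>h. reduce w \<in> square_prods r h"
  using assms
proof (induction "length w" arbitrary: w rule: less_induct)
  let ?G = "free_group r"
  case less
  note S = free_group.squares_closed[of r]
  show ?case
  proof (cases w)
    case Nil
    then show ?thesis by (intro exI[of _ 0]) (simp add: reduce_Nil[of r])
  next
    case (Cons a u)
    have "odd (length (filter (\<lambda>l. fst l = fst a) u))" using less(3)[of "fst a"] Cons by simp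
    then have "filter (\<lambda>l. fst l = fst a) u \<noteq> []" by auto
    then obtain b where "b \<in> set u" "fst b = fst a" by (auto simp: filter_empty_conv)
    then obtain p q where u: "u = p @ b # q" "fst b = fst a" by (auto dest: split_list)
    define v where "v = word_inv p @ q"
    have wi: "word_in r v" "word_in r p" "word_in r q" "word_in r [a]"
      using less(2) Cons u by (auto simp: v_def)
    have flt: "length (filter (\<lambda>l. fst l = i) (word_inv p)) = length (filter (\<lambda>l. fst l = i) p)" for i
      by (simp add: word_inv_def rev_filter[symmetric] filter_map comp_def)
    have "\<exists>h. reduce v \<in> square_prods r h"
    proof (rule less(1))
      show "even (length (filter (\<lambda>l. fst l = i) v))" for i
        using less(3)[of i] Cons u by (auto simp: v_def flt split: if_splits)
    qed (use Cons u wi in \<open>auto simp: v_def\<close>)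
    then obtain h where h: "reduce v \<in> square_prods r h" by blast
    define A where "A = reduce [a]"
    define P where "P = reduce p"
    define Q where "Q = reduce q"
    have C: "A \<in> carrier ?G" "P \<in> carrier ?G" "Q \<in> carrier ?G"
      using wi by (auto simp: A_def P_def Q_def intro: reduce_carrier)
    have v: "reduce v = inv\<^bsub>?G\<^esub> P \<otimes>\<^bsub>?G\<^esub> Q"
      using wi by (simp add: v_def reduce_append[of _ _ r] reduce_inv P_def Q_def)
    have w: "reduce w = A \<otimes>\<^bsub>?G\<^esub> (P \<otimes>\<^bsub>?G\<^esub> (reduce [b] \<otimes>\<^bsub>?G\<^esub> Q))"
      unfolding Cons u A_def P_def Q_def reduce_append[symmetric] by simp
    define s where "s = (A \<otimes>\<^bsub>?G\<^esub> P) \<otimes>\<^bsub>?G\<^esub> (A \<otimes>\<^bsub>?G\<^esub> P)"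
    have s: "s \<in> square_prods r 1"
      unfolding s_def using C by (intro free_group.prods_one[OF S]) (auto simp: free_group.squares_def)
    have "b = a \<or> b = inv_letter a" using u by (cases a; cases b) (auto simp: inv_letter_def)
    then show ?thesis
    proof
      assume "b = a"
      then have "reduce w = s \<otimes>\<^bsub>?G\<^esub> reduce v"
        using C by (simp add: w v s_def A_def[symmetric] free_group.group_simps)
      then have "reduce w \<in> square_prods r (1 + h)"
        using free_group.prods_mult[OF S s h] by simp
      then show ?thesis by blast
    next
      assume "b = inv_letter a"
      then have b: "reduce [b] = inv\<^bsub>?G\<^esub> A"
        using reduce_inv[of r "[a]"] wi by (simp add: A_def)
      define t where "t = inv\<^bsub>?G\<^esub> P \<otimes>\<^bsub>?G\<^esub> inv\<^bsub>?G\<^esub> A \<otimes>\<^bsub>?G\<^esub> P"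
      have t: "t \<otimes>\<^bsub>?G\<^esub> t \<in> square_prods r 1"
        using C by (intro free_group.prods_one[OF S]) (auto simp: free_group.squares_def t_def)
      have "reduce w = s \<otimes>\<^bsub>?G\<^esub> ((t \<otimes>\<^bsub>?G\<^esub> t) \<otimes>\<^bsub>?G\<^esub> reduce v)"
        using C by (simp add: w v b s_def t_def free_group.group_simps)
      then have "reduce w \<in> square_prods r (1 + (1 + h))"
        using free_group.prods_mult[OF S s free_group.prods_mult[OF S t h]] by simp
      then show ?thesis by blast
    qed
  qed
qed

lemma sql_eq: "sql r w = product_length (free_group r) (free_group.squares r) w"
  by (simp add: sql_def free_group.squares_def)

lemma cl_eq: "cl r w = product_length (free_group r) (free_group.commutators r) w"
  by (simp add: cl_def free_group.commutators_def)

lemma odd_letter_if_sql_infinite: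
  assumes "w \<in> carrier (free_group r)" "sql r w = \<infinity>"
  obtains i where "i < r" "odd (length (filter (\<lambda>l. fst l = i) w))"
proof -
  have wi: "word_in r w" using assms(1) by (simp add: free_group_def word_in_def)
  have "\<nexists>h. w \<in> square_prods r h"
    using free_group.product_length_le assms(2) unfolding sql_eq by fastforce
  then obtain i where i: "odd (length (filter (\<lambda>l. fst l = i) w))"
    using prods_squares_if_even[OF wi] reduce_reduced[OF assms(1)] by auto
  then have "filter (\<lambda>l. fst l = i) w \<noteq> []" by auto
  then have "i < r" using wi by (auto simp: filter_empty_conv word_in_def)
  then show thesis using that i by blast
qed

section \<open>Surfaces bounded by families of unreduced words\<close>

definition word_bounds :: "nat \<Rightarrow> letter list list \<Rightarrow> int \<Rightarrow> bool" where
  "word_bounds r ws e \<longleftrightarrow> free_group.bounds r (mset (map reduce ws)) e"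

lemma word_bounds_perm: "mset us = mset vs \<Longrightarrow> word_bounds r us e \<longleftrightarrow> word_bounds r vs e"
  by (simp add: word_bounds_def)

lemma word_bounds_join:
  assumes "word_bounds r (u # v # ws) e" "word_in r u" "word_in r v"
  shows "word_bounds r ((u @ v) # ws) (e - 1)"
  using assms free_group.bounds_join[of r "reduce u" "reduce v"] reduce_carrier
  by (simp add: word_bounds_def reduce_append[of _ _ r])

text \<open>\<open>u v = (u u) (u^{-1} v)\<close>, and \<open>u^{-1} v\<close> is conjugate to the
  inverse of \<open>u v^{-1}\<close>, so one crosscap undoes a twist.\<close>

lemma word_bounds_crosscap:
  assumes "word_bounds r ((u @ word_inv v) # ws) e" "word_in r u" "word_in r v"
  shows "word_bounds r ((u @ v) # ws) (e - 1)"
proof -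
  let ?G = "free_group r"
  define a where "a = reduce u"
  define b where "b = reduce v"
  have C: "a \<in> carrier ?G" "b \<in> carrier ?G"
    using assms by (auto simp: a_def b_def intro: reduce_carrier)
  have "free_group.conj_inv_rel r (a \<otimes>\<^bsub>?G\<^esub> inv\<^bsub>?G\<^esub> b) (inv\<^bsub>?G\<^esub> a \<otimes>\<^bsub>?G\<^esub> b)"
    by (rule free_group.conj_inv_rel_invI[of _ _ "inv\<^bsub>?G\<^esub> a"])
      (use C in \<open>simp_all add: free_group.group_simps\<close>)
  from free_group.bounds_crosscap[OF _ this C(1)] show ?thesis
    using assms C
    by (simp add: word_bounds_def reduce_append[of _ _ r] reduce_inv a_def[symmetric] b_def[symmetric]
        free_group.group_simps)
qed

text \<open>The loop equation inserts \<open>w\<close> or its inverse into another word; a strip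
  takes it out again, because \<open>u x v = (u x u^{-1}) (u v)\<close>.\<close>

lemma word_bounds_split:
  assumes "word_bounds r ((u @ x @ v) # ws) e" "x = w \<or> x = word_inv w"
    "word_in r u" "word_in r v" "word_in r w"
  shows "word_bounds r (w # (u @ v) # ws) (e - 1)"
proof -
  let ?G = "free_group r"
  define a where "a = reduce u"
  define b where "b = reduce v"
  define c where "c = reduce w"
  define d where "d = reduce x"
  have C: "a \<in> carrier ?G" "b \<in> carrier ?G" "c \<in> carrier ?G"
    using assms by (auto simp: a_def b_def c_def intro: reduce_carrier)
  have d: "d = c \<or> d = inv\<^bsub>?G\<^esub> c" using assms by (auto simp: c_def d_def reduce_inv)
  then have D: "d \<in> carrier ?G" using C by auto
  have "free_group.conj_inv_rel r c (a \<otimes>\<^bsub>?G\<^esub> d \<otimes>\<^bsub>?G\<^esub> inv\<^bsub>?G\<^esub> a)"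
    using d C by (auto simp: free_group.conj_inv_rel_def)
  moreover have "free_group.conj_inv_rel r (a \<otimes>\<^bsub>?G\<^esub> b) (a \<otimes>\<^bsub>?G\<^esub> b)"
    using C by (intro free_group.conj_inv_rel_refl) auto
  moreover have "reduce (u @ x @ v) =
      (a \<otimes>\<^bsub>?G\<^esub> d \<otimes>\<^bsub>?G\<^esub> inv\<^bsub>?G\<^esub> a) \<otimes>\<^bsub>?G\<^esub> (a \<otimes>\<^bsub>?G\<^esub> b)"
    using C D by (simp add: reduce_append[of _ _ r] a_def[symmetric] b_def[symmetric] d_def[symmetric]
        free_group.group_simps)
  ultimately show ?thesis
    using free_group.bounds_split[of r _ _ "mset (map reduce ws)"] assms(1)
    by (simp add: word_bounds_def reduce_append[of _ _ r] a_def[symmetric] b_def[symmetric] c_def[symmetric])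
qed

lemma word_bounds_conj:
  assumes "word_bounds r (u # ws) e" "word_in r u" "word_in r v"
  shows "word_bounds r ((v @ u @ word_inv v) # ws) e"
proof -
  have "free_group.conj_inv_rel r (reduce u) (reduce (v @ u @ word_inv v))"
    by (rule free_group.conj_inv_rel_conjI[of _ _ "reduce v"])
      (use assms in \<open>auto intro: reduce_carrier simp: reduce_append[of _ _ r] reduce_inv free_group.m_assoc reduce_carrier\<close>)
  then show ?thesis
    using assms(1) free_group.bounds_cong by (auto simp: word_bounds_def)
qed

lemma word_bounds_rotate:
  assumes "word_bounds r ((u @ v) # ws) e" "word_in r u" "word_in r v"
  shows "word_bounds r ((v @ u) # ws) e"
proof -
  have C: "reduce u \<in> carrier (free_group r)" "reduce v \<in> carrier (free_group r)"
    using assms by (auto intro: reduce_carrier)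
  have "free_group.conj_inv_rel r (reduce (u @ v)) (reduce (v @ u))"
    by (rule free_group.conj_inv_rel_conjI[of _ _ "reduce v"])
      (use C in \<open>simp_all add: reduce_append[of _ _ r] free_group.group_simps\<close>)
  then show ?thesis
    using assms(1) free_group.bounds_cong by (auto simp: word_bounds_def)
qed

lemma word_bounds_inv:
  assumes "word_bounds r (word_inv u # ws) e" "word_in r u"
  shows "word_bounds r (u # ws) e"
proof -
  have "free_group.conj_inv_rel r (reduce (word_inv u)) (reduce u)"
    by (rule free_group.conj_inv_rel_invI[of _ _ "\<one>\<^bsub>free_group r\<^esub>"])
      (use assms in \<open>auto simp: reduce_inv reduce_carrier\<close>)
  then show ?thesis
    using assms(1) free_group.bounds_cong by (auto simp: word_bounds_def)
qed

lemma word_bounds_Nils: "(\<And>w. w \<in> set ws \<Longrightarrow> w = []) \<Longrightarrow> word_bounds r ws (int (length ws))"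
proof -
  assume *: "\<And>w. w \<in> set ws \<Longrightarrow> w = []"
  have "reduce w = \<one>\<^bsub>free_group r\<^esub>" if "w \<in> set ws" for w
    using *[OF that] by (simp add: reduce_Nil[of r])
  then have "map reduce ws = replicate (length ws) \<one>\<^bsub>free_group r\<^esub>"
    by (intro replicate_eqI) auto
  then show ?thesis using free_group.bounds_ones[of r "length ws"] by (simp add: word_bounds_def)
qed

text \<open>The Euler characteristic is \<open>1 - m\<close> with \<open>w\<close> a product of
  \<open>m\<close> squares or of \<open>m / 2\<close> commutators, and the two lengths bound
  \<open>m\<close> from below.\<close>

lemma word_bounds_le:
  assumes "w \<in> carrier (free_group r)" "sql r w \<noteq> \<infinity>" "word_bounds r [w] e"
  shows "e \<le> 1 - int (the_enat (min (sql r w) (2 * cl r w)))"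
proof -
  obtain m where m: "w \<in> free_group.disc_boundary r m" "e = 1 - int m"
    using assms free_group.bounds_single[of r w e] by (auto simp: word_bounds_def reduce_reduced)
  have "min (sql r w) (2 * cl r w) \<le> enat m"
    using free_group.product_length_le_if_disc_boundary[OF m(1)] by (simp add: sql_eq cl_eq)
  then have "the_enat (min (sql r w) (2 * cl r w)) \<le> m"
    by (cases "min (sql r w) (2 * cl r w)") auto
  then show ?thesis using m(2) by simp
qed

section \<open>Induction over the loop equations\<close>

definition word_energy :: "letter list list \<Rightarrow> nat" where
  "word_energy ws = (\<Sum>w\<leftarrow>ws. length w ^ 2)"

text \<open>Each use of the equation divides by \<open>n\<close>, which improves the trivial
  exponent \<open>length ws\<close> by one as long as the family does not grow. So the exponent
  \<open>max e (length ws - j)\<close> is proved by induction on \<open>j\<close>. Terms with no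
  more words than before use the claim for \<open>j\<close>, whatever their energy. A term with one
  word more needs the claim for \<open>Suc j\<close> itself, which the inner induction on the energy
  supplies.\<close>

lemma asymptotics_of_loop_equation:
  fixes f :: "nat \<Rightarrow> letter list list \<Rightarrow> complex" and valid :: "letter list list \<Rightarrow> bool"
    and B :: "letter list list \<Rightarrow> int \<Rightarrow> bool"
  assumes trivial: "\<And>n ws. n \<ge> 2 \<Longrightarrow> valid ws \<Longrightarrow> norm (f n ws) \<le> (2 * real n) ^ length ws"
    and base: "\<And>ws. (\<And>w. w \<in> set ws \<Longrightarrow> w = []) \<Longrightarrow> B ws (int (length ws))"
    and step: "\<And>ws w. valid ws \<Longrightarrow> w \<in> set ws \<Longrightarrow> w \<noteq> [] \<Longrightarrow> \<exists>A.
      (\<forall>n\<ge>2. real n / 2 * norm (f n ws) \<le> (\<Sum>ws'\<leftarrow>A. norm (f n ws'))) \<and>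
      (\<forall>ws'\<in>set A. valid ws' \<and> (\<forall>e. B ws' e \<longrightarrow> B ws (e - 1)) \<and>
        (length ws' \<le> length ws \<or>
         length ws' = Suc (length ws) \<and> word_energy ws' < word_energy ws))"
    and "valid ws" and "\<And>e'. B ws e' \<Longrightarrow> e' \<le> e"
  shows "\<exists>C. \<forall>n\<ge>2. norm (f n ws) \<le> C * real n powi e"
proof -
  have "\<exists>C\<ge>0. \<forall>n\<ge>2. norm (f n ws) \<le> C * real n powi max e (int (length ws) - int j)"
    if "valid ws" "\<And>e'. B ws e' \<Longrightarrow> e' \<le> e" for j ws e
    using that
  proof (induction j arbitrary: ws e)
    case 0
    have "norm (f n ws) \<le> 2 ^ length ws * real n powi max e (int (length ws) - int 0)" if n: "n \<ge> 2" for n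
    proof -
      have "norm (f n ws) \<le> 2 ^ length ws * real n powi (int (length ws))"
        using trivial[OF n 0(1)] by (simp add: power_mult_distrib)
      also have "\<dots> \<le> 2 ^ length ws * real n powi max e (int (length ws) - int 0)"
        using n by (intro mult_left_mono power_int_increasing) auto
      finally show ?thesis .
    qed
    then show ?case by (intro exI[of _ "2 ^ length ws"]) auto
  next
    case (Suc j)
    show ?case
      using Suc.prems
    proof (induction "word_energy ws" arbitrary: ws e rule: less_induct)
      case less
      let ?E = "max e (int (length ws) - int (Suc j))"
      show ?case
      proof (cases "\<exists>w\<in>set ws. w \<noteq> []")
        case False
        \<comment> \<open>Only empty words are left, so \<open>base\<close> gives a surface of Euler
          characteristic \<open>length ws\<close>; hence \<open>e\<close> is at least that large and
          the trivial bound suffices.\<close>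
        then have "int (length ws) \<le> e" using less(3)[of "int (length ws)"] base[of ws] by blast
        have "norm (f n ws) \<le> 2 ^ length ws * real n powi ?E" if n: "n \<ge> 2" for n
        proof -
          have "norm (f n ws) \<le> 2 ^ length ws * real n powi (int (length ws))"
            using trivial[OF n less(2)] by (simp add: power_mult_distrib)
          also have "\<dots> \<le> 2 ^ length ws * real n powi ?E"
            using n \<open>int (length ws) \<le> e\<close> by (intro mult_left_mono power_int_increasing) auto
          finally show ?thesis .
        qed
        then show ?thesis by (intro exI[of _ "2 ^ length ws"]) auto
      next
        case True
        then obtain A where A: "\<And>n. n \<ge> 2 \<Longrightarrow> real n / 2 * norm (f n ws) \<le> (\<Sum>ws'\<leftarrow>A. norm (f n ws'))"
          and A': "\<And>ws'. ws' \<in> set A \<Longrightarrow> valid ws' \<and> (\<forall>e. B ws' e \<longrightarrow> B ws (e - 1)) \<and>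
            (length ws' \<le> length ws \<or> length ws' = Suc (length ws) \<and> word_energy ws' < word_energy ws)"
          using step[OF less(2)] by meson
        have "\<exists>C\<ge>0. \<forall>n\<ge>2. norm (f n ws') \<le> C * real n powi (?E + 1)" if ws': "ws' \<in> set A" for ws'
        proof -
          have v: "valid ws'" using A'[OF ws'] by auto
          have ub: "e' \<le> e + 1" if "B ws' e'" for e'
            using A'[OF ws'] less(3)[of "e' - 1"] that by force
          \<comment> \<open>Both kinds of terms lead to \<open>length ws - j\<close>: the outer
            hypothesis directly, the inner one because the additional word and the
            \<open>Suc\<close> of \<open>Suc j\<close> cancel.\<close>
          have "\<exists>C\<ge>0. \<forall>n\<ge>2. norm (f n ws') \<le> C * real n powi (max (e + 1) (int (length ws) - int j))"
          proof (cases "length ws' \<le> length ws")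
            case True
            obtain C where C: "C \<ge> 0" "\<And>n. n \<ge> 2 \<Longrightarrow>
                norm (f n ws') \<le> C * real n powi (max (e + 1) (int (length ws') - int j))"
              using Suc.IH[OF v ub] by blast
            have "norm (f n ws') \<le> C * real n powi (max (e + 1) (int (length ws) - int j))" if n: "n \<ge> 2" for n
              by (rule order_trans[OF C(2)[OF n]], intro mult_left_mono power_int_increasing) (use n C True in auto)
            then show ?thesis using C(1) by blast
          next
            case False
            then have "length ws' = Suc (length ws)" "word_energy ws' < word_energy ws"
              using A'[OF ws'] by auto
            then show ?thesis using less(1)[OF _ v ub] by simp
          qed
          moreover have "max (e + 1) (int (length ws) - int j) = ?E + 1" by auto
          ultimately show ?thesis by simp
        qed
        then obtain C where C: "\<And>ws'. ws' \<in> set A \<Longrightarrow> C ws' \<ge> 0"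
          "\<And>ws' n. ws' \<in> set A \<Longrightarrow> n \<ge> 2 \<Longrightarrow> norm (f n ws') \<le> C ws' * real n powi (?E + 1)"
          by metis
        have "norm (f n ws) \<le> 2 * (\<Sum>ws'\<leftarrow>A. C ws') * real n powi ?E" if n: "n \<ge> 2" for n
        proof -
          have "real n / 2 * norm (f n ws) \<le> (\<Sum>ws'\<leftarrow>A. norm (f n ws'))" using A n by simp
          also have "\<dots> \<le> (\<Sum>ws'\<leftarrow>A. C ws' * real n powi (?E + 1))"
            by (intro sum_list_mono C(2) n)
          also have "\<dots> = (\<Sum>ws'\<leftarrow>A. C ws') * real n powi (?E + 1)"
            by (simp add: sum_list_mult_const)
          also have "\<dots> = real n * ((\<Sum>ws'\<leftarrow>A. C ws') * real n powi ?E)"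
            using n by (simp add: power_int_add)
          finally have "real n * norm (f n ws) \<le> real n * (2 * (\<Sum>ws'\<leftarrow>A. C ws') * real n powi ?E)"
            by (simp add: field_simps)
          then show ?thesis using n by (subst (asm) mult_le_cancel_left_pos) auto
        qed
        moreover have "(\<Sum>ws'\<leftarrow>A. C ws') \<ge> 0" using C(1) by (intro sum_list_nonneg) auto
        ultimately show ?thesis by (intro exI[of _ "2 * (\<Sum>ws'\<leftarrow>A. C ws')"]) auto
      qed
    qed
  qed
  \<comment> \<open>With this many rounds the trivial exponent has come down to \<open>e\<close>;
    the truncation by \<open>nat\<close> covers the case that \<open>e\<close> exceeds
    \<open>length ws\<close> already.\<close>
  from this[OF assms(4,5), of "nat (int (length ws) - e)"]
  obtain C where C: "\<And>n. n \<ge> 2 \<Longrightarrow>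
      norm (f n ws) \<le> C * real n powi max e (int (length ws) - int (nat (int (length ws) - e)))"
    by blast
  moreover have "max e (int (length ws) - int (nat (int (length ws) - e))) = e" by auto
  ultimately show ?thesis by auto
qed

section \<open>Matrices preserving a form\<close>

lemma mat_mult_index:
  "A \<in> carrier_mat n n \<Longrightarrow> B \<in> carrier_mat n n \<Longrightarrow> i < n \<Longrightarrow> j < n \<Longrightarrow>
    (A * B) $$ (i, j) = (\<Sum>k<n. A $$ (i, k) * B $$ (k, j))"
  by (auto simp: scalar_prod_def atLeast0LessThan)

lemma mat_mult3_index:
  fixes A :: "'a::comm_semiring_0 mat"
  assumes "A \<in> carrier_mat n n" "T \<in> carrier_mat n n" "B \<in> carrier_mat n n" "i < n" "j < n"
  shows "(A * T * B) $$ (i, j) = (\<Sum>k<n. \<Sum>l<n. T $$ (k, l) * (A $$ (i, k) * B $$ (l, j)))"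
  using assms
  by (simp add: mat_mult_index[of _ n] mult_carrier_mat[of _ n n] sum_distrib_left mult_ac
      del: index_mult_mat)

lemma trace_mat_eq: "A \<in> carrier_mat n n \<Longrightarrow> trace_mat A = (\<Sum>i<n. A $$ (i, i))"
  by (simp add: trace_mat_def)

lemma trace_mat_mult:
  "A \<in> carrier_mat n n \<Longrightarrow> B \<in> carrier_mat n n \<Longrightarrow>
    trace_mat (A * B) = (\<Sum>i<n. \<Sum>j<n. A $$ (i, j) * B $$ (j, i))"
  by (simp add: trace_mat_eq[of _ n] mat_mult_index[of _ n] del: index_mult_mat)

lemma trace_mat_comm:
  fixes A :: "'a::comm_semiring_0 mat"
  assumes "A \<in> carrier_mat n n" "B \<in> carrier_mat n n"
  shows "trace_mat (A * B) = trace_mat (B * A)"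
  unfolding trace_mat_mult[OF assms] trace_mat_mult[OF assms(2,1)]
  by (subst sum.swap) (simp add: mult.commute)

lemma trace_mat_transpose: "A \<in> carrier_mat n n \<Longrightarrow> trace_mat (transpose_mat A) = trace_mat A"
  by (simp add: trace_mat_eq[of _ n])

lemma trace_mat_smult: "trace_mat (c \<cdot>\<^sub>m A) = c * trace_mat (A :: 'a::semiring_0 mat)" if "A \<in> carrier_mat n n"
  using that by (simp add: trace_mat_eq[of _ n] sum_distrib_left)

lemma adjoint_index:
  "A \<in> carrier_mat n n \<Longrightarrow> i < n \<Longrightarrow> j < n \<Longrightarrow> mat_adjoint A $$ (i, j) = cnj (A $$ (j, i))"
  by (simp add: mat_adjoint_index)

text \<open>A real orthogonal matrix, symmetric or antisymmetric according to the sign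
  \<open>eps\<close>, treats both families of groups at once. In the loop equation
  \<open>eps\<close> is just the sign of the twisted terms, so the estimates see it only through
  \<open>N - eps\<close>.\<close>

locale matrix_form =
  fixes N :: nat and K :: "complex mat" and eps :: complex
  assumes K_carrier [simp]: "K \<in> carrier_mat N N"
    and K_real: "i < N \<Longrightarrow> j < N \<Longrightarrow> cnj (K $$ (i, j)) = K $$ (i, j)"
    and K_orthogonal: "K * transpose_mat K = 1\<^sub>m N"
    and K_transpose: "transpose_mat K = eps \<cdot>\<^sub>m K"
    and eps_cases: "eps = 1 \<or> eps = -1"
begin

abbreviation "MN \<equiv> carrier_mat N N"

lemma assoc: "A \<in> MN \<Longrightarrow> B \<in> MN \<Longrightarrow> C \<in> MN \<Longrightarrow> A * B * C = A * (B * C)"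
  by (rule assoc_mult_mat)

lemma mult_closed [simp]: "A \<in> MN \<Longrightarrow> B \<in> MN \<Longrightarrow> A * B \<in> MN"
  by simp

lemma adjoint_closed [simp]: "A \<in> MN \<Longrightarrow> mat_adjoint A \<in> MN"
  by (rule mat_adjoint_carrier)

lemma K_transpose_closed [simp]: "transpose_mat K \<in> MN"
  by simp

lemma mult_one [simp]:
  fixes A :: "complex mat"
  shows "A \<in> MN \<Longrightarrow> A * 1\<^sub>m N = A" "A \<in> MN \<Longrightarrow> 1\<^sub>m N * A = A"
  by (rule right_mult_one_mat[of A N N], assumption) (rule left_mult_one_mat[of A N N])

lemma eps_square: "eps * eps = 1"
  using eps_cases by auto

text \<open>The adjoint with respect to the form \<open>K\<close>, which is the inverse on the group. The orthogonal
  group is the case \<open>K = 1\<close>, \<open>eps = 1\<close>, the symplectic group is the case \<open>K = J\<close>, \<open>eps = - 1\<close>.\<close>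

definition star :: "complex mat \<Rightarrow> complex mat" where
  "star A = K * transpose_mat A * transpose_mat K"

lemma star_carrier [simp]: "A \<in> MN \<Longrightarrow> star A \<in> MN"
  by (simp add: star_def)

lemma star_dim [simp]: "dim_row (star A) = N" "dim_col (star A) = N"
  using K_carrier by (auto simp: star_def simp del: K_carrier)

lemma K_orthogonal': "transpose_mat K * K = 1\<^sub>m N"
  using mat_mult_left_right_inverse[of K N "transpose_mat K"] K_orthogonal by simp

lemma star_mult:
  assumes "A \<in> MN" "B \<in> MN"
  shows "star (A * B) = star B * star A"
proof -
  let ?A = "transpose_mat A" and ?B = "transpose_mat B" and ?K = "transpose_mat K"
  have "star B * star A = K * ?B * (?K * K) * ?A * ?K"
    using assms by (simp add: star_def assoc)
  also have "\<dots> = K * (?B * ?A) * ?K" using assms by (simp add: K_orthogonal' assoc)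
  finally show ?thesis using assms by (simp add: star_def transpose_mult[of _ N N _ N])
qed

lemma star_eq: "A \<in> MN \<Longrightarrow> star A = eps \<cdot>\<^sub>m (K * transpose_mat A * K)"
  unfolding star_def K_transpose by (rule mult_smult_distrib[of _ N N _ N]) auto

lemma star_star:
  assumes "A \<in> MN"
  shows "star (star A) = A"
proof -
  let ?K = "transpose_mat K"
  have K: "?K \<in> MN" by simp
  have "star (star A) = K * transpose_mat (K * transpose_mat A * ?K) * ?K" by (simp add: star_def)
  also have "transpose_mat (K * transpose_mat A * ?K) = K * (A * ?K)"
    using assms by (simp add: transpose_mult[of _ N N _ N])
  also have "K * (K * (A * ?K)) * ?K = (K * K) * A * (?K * ?K)" using assms K by (simp add: assoc)
  also have "K * K = eps \<cdot>\<^sub>m 1\<^sub>m N"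
  proof -
    have "K = transpose_mat (eps \<cdot>\<^sub>m K)" by (simp flip: K_transpose)
    also have "\<dots> = eps \<cdot>\<^sub>m ?K" by (intro eq_matI) auto
    finally have "K * K = K * (eps \<cdot>\<^sub>m ?K)" by simp
    then show ?thesis by (simp add: mult_smult_distrib[of _ N N _ N] K_orthogonal)
  qed
  also have "?K * ?K = eps \<cdot>\<^sub>m 1\<^sub>m N"
    unfolding K_transpose[THEN arg_cong[where f="\<lambda>x. x * ?K"]]
    by (simp add: mult_smult_assoc_mat[of _ N N _ N] K_orthogonal)
  also have "eps \<cdot>\<^sub>m 1\<^sub>m N * A * (eps \<cdot>\<^sub>m 1\<^sub>m N) = (eps * eps) \<cdot>\<^sub>m A"
    using assms by (intro eq_matI) (auto simp: mult_smult_assoc_mat[of _ N N _ N] mult_smult_distrib[of _ N N _ N])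
  finally show ?thesis using assms by (simp add: eps_square) (intro eq_matI, auto)
qed

lemma star_one: "star (1\<^sub>m N) = 1\<^sub>m N"
  by (simp add: star_def K_orthogonal)

lemma star_index:
  assumes "A \<in> MN" "c < N" "d < N"
  shows "star A $$ (c, d) = (\<Sum>p<N. \<Sum>q<N. A $$ (q, p) * (K $$ (c, p) * K $$ (d, q)))"
  using assms by (simp add: star_def mat_mult3_index[of _ N] index_transpose_mat(1)[of _ K] carrier_matD[OF K_carrier] del: index_mult_mat)

lemma star_add: "A \<in> MN \<Longrightarrow> B \<in> MN \<Longrightarrow> star (A + B) = star A + star B"
  by (intro eq_matI) (auto simp: star_index sum.distrib algebra_simps)

lemma star_smult: "A \<in> MN \<Longrightarrow> star (x \<cdot>\<^sub>m A) = x \<cdot>\<^sub>m star A"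
  by (intro eq_matI) (auto simp: star_index sum_distrib_left mult_ac)

lemma star_uminus: "A \<in> MN \<Longrightarrow> star (- A) = - star A"
  by (intro eq_matI) (auto simp: star_index sum_negf)

lemma trace_star: 
  assumes "A \<in> MN"
  shows "trace_mat (star A) = trace_mat A"
proof -
  have "trace_mat (star A) = trace_mat (transpose_mat K * (K * transpose_mat A))"
    unfolding star_def using assms by (intro trace_mat_comm[of _ N]) auto
  also have "transpose_mat K * (K * transpose_mat A) = transpose_mat K * K * transpose_mat A"
    using assms by (simp add: assoc)
  finally show ?thesis using assms by (simp add: K_orthogonal' trace_mat_transpose[of _ N])
qed

lemma adjoint_star:
  assumes "A \<in> MN"
  shows "mat_adjoint (star A) = star (mat_adjoint A)"
proof (rule eq_matI)
  fix i j assume "i < dim_row (star (mat_adjoint A))" "j < dim_col (star (mat_adjoint A))"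
  then have ij: "i < N" "j < N" by auto
  have "mat_adjoint (star A) $$ (i, j) = (\<Sum>p<N. \<Sum>q<N. cnj (A $$ (q, p)) * (K $$ (j, p) * K $$ (i, q)))"
    using assms ij by (simp add: adjoint_index[of _ N] star_index K_real)
  also have "\<dots> = (\<Sum>q<N. \<Sum>p<N. cnj (A $$ (q, p)) * (K $$ (j, p) * K $$ (i, q)))"
    by (rule sum.swap)
  also have "\<dots> = star (mat_adjoint A) $$ (i, j)"
    using assms ij mat_adjoint_carrier[OF assms]
    by (simp add: star_index adjoint_index[of _ N] mult_ac)
  finally show "mat_adjoint (star A) $$ (i, j) = star (mat_adjoint A) $$ (i, j)" .
qed (use assms carrier_matD[OF adjoint_closed[OF star_carrier[OF assms]]] in auto)

text \<open>\<open>star\<close> is complex linear and \<open>mat_adjoint\<close> is conjugate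
  linear, so their equality is a reality condition; for \<open>K = 1\<close> it says that the
  entries are real.\<close>

definition form_group :: "complex mat set" where
  "form_group = {A \<in> MN. mat_adjoint A * A = 1\<^sub>m N \<and> star A = mat_adjoint A}"

lemma form_groupD:
  assumes "A \<in> form_group"
  shows "A \<in> MN" "mat_adjoint A * A = 1\<^sub>m N" "star A = mat_adjoint A" "star A * A = 1\<^sub>m N"
    "A * star A = 1\<^sub>m N"
proof -
  show *: "A \<in> MN" "mat_adjoint A * A = 1\<^sub>m N" "star A = mat_adjoint A"
    using assms by (auto simp: form_group_def)
  then show "star A * A = 1\<^sub>m N" by simp
  then show "A * star A = 1\<^sub>m N"
    using * by (intro mat_mult_left_right_inverse[of "star A" N A]) auto
qed

lemma form_group_one: "1\<^sub>m N \<in> form_group"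
  by (simp add: form_group_def star_one mat_adjoint_one)

lemma form_group_mult:
  assumes "A \<in> form_group" "B \<in> form_group"
  shows "A * B \<in> form_group"
proof -
  note A = form_groupD[OF assms(1)] and B = form_groupD[OF assms(2)]
  have "star (A * B) * (A * B) = star B * (star A * A) * B"
    using A(1) B(1) by (simp add: star_mult assoc)
  then show ?thesis
    using A B by (simp add: form_group_def star_mult mat_adjoint_mult)
qed

lemma form_group_star: "A \<in> form_group \<Longrightarrow> star A \<in> form_group"
proof -
  assume "A \<in> form_group"
  note A = form_groupD[OF this]
  have "mat_adjoint (star A) = A" unfolding A(3) by (rule mat_adjoint_mat_adjoint[OF A(1)])
  moreover have "star (star A) = A" by (rule star_star[OF A(1)])
  ultimately show "star A \<in> form_group" using A unfolding form_group_def by simp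
qed

lemma form_group_entry_le:
  assumes "A \<in> form_group" "i < N" "j < N"
  shows "cmod (A $$ (i, j)) \<le> 1"
proof -
  note A = form_groupD[OF assms(1)]
  have "(\<Sum>k<N. mat_adjoint A $$ (j, k) * A $$ (k, j)) = 1"
    using mat_mult_index[OF mat_adjoint_carrier[OF A(1)] A(1) assms(3,3)] A(2) assms by simp
  moreover have "(\<Sum>k<N. mat_adjoint A $$ (j, k) * A $$ (k, j)) = of_real (\<Sum>k<N. (cmod (A $$ (k, j)))\<^sup>2)"
    using A(1) assms by (simp add: adjoint_index[of _ N] mult.commute flip: complex_norm_square)
  ultimately have "(\<Sum>k<N. (cmod (A $$ (k, j)))\<^sup>2) = 1" by (metis of_real_eq_1_iff)
  moreover have "(cmod (A $$ (i, j)))\<^sup>2 \<le> (\<Sum>k<N. (cmod (A $$ (k, j)))\<^sup>2)"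
    using assms by (intro member_le_sum) auto
  ultimately show ?thesis by (simp add: abs_square_le_1)
qed

lemma form_group_trace_le:
  assumes "A \<in> form_group"
  shows "cmod (trace_mat A) \<le> real N"
proof -
  have "cmod (trace_mat A) \<le> (\<Sum>i<N. 1)"
    unfolding trace_mat_eq[OF form_groupD(1)[OF assms]]
    by (rule sum_norm_le) (use form_group_entry_le[OF assms] in auto)
  then show ?thesis by simp
qed

text \<open>A kernel vector satisfies \<open>H v = v\<close>, so its squared norm is the value
  \<open>S\<close> of the form of \<open>H\<close> at \<open>v\<close>. This is imaginary because
  \<open>H\<close> is skew-Hermitian, and real because it is a norm, hence zero.\<close>

lemma skew_hermitian_det:
  fixes H :: "complex mat"
  assumes H: "H \<in> MN" "mat_adjoint H = - H"
  shows "det (1\<^sub>m N - H) \<noteq> 0"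
proof
  assume "det (1\<^sub>m N - H) = 0"
  then obtain v where v: "v \<in> carrier_vec N" "v \<noteq> 0\<^sub>v N" "(1\<^sub>m N - H) *\<^sub>v v = 0\<^sub>v N"
    using det_0_iff_vec_prod_zero[OF minus_carrier_mat[OF H(1)]] by blast
  have vH: "v $ i = (\<Sum>j<N. H $$ (i, j) * v $ j)" if i: "i < N" for i
  proof -
    have "v - H *\<^sub>v v = 0\<^sub>v N"
      using v(3) minus_mult_distrib_mat_vec[OF one_carrier_mat H(1) v(1)] v(1) by simp
    then have "(v - H *\<^sub>v v) $ i = 0" using i by simp
    moreover have "(H *\<^sub>v v) $ i = (\<Sum>j<N. H $$ (i, j) * v $ j)"
      using i H v(1) by (simp add: scalar_prod_def atLeast0LessThan)
    ultimately show ?thesis using i H v(1) by simp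
  qed
  have adj: "cnj (H $$ (i, j)) = - H $$ (j, i)" if "i < N" "j < N" for i j
    using adjoint_index[OF H(1) that(2,1)] that H by simp
  define S where "S = (\<Sum>i<N. cnj (v $ i) * v $ i)"
  have S: "S = (\<Sum>i<N. \<Sum>j<N. cnj (v $ i) * (H $$ (i, j) * v $ j))"
    unfolding S_def sum_distrib_left[symmetric] by (intro sum.cong refl arg_cong2[of _ _ _ _ "(*)"] vH) simp
  have "cnj S = (\<Sum>i<N. \<Sum>j<N. - (cnj (v $ j) * (H $$ (j, i) * v $ i)))"
    unfolding S cnj_sum by (intro sum.cong refl) (simp add: adj)
  also have "\<dots> = - (\<Sum>i<N. \<Sum>j<N. cnj (v $ i) * (H $$ (i, j) * v $ j))"
    unfolding sum_negf by (intro arg_cong[of _ _ uminus] sum.swap)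
  also have "\<dots> = - S" unfolding S ..
  finally have "cnj S = - S" .
  moreover have Sr: "S = of_real (\<Sum>i<N. (cmod (v $ i))\<^sup>2)"
    by (simp add: S_def mult.commute flip: complex_norm_square)
  ultimately have "(\<Sum>i<N. (cmod (v $ i))\<^sup>2) = 0" by (simp add: complex_eq_iff)
  then have "v $ i = 0" if "i < N" for i
    using that by (subst (asm) sum_nonneg_eq_0_iff) auto
  then have "v = 0\<^sub>v N" using v(1) by (intro eq_vecI) auto
  with v(2) show False by simp
qed

text \<open>The witness is \<open>(1 + H) (1 - H)^{-1}\<close>. Multiplied by \<open>1 - H\<close>
  it gives the implicit equation, from which the expansion of \<open>h\<close> is read off later
  with the inverse out of sight.\<close>

lemma cayley:
  assumes H: "H \<in> MN" "mat_adjoint H = - H" "star H = - H"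
  obtains h where "h \<in> form_group" "h = 1\<^sub>m N + H + h * H"
proof -
  define P where "P = 1\<^sub>m N + H"
  define Q where "Q = 1\<^sub>m N - H"
  have PQ [simp]: "P \<in> MN" "Q \<in> MN" using H by (auto simp: P_def Q_def)
  have PQc: "P * Q = Q * P"
    using H unfolding P_def Q_def
    by (simp add: add_mult_distrib_mat[of _ N N _ _ N] mult_minus_distrib_mat[of _ N N _ N]
        minus_mult_distrib_mat[of _ N N _ _ N] mult_add_distrib_mat[of _ N N _ N])
  obtain B where B: "B \<in> MN" "Q * B = 1\<^sub>m N" "B * Q = 1\<^sub>m N"
    using det_non_zero_imp_unit[OF PQ(2)] skew_hermitian_det[OF H(1,2)]
    by (auto simp: Q_def Units_def ring_mat_def)
  have adjH: "cnj (H $$ (j, i)) = - H $$ (i, j)" if "i < N" "j < N" for i j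
    using adjoint_index[OF H(1) that] that H by simp
  have aP: "mat_adjoint P = Q"
  proof (rule eq_matI)
    fix i j assume "i < dim_row Q" "j < dim_col Q"
    then have ij: "i < N" "j < N" using PQ by auto
    show "mat_adjoint P $$ (i, j) = Q $$ (i, j)"
      unfolding adjoint_index[OF PQ(1) ij] using ij H(1) by (simp add: P_def Q_def adjH)
  qed (use carrier_matD[OF adjoint_closed[OF PQ(1)]] carrier_matD[OF PQ(2)] in auto)
  then have aQ: "mat_adjoint Q = P" using mat_adjoint_mat_adjoint[OF PQ(1)] by simp
  have "star Q = star (1\<^sub>m N + - H)" unfolding Q_def using H by (intro arg_cong[of _ _ star] eq_matI) auto
  then have sP: "star P = Q" "star Q = P"
    using H by (auto intro!: eq_matI simp: P_def Q_def star_add star_one star_uminus)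
  define A where "A = mat_adjoint B"
  have A [simp]: "A \<in> MN" using mat_adjoint_carrier B by (simp add: A_def)
  have AP: "A * P = 1\<^sub>m N" "P * A = 1\<^sub>m N"
    using mat_adjoint_mult[OF PQ(2) B(1), unfolded B(2) aQ, folded A_def, symmetric]
      mat_adjoint_mult[OF B(1) PQ(2), unfolded B(3) aQ, folded A_def, symmetric]
    by (simp_all add: mat_adjoint_one)
  have SP: "star B * P = 1\<^sub>m N" using star_mult[OF PQ(2) B(1)] B sP by (simp add: star_one)
  have "star B = star B * (P * A)" using B by (simp add: AP)
  also have "\<dots> = A" using B SP by (simp flip: assoc)
  finally have SB: "star B = A" .
  define h where "h = P * B"
  have hC: "h \<in> MN" using B by (simp add: h_def)
  have ah: "mat_adjoint h = A * Q" using B by (simp add: h_def mat_adjoint_mult[of _ N] aP A_def)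
  have sh: "star h = A * Q" using B by (simp add: h_def star_mult SB sP)
  \<comment> \<open>\<open>A\<close> inverts \<open>P\<close> and \<open>B\<close> inverts
    \<open>Q\<close>; exchanging the commuting factors \<open>Q\<close> and \<open>P\<close> in the
    middle lets everything cancel.\<close>
  have "A * Q * h = A * (Q * P) * B" using B by (simp add: h_def assoc)
  also have "\<dots> = (A * P) * (Q * B)" using B by (simp add: assoc flip: PQc)
  finally have "h \<in> form_group" using hC ah sh B AP by (simp add: form_group_def)
  moreover have "h = 1\<^sub>m N + H + h * H"
  proof -
    have "h * Q = P" using B by (simp add: h_def assoc)
    moreover have "h * Q = h - h * H" using hC H unfolding Q_def by (simp add: mult_minus_distrib_mat[of _ N N _ N])
    ultimately have e: "P = h - h * H" by simp
    have "h = P + h * H" unfolding e using hC H by (intro eq_matI) auto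
    then show ?thesis by (simp add: P_def)
  qed
  ultimately show thesis using that by blast
qed

end

section \<open>Words evaluated at matrices\<close>

lemma sum_sum_list_swap: "(\<Sum>a\<in>A. \<Sum>x\<leftarrow>L. g a x) = (\<Sum>x\<leftarrow>L. \<Sum>a\<in>A. g a x)"
  by (induction L) (auto simp: sum.distrib)

text \<open>When the \<open>i\<close>-th generator \<open>x\<close> is moved in the direction \<open>T\<close>, to \<open>x + T x\<close>, the value of
  a word changes by the sum of its values with \<open>T\<close> inserted before each \<open>x\<close>, and with
  \<open>- T\<close> inserted after each inverse of \<open>x\<close>. The cuts are these positions, with their signs.\<close>

primrec cuts :: "nat \<Rightarrow> letter list \<Rightarrow> (letter list \<times> letter list \<times> complex) list" where
  "cuts i [] = []"
| "cuts i (l # w) =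
     (if l = (i, True) then [([], l # w, 1)] else if l = (i, False) then [([l], w, -1)] else [])
     @ map (\<lambda>(P, Q, s). (l # P, Q, s)) (cuts i w)"

primrec family_cuts ::
  "nat \<Rightarrow> letter list list \<Rightarrow> (letter list \<times> letter list \<times> complex \<times> letter list list) list" where
  "family_cuts i [] = []"
| "family_cuts i (v # vs) = map (\<lambda>(P, Q, s). (P, Q, s, vs)) (cuts i v)
     @ map (\<lambda>(P, Q, s, us). (P, Q, s, v # us)) (family_cuts i vs)"

lemma cutsD:
  "(P, Q, s) \<in> set (cuts i w) \<Longrightarrow>
    P @ Q = w \<and> (s = 1 \<and> Q \<noteq> [] \<or> s = -1 \<and> P \<noteq> [] \<and> last P = (i, False))"
  by (induction w arbitrary: P) (fastforce split: if_splits)+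

lemma family_cutsD:
  "(P, Q, s, us) \<in> set (family_cuts i vs) \<Longrightarrow>
    mset ((P @ Q) # us) = mset vs \<and> (s = 1 \<or> s = -1)"
  by (induction vs arbitrary: us) (fastforce dest: cutsD)+

context matrix_form
begin

definition letter_val :: "(nat \<Rightarrow> complex mat) \<Rightarrow> letter \<Rightarrow> complex mat" where
  "letter_val g l = (if snd l then g (fst l) else star (g (fst l)))"

primrec word_val :: "(nat \<Rightarrow> complex mat) \<Rightarrow> letter list \<Rightarrow> complex mat" where
  "word_val g [] = 1\<^sub>m N"
| "word_val g (l # w) = letter_val g l * word_val g w"

definition family_val :: "(nat \<Rightarrow> complex mat) \<Rightarrow> letter list list \<Rightarrow> complex" where
  "family_val g ws = (\<Prod>w\<leftarrow>ws. trace_mat (word_val g w))"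

definition word_deriv ::
  "nat \<Rightarrow> complex mat \<Rightarrow> (nat \<Rightarrow> complex mat) \<Rightarrow> letter list \<Rightarrow> nat \<Rightarrow> nat \<Rightarrow> complex" where
  "word_deriv i T g w a b =
     (\<Sum>(P, Q, s)\<leftarrow>cuts i w. s * (word_val g P * T * word_val g Q) $$ (a, b))"

definition family_deriv ::
  "nat \<Rightarrow> complex mat \<Rightarrow> (nat \<Rightarrow> complex mat) \<Rightarrow> letter list list \<Rightarrow> complex" where
  "family_deriv i T g ws = (\<Sum>(P, Q, s, us)\<leftarrow>family_cuts i ws.
     s * trace_mat (word_val g P * T * word_val g Q) * family_val g us)"

section \<open>Values of words at elements of the group\<close>

context
  fixes g :: "nat \<Rightarrow> complex mat"
  assumes g: "\<And>i. g i \<in> form_group"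
begin

lemma letter_val_form_group: "letter_val g l \<in> form_group"
  using g form_group_star by (auto simp: letter_val_def)

lemma letter_val_carrier [simp]: "letter_val g l \<in> MN"
  using letter_val_form_group form_groupD by auto

lemma word_val_form_group: "word_val g w \<in> form_group"
  by (induction w) (auto intro: form_group_one form_group_mult letter_val_form_group)

lemma word_val_carrier [simp]: "word_val g w \<in> MN"
  using word_val_form_group form_groupD by auto

lemma word_val_append: "word_val g (u @ v) = word_val g u * word_val g v"
  by (induction u) (auto simp: assoc)

lemma word_val_inv: "word_val g (word_inv w) = star (word_val g w)"
proof (induction w)
  case (Cons l w)
  have "letter_val g (inv_letter l) = star (letter_val g l)"
    using g form_groupD(1) by (auto simp: letter_val_def inv_letter_def star_star)
  then show ?case using Cons by (simp add: word_val_append star_mult)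
qed (simp add: star_one)

lemma trace_word_val_rotate: "trace_mat (word_val g (u @ v)) = trace_mat (word_val g (v @ u))"
  by (simp add: word_val_append trace_mat_comm[of _ N])

lemma trace_word_val_inv: "trace_mat (word_val g (word_inv w)) = trace_mat (word_val g w)"
  by (simp add: word_val_inv trace_star)

lemma trace_word_val_conj:
  "trace_mat (word_val g (u @ w @ word_inv u)) = trace_mat (word_val g w)"
proof -
  have "trace_mat (word_val g (u @ w @ word_inv u)) = trace_mat (word_val g ((w @ word_inv u) @ u))"
    by (rule trace_word_val_rotate)
  also have "word_val g ((w @ word_inv u) @ u) = word_val g w * (star (word_val g u) * word_val g u)"
    by (simp add: word_val_append word_val_inv assoc)
  finally show ?thesis by (simp add: form_groupD(4)[OF word_val_form_group])
qed

lemma family_val_le: "cmod (family_val g ws) \<le> real N ^ length ws"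
  by (induction ws)
    (auto simp: family_val_def norm_mult intro!: mult_mono form_group_trace_le word_val_form_group)

text \<open>Separating \<open>T\<close> from coefficients that do not depend on it makes the complex
  linearity explicit, which later carries an identity from the real Lie algebra to its
  complexification.\<close>

lemma word_deriv_coeffs:
  assumes T: "T \<in> MN" and ab: "a < N" "b < N"
  shows "word_deriv i T g w a b = (\<Sum>c<N. \<Sum>d<N. T $$ (c, d) *
    (\<Sum>(P, Q, s)\<leftarrow>cuts i w. s * (word_val g P $$ (a, c) * word_val g Q $$ (d, b))))"
proof -
  have "s * (word_val g P * T * word_val g Q) $$ (a, b) =
      (\<Sum>c<N. \<Sum>d<N. T $$ (c, d) * (s * (word_val g P $$ (a, c) * word_val g Q $$ (d, b))))" for P Q s
    unfolding mat_mult3_index[OF word_val_carrier T word_val_carrier ab]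
    by (simp add: sum_distrib_left mult_ac)
  then show ?thesis
    by (simp add: word_deriv_def split_def sum_sum_list_swap flip: sum_list_const_mult)
qed

lemma family_deriv_coeffs:
  assumes T: "T \<in> MN"
  shows "family_deriv i T g ws = (\<Sum>c<N. \<Sum>d<N. T $$ (c, d) *
    (\<Sum>(P, Q, s, us)\<leftarrow>family_cuts i ws.
      s * (\<Sum>e<N. word_val g P $$ (e, c) * word_val g Q $$ (d, e)) * family_val g us))"
proof -
  have "s * trace_mat (word_val g P * T * word_val g Q) * y =
      (\<Sum>c<N. \<Sum>d<N. T $$ (c, d) * (s * (\<Sum>e<N. word_val g P $$ (e, c) * word_val g Q $$ (d, e)) * y))" for P Q s y
  proof -
    have "trace_mat (word_val g P * T * word_val g Q) =
        (\<Sum>e<N. \<Sum>c<N. \<Sum>d<N. T $$ (c, d) * (word_val g P $$ (e, c) * word_val g Q $$ (d, e)))"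
      using T by (simp add: trace_mat_eq[of _ N] mat_mult3_index[of _ N] del: index_mult_mat)
    also have "\<dots> = (\<Sum>c<N. \<Sum>e<N. \<Sum>d<N. T $$ (c, d) * (word_val g P $$ (e, c) * word_val g Q $$ (d, e)))"
      by (rule sum.swap)
    also have "\<dots> = (\<Sum>c<N. \<Sum>d<N. T $$ (c, d) * (\<Sum>e<N. word_val g P $$ (e, c) * word_val g Q $$ (d, e)))"
      unfolding sum_distrib_left by (intro sum.cong refl sum.swap)
    finally show ?thesis by (simp add: sum_distrib_left sum_distrib_right mult_ac)
  qed
  then show ?thesis
    by (simp add: family_deriv_def split_def sum_sum_list_swap flip: sum_list_const_mult)
qed

end

text \<open>The matrix \<open>E - E\<^sup>*\<close> for the matrix unit \<open>E\<close> at \<open>(a, b)\<close>; such matrices span the complexified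
  Lie algebra.\<close>

definition lie_unit :: "nat \<Rightarrow> nat \<Rightarrow> complex mat" where
  "lie_unit a b = mat N N (\<lambda>(c, d). (if c = a \<and> d = b then 1 else 0) - K $$ (c, b) * K $$ (d, a))"

lemma lie_unit_carrier [simp]: "lie_unit a b \<in> MN"
  by (simp add: lie_unit_def)

lemma sum_lie_unit:
  assumes "a < N" "b < N"
  shows "(\<Sum>c<N. \<Sum>d<N. lie_unit a b $$ (c, d) * f c d) =
    f a b - (\<Sum>c<N. \<Sum>d<N. K $$ (c, b) * K $$ (d, a) * f c d)"
proof -
  have "(\<Sum>c<N. \<Sum>d<N. (if c = a \<and> d = b then 1 else 0) * f c d) = (\<Sum>c<N. if c = a then f a b else 0)"
    by (intro sum.cong) (use assms in \<open>auto simp: if_distrib[of "\<lambda>x. x * _"] cong: if_cong\<close>)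
  then show ?thesis
    using assms by (simp add: lie_unit_def left_diff_distrib sum_subtractf)
qed

lemma star_lie_unit:
  assumes "a < N" "b < N"
  shows "star (lie_unit a b) = - lie_unit a b"
proof -
  define E :: "complex mat" where "E = mat N N (\<lambda>(c, d). if c = a \<and> d = b then 1 else 0)"
  have E: "E \<in> MN" by (simp add: E_def)
  have "star E $$ (c, d) = K $$ (c, b) * K $$ (d, a)" if cd: "c < N" "d < N" for c d
  proof -
    have "star E $$ (c, d) = (\<Sum>p<N. \<Sum>q<N. if q = a \<and> p = b then K $$ (c, p) * K $$ (d, q) else 0)"
      unfolding star_index[OF E cd] by (intro sum.cong refl) (auto simp: E_def)
    also have "\<dots> = (\<Sum>p<N. if p = b then K $$ (c, b) * K $$ (d, a) else 0)"
      by (intro sum.cong) (use assms in auto)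
    finally show ?thesis using assms by simp
  qed
  then have L: "lie_unit a b = E + - star E"
    by (intro eq_matI) (auto simp: lie_unit_def E_def)
  show ?thesis
    unfolding L using E by (intro eq_matI) (auto simp: star_add star_uminus star_star)
qed

text \<open>The matrix unit contributes \<open>A_aa B_bb\<close>, which separates into two traces
  and splits a word. Its \<open>star\<close> contributes \<open>(A K)_ab (K^T B)_ab\<close>, which
  reconnects \<open>A\<close> with the reversed \<open>B\<close> and twists a word; the sign arises
  from \<open>K = eps K^T\<close>.\<close>

lemma sum_lie_unit_entry:
  assumes A: "A \<in> MN" and B: "B \<in> MN"
  shows "(\<Sum>a<N. \<Sum>b<N. (A * lie_unit a b * B) $$ (a, b)) =
    trace_mat A * trace_mat B - eps * trace_mat (A * star B)"
proof -
  have "(A * lie_unit a b * B) $$ (a, b) = A $$ (a, a) * B $$ (b, b) -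
      (A * K) $$ (a, b) * (transpose_mat K * B) $$ (a, b)" if ab: "a < N" "b < N" for a b
  proof -
    have "(\<Sum>c<N. \<Sum>d<N. K $$ (c, b) * K $$ (d, a) * (A $$ (a, c) * B $$ (d, b))) =
        (A * K) $$ (a, b) * (transpose_mat K * B) $$ (a, b)"
      using A B ab carrier_matD[OF K_carrier]
      by (simp add: mat_mult_index[of _ N] sum_product mult_ac del: index_mult_mat)
    then show ?thesis
      unfolding mat_mult3_index[OF A lie_unit_carrier B ab] sum_lie_unit[OF ab] by simp
  qed
  then have "(\<Sum>a<N. \<Sum>b<N. (A * lie_unit a b * B) $$ (a, b)) =
      (\<Sum>a<N. \<Sum>b<N. A $$ (a, a) * B $$ (b, b)) -
      (\<Sum>a<N. \<Sum>b<N. (A * K) $$ (a, b) * (transpose_mat K * B) $$ (a, b))"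
    by (simp add: sum_subtractf)
  also have "(\<Sum>a<N. \<Sum>b<N. A $$ (a, a) * B $$ (b, b)) = trace_mat A * trace_mat B"
    using A B by (simp add: trace_mat_eq[of _ N] sum_product)
  also have "(\<Sum>a<N. \<Sum>b<N. (A * K) $$ (a, b) * (transpose_mat K * B) $$ (a, b)) =
      trace_mat (A * K * transpose_mat (transpose_mat K * B))"
    using A B carrier_matD[OF B] carrier_matD[OF K_carrier] by (subst trace_mat_mult[of _ N]) auto
  also have "A * K * transpose_mat (transpose_mat K * B) = A * (K * transpose_mat B * K)"
    using A B by (simp add: transpose_mult[of _ N N _ N] assoc)
  also have "K * transpose_mat B * K = eps \<cdot>\<^sub>m star B"
    using B by (simp add: star_eq) (intro eq_matI, auto simp: eps_square mult.assoc[symmetric])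
  also have "trace_mat (A * (eps \<cdot>\<^sub>m star B)) = eps * trace_mat (A * star B)"
    using A B by (simp add: mult_smult_distrib[of _ N N _ N] trace_mat_smult[of _ N])
  finally show ?thesis .
qed

text \<open>By linearity: the matrix units weighted with the entries of \<open>W\<close> add up to
  \<open>W\<close>, and their images under \<open>star\<close> to \<open>star W\<close>. This merges
  two words.\<close>

lemma sum_lie_unit_trace:
  assumes A: "A \<in> MN" and B: "B \<in> MN" and W: "W \<in> MN"
  shows "(\<Sum>a<N. \<Sum>b<N. W $$ (a, b) * trace_mat (A * lie_unit a b * B)) =
    trace_mat (A * W * B) - trace_mat (A * star W * B)"
proof -
  let ?s = "\<lambda>a b c d. W $$ (a, b) * K $$ (c, b) * K $$ (d, a) * (B * A) $$ (d, c)"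
  have tr: "trace_mat (A * T * B) = (\<Sum>c<N. \<Sum>d<N. T $$ (c, d) * (B * A) $$ (d, c))"
    if T: "T \<in> MN" for T
  proof -
    have "trace_mat (A * T * B) = trace_mat (T * (B * A))"
      using A B T trace_mat_comm[of A N "T * B"] by (simp add: assoc)
    also have "\<dots> = (\<Sum>c<N. \<Sum>d<N. T $$ (c, d) * (B * A) $$ (d, c))"
      using A B T by (intro trace_mat_mult) auto
    finally show ?thesis .
  qed
  have "(\<Sum>a<N. \<Sum>b<N. W $$ (a, b) * trace_mat (A * lie_unit a b * B)) =
      (\<Sum>a<N. \<Sum>b<N. W $$ (a, b) * (B * A) $$ (b, a)) -
      (\<Sum>a<N. \<Sum>b<N. W $$ (a, b) * (\<Sum>c<N. \<Sum>d<N. K $$ (c, b) * K $$ (d, a) * (B * A) $$ (d, c)))"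
    unfolding sum_subtractf[symmetric] right_diff_distrib[symmetric]
    by (intro sum.cong refl) (simp add: tr sum_lie_unit)
  also have "(\<Sum>a<N. \<Sum>b<N. W $$ (a, b) * (B * A) $$ (b, a)) = trace_mat (A * W * B)"
    by (rule tr[OF W, symmetric])
  also have "(\<Sum>a<N. \<Sum>b<N. W $$ (a, b) * (\<Sum>c<N. \<Sum>d<N. K $$ (c, b) * K $$ (d, a) * (B * A) $$ (d, c))) =
      (\<Sum>a<N. \<Sum>b<N. \<Sum>c<N. \<Sum>d<N. ?s a b c d)"
    by (simp add: sum_distrib_left mult.assoc)
  \<comment> \<open>The sums are brought from the order a, b, c, d into c, d, b, a, the shape of
    \<open>star_index\<close>.\<close>
  also have "\<dots> = (\<Sum>b<N. \<Sum>a<N. \<Sum>c<N. \<Sum>d<N. ?s a b c d)"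
    by (rule sum.swap)
  also have "\<dots> = (\<Sum>b<N. \<Sum>c<N. \<Sum>a<N. \<Sum>d<N. ?s a b c d)"
    by (intro sum.cong refl sum.swap)
  also have "\<dots> = (\<Sum>c<N. \<Sum>b<N. \<Sum>a<N. \<Sum>d<N. ?s a b c d)"
    by (rule sum.swap)
  also have "\<dots> = (\<Sum>c<N. \<Sum>b<N. \<Sum>d<N. \<Sum>a<N. ?s a b c d)"
    by (intro sum.cong refl sum.swap)
  also have "\<dots> = (\<Sum>c<N. \<Sum>d<N. \<Sum>b<N. \<Sum>a<N. ?s a b c d)"
    by (intro sum.cong refl sum.swap)
  also have "\<dots> = (\<Sum>c<N. \<Sum>d<N. star W $$ (c, d) * (B * A) $$ (d, c))"
    using W by (intro sum.cong refl) (simp add: star_index sum_distrib_right mult.assoc)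
  also have "\<dots> = trace_mat (A * star W * B)"
    using W by (intro tr[symmetric]) auto
  finally show ?thesis .
qed

text \<open>This is the integrand of the loop equation. Differentiating the entry of
  \<open>w\<close> splits or twists \<open>w\<close>; differentiating the traces of
  \<open>vs\<close> merges \<open>w\<close> into one of these words.\<close>

lemma sum_lie_unit_derivs:
  assumes g: "\<And>i. g i \<in> form_group"
  shows "(\<Sum>a<N. \<Sum>b<N. word_deriv i (lie_unit a b) g w a b * family_val g vs +
      word_val g w $$ (a, b) * family_deriv i (lie_unit a b) g vs) =
    (\<Sum>(P, Q, s)\<leftarrow>cuts i w. s * (family_val g (P # Q # vs) - eps * family_val g ((P @ word_inv Q) # vs))) +
    (\<Sum>(P, Q, s, us)\<leftarrow>family_cuts i vs. s * (family_val g ((P @ w @ Q) # us) -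
      family_val g ((P @ word_inv w @ Q) # us)))"
proof -
  note [simp] = word_val_carrier[OF g]
  let ?v = "word_val g"
  have "(\<Sum>a<N. \<Sum>b<N. word_deriv i (lie_unit a b) g w a b * y) =
      (\<Sum>(P, Q, s)\<leftarrow>cuts i w. s * (trace_mat (?v P) * trace_mat (?v Q) - eps * trace_mat (?v P * star (?v Q))) * y)" for y
  proof -
    have "(\<Sum>a<N. \<Sum>b<N. word_deriv i (lie_unit a b) g w a b * y) =
        (\<Sum>a<N. \<Sum>b<N. word_deriv i (lie_unit a b) g w a b) * y"
      by (simp add: sum_distrib_right)
    also have "(\<Sum>a<N. \<Sum>b<N. word_deriv i (lie_unit a b) g w a b) =
        (\<Sum>(P, Q, s)\<leftarrow>cuts i w. s * (\<Sum>a<N. \<Sum>b<N. (?v P * lie_unit a b * ?v Q) $$ (a, b)))"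
      by (simp add: word_deriv_def split_def sum_sum_list_swap sum_distrib_left)
    finally show ?thesis
      by (simp add: sum_lie_unit_entry split_def sum_list_mult_const)
  qed
  moreover have "(\<Sum>a<N. \<Sum>b<N. ?v w $$ (a, b) * family_deriv i (lie_unit a b) g vs) =
      (\<Sum>(P, Q, s, us)\<leftarrow>family_cuts i vs. s * (trace_mat (?v P * ?v w * ?v Q) - trace_mat (?v P * star (?v w) * ?v Q)) * family_val g us)"
  proof -
    have "(\<Sum>a<N. \<Sum>b<N. ?v w $$ (a, b) * family_deriv i (lie_unit a b) g vs) =
        (\<Sum>(P, Q, s, us)\<leftarrow>family_cuts i vs. s * (\<Sum>a<N. \<Sum>b<N. ?v w $$ (a, b) * trace_mat (?v P * lie_unit a b * ?v Q)) * family_val g us)"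
      by (simp add: family_deriv_def split_def sum_list_const_mult[symmetric] sum_sum_list_swap
          sum_distrib_left sum_distrib_right mult_ac)
    then show ?thesis by (simp add: sum_lie_unit_trace)
  qed
  ultimately show ?thesis
    using g by (simp add: sum.distrib family_val_def word_val_append word_val_inv assoc split_def algebra_simps)
qed

end

section \<open>First-order expansions\<close>

text \<open>A first-order expansion at 0, uniform in \<open>\<omega>\<close> so that it can be
  integrated. The same constant bounds the values, the derivative and the remainder, which makes
  closure under products convenient.\<close>

definition expansion_bound ::
  "'w set \<Rightarrow> (real \<Rightarrow> 'w \<Rightarrow> complex) \<Rightarrow> ('w \<Rightarrow> complex) \<Rightarrow> real \<Rightarrow> bool" where
  "expansion_bound \<Omega> F F' C \<longleftrightarrow> (\<forall>t \<omega>. \<bar>t\<bar> \<le> 1 \<longrightarrow> \<omega> \<in> \<Omega> \<longrightarrow> cmod (F t \<omega>) \<le> C \<and>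
     cmod (F' \<omega>) \<le> C \<and> cmod (F t \<omega> - F 0 \<omega> - of_real t * F' \<omega>) \<le> C * t\<^sup>2)"

definition expands :: "'w set \<Rightarrow> (real \<Rightarrow> 'w \<Rightarrow> complex) \<Rightarrow> ('w \<Rightarrow> complex) \<Rightarrow> bool" where
  "expands \<Omega> F F' \<longleftrightarrow> (\<exists>C. expansion_bound \<Omega> F F' C)"

lemma expansion_boundD:
  assumes "expansion_bound \<Omega> F F' C" "\<omega> \<in> \<Omega>"
  shows "C \<ge> 0" "\<bar>t\<bar> \<le> 1 \<Longrightarrow> cmod (F t \<omega>) \<le> C" "cmod (F' \<omega>) \<le> C"
    "\<bar>t\<bar> \<le> 1 \<Longrightarrow> cmod (F t \<omega> - F 0 \<omega> - of_real t * F' \<omega>) \<le> C * t\<^sup>2"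
proof -
  have *: "\<bar>t\<bar> \<le> 1 \<Longrightarrow> cmod (F t \<omega>) \<le> C \<and> cmod (F' \<omega>) \<le> C \<and>
      cmod (F t \<omega> - F 0 \<omega> - of_real t * F' \<omega>) \<le> C * t\<^sup>2" for t
    using assms by (simp add: expansion_bound_def)
  show "cmod (F' \<omega>) \<le> C" using *[of 0] by simp
  then show "C \<ge> 0" using norm_ge_zero order_trans by blast
qed (use assms in \<open>simp_all add: expansion_bound_def\<close>)

lemma expands_cong:
  assumes "expands \<Omega> F F'" "\<And>t \<omega>. \<omega> \<in> \<Omega> \<Longrightarrow> G t \<omega> = F t \<omega>" "\<And>\<omega>. \<omega> \<in> \<Omega> \<Longrightarrow> G' \<omega> = F' \<omega>"
  shows "expands \<Omega> G G'"
  using assms by (simp add: expands_def expansion_bound_def)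

lemma expands_const:
  assumes "\<And>\<omega>. \<omega> \<in> \<Omega> \<Longrightarrow> cmod (f \<omega>) \<le> C"
  shows "expands \<Omega> (\<lambda>t. f) (\<lambda>_. 0)"
  unfolding expands_def expansion_bound_def
proof (intro exI[of _ "max C 0"] allI impI)
  fix t :: real and \<omega> assume "\<omega> \<in> \<Omega>"
  then show "cmod (f \<omega>) \<le> max C 0 \<and> cmod 0 \<le> max C 0 \<and>
      cmod (f \<omega> - f \<omega> - of_real t * 0) \<le> max C 0 * t\<^sup>2"
    using assms[of \<omega>] by simp
qed

lemma expands_add:
  assumes "expands \<Omega> F F'" "expands \<Omega> G G'"
  shows "expands \<Omega> (\<lambda>t \<omega>. F t \<omega> + G t \<omega>) (\<lambda>\<omega>. F' \<omega> + G' \<omega>)"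
proof -
  obtain C where C: "expansion_bound \<Omega> F F' C"
    using assms(1) by (auto simp: expands_def)
  obtain D where D: "expansion_bound \<Omega> G G' D"
    using assms(2) by (auto simp: expands_def)
  show ?thesis
    unfolding expands_def expansion_bound_def
  proof (intro exI[of _ "C + D"] allI impI conjI)
    fix t :: real and \<omega> assume t: "\<bar>t\<bar> \<le> 1" and \<omega>: "\<omega> \<in> \<Omega>"
    note C = expansion_boundD[OF C \<omega>] and D = expansion_boundD[OF D \<omega>]
    show "cmod (F t \<omega> + G t \<omega>) \<le> C + D" "cmod (F' \<omega> + G' \<omega>) \<le> C + D"
      using C D t \<omega> by (auto intro!: norm_triangle_mono)
    have *: "F t \<omega> + G t \<omega> - (F 0 \<omega> + G 0 \<omega>) - of_real t * (F' \<omega> + G' \<omega>) =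
        (F t \<omega> - F 0 \<omega> - of_real t * F' \<omega>) + (G t \<omega> - G 0 \<omega> - of_real t * G' \<omega>)"
      by (simp add: algebra_simps)
    show "cmod (F t \<omega> + G t \<omega> - (F 0 \<omega> + G 0 \<omega>) - of_real t * (F' \<omega> + G' \<omega>)) \<le> (C + D) * t\<^sup>2"
      unfolding * distrib_right[of C] by (rule norm_triangle_mono[OF C(4)[OF t] D(4)[OF t]])
  qed
qed

lemma expands_mult:
  assumes "expands \<Omega> F F'" "expands \<Omega> G G'"
  shows "expands \<Omega> (\<lambda>t \<omega>. F t \<omega> * G t \<omega>) (\<lambda>\<omega>. F' \<omega> * G 0 \<omega> + F 0 \<omega> * G' \<omega>)"
proof -
  obtain C where C: "expansion_bound \<Omega> F F' C"
    using assms(1) by (auto simp: expands_def)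
  obtain D where D: "expansion_bound \<Omega> G G' D"
    using assms(2) by (auto simp: expands_def)
  show ?thesis
    unfolding expands_def expansion_bound_def
  proof (intro exI[of _ "4 * (C * D)"] allI impI conjI)
    fix t :: real and \<omega> assume t: "\<bar>t\<bar> \<le> 1" and \<omega>: "\<omega> \<in> \<Omega>"
    note C = expansion_boundD[OF C \<omega>] and D = expansion_boundD[OF D \<omega>]
    have mono: "cmod x \<le> C \<Longrightarrow> cmod y \<le> D \<Longrightarrow> cmod (x * y) \<le> C * D" for x y
      using C(1) by (auto simp: norm_mult intro!: mult_mono)
    have CD: "0 \<le> C * D" using C D by simp
    show "cmod (F t \<omega> * G t \<omega>) \<le> 4 * (C * D)"
      using mono[OF C(2) D(2), OF t t] CD by linarith
    have "cmod (F' \<omega> * G 0 \<omega> + F 0 \<omega> * G' \<omega>) \<le> C * D + C * D"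
      by (intro norm_triangle_mono mono C(2,3) D(2,3) \<omega>) simp_all
    then show "cmod (F' \<omega> * G 0 \<omega> + F 0 \<omega> * G' \<omega>) \<le> 4 * (C * D)"
      using CD by linarith
    define f where "f = F t \<omega> - F 0 \<omega> - of_real t * F' \<omega>"
    define h where "h = G t \<omega> - G 0 \<omega> - of_real t * G' \<omega>"
    have f: "cmod f \<le> C * t\<^sup>2" and h: "cmod h \<le> D * t\<^sup>2"
      using C(4) D(4) t \<omega> by (auto simp: f_def h_def)
    \<comment> \<open>Four error terms, each at most \<open>C D t^2\<close>, whence the constant 4.
      The last one is of third order in \<open>t\<close> and uses that \<open>\<bar>t\<bar>\<close>
      is at most 1.\<close>
    have eq: "F t \<omega> * G t \<omega> - F 0 \<omega> * G 0 \<omega> - of_real t * (F' \<omega> * G 0 \<omega> + F 0 \<omega> * G' \<omega>) =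
       f * G t \<omega> + F 0 \<omega> * h + of_real t * of_real t * (F' \<omega> * G' \<omega>) + of_real t * (F' \<omega> * h)"
      by (simp add: f_def h_def algebra_simps)
    have b1: "cmod (f * G t \<omega>) \<le> (C * t\<^sup>2) * D"
      unfolding norm_mult using C D f t \<omega> by (intro mult_mono) auto
    have b2: "cmod (F 0 \<omega> * h) \<le> C * (D * t\<^sup>2)"
      unfolding norm_mult using C D h t \<omega> by (intro mult_mono) auto
    have b3: "cmod (of_real t * of_real t * (F' \<omega> * G' \<omega>)) \<le> t\<^sup>2 * (C * D)"
    proof -
      have "cmod (of_real t * of_real t :: complex) \<le> t\<^sup>2" by (simp add: norm_mult power2_eq_square)
      then show ?thesis
        unfolding norm_mult[of "of_real t * of_real t"] using C D mono[of "F' \<omega>" "G' \<omega>"] \<omega>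
        by (intro mult_mono) auto
    qed
    have b4: "cmod (of_real t * (F' \<omega> * h)) \<le> 1 * (C * (D * t\<^sup>2))"
      unfolding norm_mult using C D h t \<omega> by (intro mult_mono) auto
    have "cmod (F t \<omega> * G t \<omega> - F 0 \<omega> * G 0 \<omega> - of_real t * (F' \<omega> * G 0 \<omega> + F 0 \<omega> * G' \<omega>))
        \<le> (C * t\<^sup>2) * D + C * (D * t\<^sup>2) + t\<^sup>2 * (C * D) + 1 * (C * (D * t\<^sup>2))"
      unfolding eq by (intro norm_triangle_mono b1 b2 b3 b4)
    then show "cmod (F t \<omega> * G t \<omega> - F 0 \<omega> * G 0 \<omega> - of_real t * (F' \<omega> * G 0 \<omega> + F 0 \<omega> * G' \<omega>))
        \<le> 4 * (C * D) * t\<^sup>2"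
      by (simp add: mult_ac)
  qed
qed

lemma expands_cmult:
  assumes "expands \<Omega> F F'"
  shows "expands \<Omega> (\<lambda>t \<omega>. c * F t \<omega>) (\<lambda>\<omega>. c * F' \<omega>)"
  using expands_mult[OF expands_const[of \<Omega> "\<lambda>_. c" "cmod c"] assms] by simp

lemma expands_sum:
  assumes "finite A" "\<And>k. k \<in> A \<Longrightarrow> expands \<Omega> (F k) (F' k)"
  shows "expands \<Omega> (\<lambda>t \<omega>. \<Sum>k\<in>A. F k t \<omega>) (\<lambda>\<omega>. \<Sum>k\<in>A. F' k \<omega>)"
  using assms by (induction A) (auto intro: expands_const[of _ _ 0] expands_add)

section \<open>Vanishing derivatives of constant integrals, and bounded measurable functions\<close>

context prob_space
begin

text \<open>The integral of \<open>F t\<close> is constant, so \<open>t\<close> times the integral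
  of \<open>F'\<close> is minus the integral of the remainder, which is at most
  \<open>C t^2\<close>. Divide by \<open>t\<close> and let it tend to 0.\<close>

lemma integral_expands_zero:
  assumes F: "expands (space M) F F'" and [measurable]: "\<And>t. F t \<in> borel_measurable M" "F' \<in> borel_measurable M"
    and eq: "\<And>t. (LINT \<omega>|M. F t \<omega>) = (LINT \<omega>|M. F 0 \<omega>)"
  shows "(LINT \<omega>|M. F' \<omega>) = 0"
proof -
  obtain C where C: "expansion_bound (space M) F F' C"
    using F by (auto simp: expands_def)
  obtain \<omega>\<^sub>0 where "\<omega>\<^sub>0 \<in> space M" using not_empty by blast
  then have C0: "C \<ge> 0" by (rule expansion_boundD(1)[OF C])
  have int: "integrable M F'" "\<And>t. \<bar>t\<bar> \<le> 1 \<Longrightarrow> integrable M (F t)"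
    using expansion_boundD(2,3)[OF C] by (auto intro!: integrable_const_bound[of _ C] AE_I2)
  define I where "I = cmod (LINT \<omega>|M. F' \<omega>)"
  have bound: "I \<le> C * t" if t: "0 < t" "t \<le> 1" for t
  proof -
    have i: "integrable M (F t)" "integrable M (F 0)" using int(2) t by auto
    have "(LINT \<omega>|M. F t \<omega> - F 0 \<omega> - of_real t * F' \<omega>) = - of_real t * (LINT \<omega>|M. F' \<omega>)"
      using int(1) i eq[of t] by simp
    then have "t * I = cmod (LINT \<omega>|M. F t \<omega> - F 0 \<omega> - of_real t * F' \<omega>)"
      using t by (simp add: norm_mult I_def)
    also have "\<dots> \<le> (LINT \<omega>|M. cmod (F t \<omega> - F 0 \<omega> - of_real t * F' \<omega>))"
      by (rule integral_norm_bound)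
    also have "\<dots> \<le> C * t\<^sup>2"
      using int(1) i t expansion_boundD(4)[OF C] by (intro integral_le_const AE_I2) auto
    finally have "t * I \<le> t * (C * t)" by (simp add: power2_eq_square mult_ac)
    then show ?thesis using t by (subst (asm) mult_le_cancel_left_pos) auto
  qed
  have "I \<le> 0"
  proof (rule ccontr)
    assume "\<not> I \<le> 0"
    \<comment> \<open>Makes \<open>C * t\<close> at most \<open>I / 2\<close>; adding 1 keeps the
      denominator positive for \<open>C = 0\<close>, and the minimum keeps \<open>t\<close> in the
      range of the expansion.\<close>
    define t where "t = min 1 (I / (2 * (C + 1)))"
    have "0 < t" "t \<le> 1" "t \<le> I / (2 * (C + 1))" using \<open>\<not> I \<le> 0\<close> C0 by (auto simp: t_def)
    then have "I \<le> C * (I / (2 * (C + 1)))" using bound[of t] C0 by (meson mult_left_mono order_trans)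
    also have "\<dots> \<le> I / 2" using C0 \<open>\<not> I \<le> 0\<close> by (simp add: field_simps)
    finally show False using \<open>\<not> I \<le> 0\<close> by simp
  qed
  then show ?thesis by (simp add: I_def)
qed

text \<open>Integrability alone is not closed under products; on a probability space these functions
  form an algebra of integrable functions.\<close>

definition bounded_measurable :: "('a \<Rightarrow> complex) \<Rightarrow> bool" where
  "bounded_measurable F \<longleftrightarrow> F \<in> borel_measurable M \<and> (\<exists>C. \<forall>\<omega>\<in>space M. cmod (F \<omega>) \<le> C)"

lemma bounded_measurable_integrable: "bounded_measurable F \<Longrightarrow> integrable M F"
  unfolding bounded_measurable_def by (auto intro!: integrable_const_bound AE_I2)

lemma bounded_measurable_const: "bounded_measurable (\<lambda>_. c)"
  by (auto simp: bounded_measurable_def)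

lemma bounded_measurable_add:
  assumes "bounded_measurable F" "bounded_measurable G"
  shows "bounded_measurable (\<lambda>\<omega>. F \<omega> + G \<omega>)"
proof -
  obtain C D where "\<forall>\<omega>\<in>space M. cmod (F \<omega>) \<le> C" "\<forall>\<omega>\<in>space M. cmod (G \<omega>) \<le> D"
    using assms unfolding bounded_measurable_def by blast
  then have "\<forall>\<omega>\<in>space M. cmod (F \<omega> + G \<omega>) \<le> C + D" by (auto intro: norm_triangle_mono)
  then show ?thesis using assms unfolding bounded_measurable_def by auto
qed

lemma bounded_measurable_mult:
  assumes "bounded_measurable F" "bounded_measurable G"
  shows "bounded_measurable (\<lambda>\<omega>. F \<omega> * G \<omega>)"
proof -
  obtain C D where CD: "\<forall>\<omega>\<in>space M. cmod (F \<omega>) \<le> C" "\<forall>\<omega>\<in>space M. cmod (G \<omega>) \<le> D"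
    using assms unfolding bounded_measurable_def by blast
  have "cmod (F \<omega> * G \<omega>) \<le> C * D" if "\<omega> \<in> space M" for \<omega>
  proof -
    have "0 \<le> C" using CD(1) that norm_ge_zero order_trans by blast
    then show ?thesis unfolding norm_mult using CD that by (intro mult_mono) auto
  qed
  then show ?thesis using assms unfolding bounded_measurable_def by auto
qed

lemma bounded_measurable_sum:
  "(\<And>k. k \<in> A \<Longrightarrow> bounded_measurable (F k)) \<Longrightarrow> bounded_measurable (\<lambda>\<omega>. \<Sum>k\<in>A. F k \<omega>)"
  by (induction A rule: infinite_finite_induct) (auto intro: bounded_measurable_const bounded_measurable_add)

lemma bounded_measurable_sum_list:
  "(\<And>x. x \<in> set L \<Longrightarrow> bounded_measurable (F x)) \<Longrightarrow> bounded_measurable (\<lambda>\<omega>. \<Sum>x\<leftarrow>L. F x \<omega>)"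
  by (induction L) (auto intro: bounded_measurable_const bounded_measurable_add)

lemma bounded_measurable_prod_list:
  "(\<And>x. x \<in> set L \<Longrightarrow> bounded_measurable (F x)) \<Longrightarrow> bounded_measurable (\<lambda>\<omega>. \<Prod>x\<leftarrow>L. F x \<omega>)"
  by (induction L) (auto intro: bounded_measurable_const bounded_measurable_mult)

lemma bounded_measurable_cong:
  "bounded_measurable F \<Longrightarrow> (\<And>\<omega>. \<omega> \<in> space M \<Longrightarrow> G \<omega> = F \<omega>) \<Longrightarrow> bounded_measurable G"
  unfolding bounded_measurable_def by (metis measurable_cong)

lemma integral_sum_list:
  "(\<And>x. x \<in> set L \<Longrightarrow> bounded_measurable (F x)) \<Longrightarrow>
    (LINT \<omega>|M. (\<Sum>x\<leftarrow>L. F x \<omega>)) = (\<Sum>x\<leftarrow>L. (LINT \<omega>|M. F x \<omega>))"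
proof (induction L)
  case (Cons x L)
  then show ?case
    using bounded_measurable_integrable[of "F x"]
      bounded_measurable_integrable[OF bounded_measurable_sum_list[of L F]] by simp
qed simp

end

section \<open>The loop equation\<close>

text \<open>The product rule for the first letter, matching the recursion of \<open>cuts\<close>:
  either the insertion happens at that letter, or at a cut of the remaining word.\<close>

lemma (in matrix_form) word_deriv_Cons:
  assumes g: "\<And>i. g i \<in> form_group" and T: "T \<in> MN" and ab: "a < N" "b < N"
  shows "word_deriv i T g (l # w) a b =
    ((if l = (i, True) then T * letter_val g l else if l = (i, False) then - (letter_val g l * T)
      else 0\<^sub>m N N) * word_val g w) $$ (a, b) +
    (\<Sum>k<N. letter_val g l $$ (a, k) * word_deriv i T g w k b)"
proof -
  note [simp] = word_val_carrier[OF g] letter_val_carrier[OF g]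
  have "(letter_val g l * word_val g P * T * word_val g Q) $$ (a, b) =
      (\<Sum>k<N. letter_val g l $$ (a, k) * (word_val g P * T * word_val g Q) $$ (k, b))" for P Q
    using T ab mat_mult_index[of "letter_val g l" N "word_val g P * T * word_val g Q" a b]
    by (simp add: assoc del: index_mult_mat)
  then have "(\<Sum>(P, Q, s)\<leftarrow>cuts i w. s * (letter_val g l * word_val g P * T * word_val g Q) $$ (a, b)) =
      (\<Sum>k<N. letter_val g l $$ (a, k) * word_deriv i T g w k b)"
    by (simp add: word_deriv_def split_def sum_sum_list_swap sum_distrib_left mult_ac
        del: index_mult_mat flip: sum_list_const_mult)
  moreover have "T * letter_val g l * word_val g w = T * (letter_val g l * word_val g w)"
    using T by (simp add: assoc)
  moreover have "(- (letter_val g l * T) * word_val g w) $$ (a, b) = - ((letter_val g l * T * word_val g w) $$ (a, b))"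
    unfolding mat_mult_index[OF uminus_carrier_mat[OF mult_closed[OF letter_val_carrier[OF g] T]] word_val_carrier[OF g] ab]
      mat_mult_index[OF mult_closed[OF letter_val_carrier[OF g] T] word_val_carrier[OF g] ab] sum_negf[symmetric]
    using ab carrier_matD[OF mult_closed[OF letter_val_carrier[OF g] T]]
    by (intro sum.cong refl) (simp del: index_mult_mat)
  moreover have "(0\<^sub>m N N * word_val g w) $$ (a, b) = 0"
    using ab by (simp add: left_mult_zero_mat[of _ N N])
  ultimately show ?thesis
    using T by (cases "l = (i, True)"; cases "l = (i, False)")
      (simp_all add: word_deriv_def comp_def split_def del: index_mult_mat)
qed

text \<open>What the loop equation uses of independent Haar matrices: values in the group,
  measurable entries, and for each \<open>h\<close> a measure-preserving map that multiplies one
  generator by \<open>h\<close> and fixes the others. The probability space is abstract so that real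
  matrices may be replaced by their complexifications.\<close>

locale haar_matrices = matrix_form N K eps + prob_space M
  for N :: nat and K :: "complex mat" and eps :: complex and M :: "'w measure" +
  fixes r :: nat and X :: "nat \<Rightarrow> 'w \<Rightarrow> complex mat"
  assumes X: "\<omega> \<in> space M \<Longrightarrow> X i \<omega> \<in> form_group"
    and X_measurable: "a < N \<Longrightarrow> b < N \<Longrightarrow> (\<lambda>\<omega>. X i \<omega> $$ (a, b)) \<in> borel_measurable M"
    and X_invariant: "i < r \<Longrightarrow> h \<in> form_group \<Longrightarrow> \<exists>\<tau>. \<tau> \<in> measurable M M \<and> distr M M \<tau> = M \<and>
      (\<forall>\<omega>\<in>space M. (\<lambda>j. X j (\<tau> \<omega>)) = (\<lambda>j. X j \<omega>)(i := h * X i \<omega>))"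
begin

abbreviation gens :: "'w \<Rightarrow> nat \<Rightarrow> complex mat" where
  "gens \<omega> \<equiv> \<lambda>i. X i \<omega>"

abbreviation V :: "'w \<Rightarrow> letter list \<Rightarrow> complex mat" where
  "V \<omega> \<equiv> word_val (gens \<omega>)"

definition moment :: "letter list list \<Rightarrow> complex" where
  "moment ws = (LINT \<omega>|M. family_val (gens \<omega>) ws)"

lemma V_carrier [simp]: "\<omega> \<in> space M \<Longrightarrow> V \<omega> w \<in> MN"
  by (rule word_val_carrier) (rule X)

lemma bounded_measurable_letter:
  assumes "a < N" "b < N"
  shows "bounded_measurable (\<lambda>\<omega>. letter_val (gens \<omega>) l $$ (a, b))"
proof -
  have *: "bounded_measurable (\<lambda>\<omega>. X i \<omega> $$ (p, q))" if "p < N" "q < N" for i p q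
    using X_measurable[OF that] form_group_entry_le[OF X that]
    unfolding bounded_measurable_def by blast
  show ?thesis
  proof (cases "snd l")
    case True
    then show ?thesis using * assms by (simp add: letter_val_def)
  next
    case False
    have "bounded_measurable (\<lambda>\<omega>. \<Sum>p<N. \<Sum>q<N. X (fst l) \<omega> $$ (q, p) * (K $$ (a, p) * K $$ (b, q)))"
      by (intro bounded_measurable_sum bounded_measurable_mult bounded_measurable_const *) auto
    then show ?thesis
      using False assms form_groupD(1)[OF X]
      by (elim bounded_measurable_cong) (simp add: letter_val_def star_index)
  qed
qed

lemma bounded_measurable_word:
  "a < N \<Longrightarrow> b < N \<Longrightarrow> bounded_measurable (\<lambda>\<omega>. V \<omega> w $$ (a, b))"
proof (induction w arbitrary: a b)
  case Nil
  then show ?case by (simp add: bounded_measurable_const)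
next
  case (Cons l w)
  have "bounded_measurable (\<lambda>\<omega>. \<Sum>k<N. letter_val (gens \<omega>) l $$ (a, k) * V \<omega> w $$ (k, b))"
    by (intro bounded_measurable_sum bounded_measurable_mult bounded_measurable_letter Cons) (use Cons in auto)
  then show ?case
    using Cons(2,3) letter_val_carrier[OF X]
    by (elim bounded_measurable_cong) (simp add: mat_mult_index[of _ N] del: index_mult_mat)
qed

lemma bounded_measurable_trace: "bounded_measurable (\<lambda>\<omega>. trace_mat (V \<omega> w))"
proof -
  have "bounded_measurable (\<lambda>\<omega>. \<Sum>a<N. V \<omega> w $$ (a, a))"
    by (intro bounded_measurable_sum bounded_measurable_word) auto
  then show ?thesis by (elim bounded_measurable_cong) (simp add: trace_mat_eq[of _ N])
qed

lemma bounded_measurable_family: "bounded_measurable (\<lambda>\<omega>. family_val (gens \<omega>) ws)"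
  unfolding family_val_def by (intro bounded_measurable_prod_list bounded_measurable_trace)

lemma moment_le: "cmod (moment ws) \<le> real N ^ length ws"
proof -
  have "cmod (moment ws) \<le> (LINT \<omega>|M. cmod (family_val (gens \<omega>) ws))"
    unfolding moment_def by (rule integral_norm_bound)
  also have "\<dots> \<le> real N ^ length ws"
    using bounded_measurable_integrable[OF bounded_measurable_family] family_val_le X
    by (intro integral_le_const AE_I2) auto
  finally show ?thesis .
qed

lemma moment_cong:
  assumes "\<And>\<omega>. \<omega> \<in> space M \<Longrightarrow> family_val (gens \<omega>) us = family_val (gens \<omega>) vs"
  shows "moment us = moment vs"
  unfolding moment_def using assms by (intro Bochner_Integration.integral_cong) auto

lemma moment_perm: "mset us = mset vs \<Longrightarrow> moment us = moment vs"
  by (rule moment_cong) (simp add: family_val_def flip: prod_mset_prod_list)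

lemma moment_trace_cong:
  "(\<And>g. (\<And>i. g i \<in> form_group) \<Longrightarrow> trace_mat (word_val g u) = trace_mat (word_val g v)) \<Longrightarrow>
    moment (u # ws) = moment (v # ws)"
  by (rule moment_cong) (simp add: family_val_def X)

text \<open>The path consists of the Cayley transforms of \<open>t H\<close>. From
  \<open>h = 1 + t (H + h H)\<close> and the bounded entries of \<open>h\<close> one gets
  \<open>h - 1 = O(t)\<close>; inserted once more, this gives
  \<open>h - 1 - 2 t H = t (h - 1) H = O(t^2)\<close>. Hence the velocity is
  \<open>2 H\<close>.\<close>

lemma skew_path:
  assumes H: "H \<in> MN" "mat_adjoint H = - H" "star H = - H"
  obtains h :: "real \<Rightarrow> complex mat" where "\<And>t. h t \<in> form_group" "h 0 = 1\<^sub>m N"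
    "\<And>a b. a < N \<Longrightarrow> b < N \<Longrightarrow> expands \<Omega> (\<lambda>t _. h t $$ (a, b)) (\<lambda>_. 2 * H $$ (a, b))"
proof -
  have "\<exists>h. h \<in> form_group \<and> h = 1\<^sub>m N + of_real t \<cdot>\<^sub>m H + h * (of_real t \<cdot>\<^sub>m H)" for t
  proof -
    have tH: "of_real t \<cdot>\<^sub>m H \<in> MN" using H by simp
    have adjH: "cnj (H $$ (j, i)) = - H $$ (i, j)" if "i < N" "j < N" for i j
      using adjoint_index[OF H(1) that] that H by simp
    have "mat_adjoint (of_real t \<cdot>\<^sub>m H) = - (of_real t \<cdot>\<^sub>m H)"
    proof (rule eq_matI)
      fix i j assume "i < dim_row (- (of_real t \<cdot>\<^sub>m H))" "j < dim_col (- (of_real t \<cdot>\<^sub>m H))"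
      then have ij: "i < N" "j < N" using H by auto
      show "mat_adjoint (of_real t \<cdot>\<^sub>m H) $$ (i, j) = (- (of_real t \<cdot>\<^sub>m H)) $$ (i, j)"
        unfolding adjoint_index[OF tH ij] using ij H(1) by (simp add: adjH)
    qed (use H(1) carrier_matD[OF adjoint_closed[OF tH]] in auto)
    moreover have "star (of_real t \<cdot>\<^sub>m H) = - (of_real t \<cdot>\<^sub>m H)"
      unfolding star_smult[OF H(1)] H(3) using H(1) by (intro eq_matI) auto
    ultimately show ?thesis using cayley[OF tH] by metis
  qed
  then obtain h where h: "\<And>t. h t \<in> form_group"
      "\<And>t. h t = 1\<^sub>m N + of_real t \<cdot>\<^sub>m H + h t * (of_real t \<cdot>\<^sub>m H)"
    by metis
  note hC [simp] = form_groupD(1)[OF h(1)]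
  have entry: "h t $$ (a, b) = 1\<^sub>m N $$ (a, b) + of_real t * (H $$ (a, b) + (\<Sum>k<N. h t $$ (a, k) * H $$ (k, b)))"
    if "a < N" "b < N" for t a b
    by (subst h(2)) (use that H(1) carrier_matD[OF hC] in \<open>simp add: mat_mult_index[of _ N] sum_distrib_left mult_ac distrib_left del: index_mult_mat(1)\<close>)
  define c where "c = (\<Sum>p\<in>{..<N} \<times> {..<N}. cmod (H $$ p))"
  have c: "cmod (H $$ (a, b)) \<le> c" if "a < N" "b < N" for a b
    unfolding c_def using that by (intro member_le_sum) auto
  have c0: "c \<ge> 0" by (simp add: c_def sum_nonneg)
  define d where "d = c + real N * c"
  have d0: "d \<ge> 0" using c0 by (simp add: d_def)
  have near: "cmod (h t $$ (a, b) - 1\<^sub>m N $$ (a, b)) \<le> \<bar>t\<bar> * d" if "a < N" "b < N" for t a b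
  proof -
    have "cmod (\<Sum>k<N. h t $$ (a, k) * H $$ (k, b)) \<le> (\<Sum>k<N. 1 * c)"
      unfolding norm_mult[symmetric]
      by (intro sum_norm_le, unfold norm_mult, intro mult_mono)
        (use that form_group_entry_le[OF h(1)] c in auto)
    then have "cmod (H $$ (a, b) + (\<Sum>k<N. h t $$ (a, k) * H $$ (k, b))) \<le> d"
      unfolding d_def using c[OF that] by (intro norm_triangle_mono) auto
    then show ?thesis
      unfolding entry[OF that] by (simp add: norm_mult mult_left_mono)
  qed
  have h0: "h 0 = 1\<^sub>m N"
  proof (rule eq_matI)
    fix a b assume "a < dim_row (1\<^sub>m N :: complex mat)" "b < dim_col (1\<^sub>m N :: complex mat)"
    then show "h 0 $$ (a, b) = 1\<^sub>m N $$ (a, b)" by (subst entry) simp_all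
  qed (use carrier_matD[OF hC[of 0]] in simp_all)
  have h_expands: "expands \<Omega> (\<lambda>t _. h t $$ (a, b)) (\<lambda>_. 2 * H $$ (a, b))" if ab: "a < N" "b < N" for a b
    unfolding expands_def expansion_bound_def
  \<comment> \<open>One constant for three estimates: 1 bounds the entries of \<open>h t\<close>,
    \<open>2 * c\<close> those of \<open>2 H\<close>, and \<open>real N * (d * c)\<close> is the
    coefficient of the remainder.\<close>
  proof (intro exI[of _ "1 + 2 * c + real N * (d * c)"] allI impI conjI)
    fix t :: real and \<omega> assume t: "\<bar>t\<bar> \<le> 1"
    have pos: "0 \<le> real N * (d * c)" using c0 d0 by simp
    show "cmod (h t $$ (a, b)) \<le> 1 + 2 * c + real N * (d * c)"
      using form_group_entry_le[OF h(1) ab, of t] c0 pos by simp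
    show "cmod (2 * H $$ (a, b)) \<le> 1 + 2 * c + real N * (d * c)"
      using c[OF ab] pos by (simp add: norm_mult)
    have "(\<Sum>k<N. h t $$ (a, k) * H $$ (k, b)) - H $$ (a, b) =
        (\<Sum>k<N. (h t $$ (a, k) - 1\<^sub>m N $$ (a, k)) * H $$ (k, b))"
      using ab by (simp add: left_diff_distrib sum_subtractf if_distrib[of "\<lambda>x. x * _"] cong: if_cong)
    then have "h t $$ (a, b) - h 0 $$ (a, b) - of_real t * (2 * H $$ (a, b)) =
        of_real t * (\<Sum>k<N. (h t $$ (a, k) - 1\<^sub>m N $$ (a, k)) * H $$ (k, b))"
      unfolding h0 entry[OF ab, of t] by (simp add: algebra_simps)
    moreover have "cmod (\<Sum>k<N. (h t $$ (a, k) - 1\<^sub>m N $$ (a, k)) * H $$ (k, b)) \<le> (\<Sum>k<N. (\<bar>t\<bar> * d) * c)"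
      by (intro sum_norm_le, unfold norm_mult, intro mult_mono) (use near c ab d0 in auto)
    ultimately have "cmod (h t $$ (a, b) - h 0 $$ (a, b) - of_real t * (2 * H $$ (a, b)))
        \<le> \<bar>t\<bar> * (real N * (\<bar>t\<bar> * d * c))"
      by (simp add: norm_mult mult_left_mono)
    also have "\<dots> = (real N * (d * c)) * (\<bar>t\<bar> * \<bar>t\<bar>)" by (simp only: mult_ac)
    also have "\<bar>t\<bar> * \<bar>t\<bar> = t\<^sup>2" by (simp add: power2_eq_square)
    also have "(real N * (d * c)) * t\<^sup>2 \<le> (1 + 2 * c + real N * (d * c)) * t\<^sup>2" using c0 by (intro mult_right_mono) auto
    finally show "cmod (h t $$ (a, b) - h 0 $$ (a, b) - of_real t * (2 * H $$ (a, b)))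
        \<le> (1 + 2 * c + real N * (d * c)) * t\<^sup>2" .
  qed
  show thesis by (rule that[of h]) (rule h(1) h0 h_expands, assumption?)+
qed

section \<open>Expansions of words and families along a path in the group\<close>

context
  fixes i :: nat and T :: "complex mat" and h :: "real \<Rightarrow> complex mat" and Y :: "real \<Rightarrow> 'w \<Rightarrow> nat \<Rightarrow> complex mat"
  assumes T: "T \<in> MN" "star T = - T"
    and h: "\<And>t. h t \<in> form_group" "h 0 = 1\<^sub>m N"
    and h_expands: "\<And>a b. a < N \<Longrightarrow> b < N \<Longrightarrow> expands (space M) (\<lambda>t _. h t $$ (a, b)) (\<lambda>_. T $$ (a, b))"
    and Y_def: "\<And>t \<omega>. Y t \<omega> = (gens \<omega>)(i := h t * X i \<omega>)"
begin

lemma Y: "\<omega> \<in> space M \<Longrightarrow> Y t \<omega> j \<in> form_group"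
  using X h(1) by (auto simp: Y_def intro: form_group_mult)

lemma Y_0: "\<omega> \<in> space M \<Longrightarrow> Y 0 \<omega> = (gens \<omega>)"
  using form_groupD(1)[OF X] by (auto simp: Y_def h(2))

lemma X_expands_const: "a < N \<Longrightarrow> b < N \<Longrightarrow> expands (space M) (\<lambda>t \<omega>. X j \<omega> $$ (a, b)) (\<lambda>_. 0)"
  using form_group_entry_le[OF X] by (intro expands_const[where C = 1]) auto

lemma hX_expands:
  assumes ab: "a < N" "b < N"
  shows "expands (space M) (\<lambda>t \<omega>. (h t * X i \<omega>) $$ (a, b)) (\<lambda>\<omega>. (T * X i \<omega>) $$ (a, b))"
proof -
  have "expands (space M) (\<lambda>t \<omega>. \<Sum>k<N. h t $$ (a, k) * X i \<omega> $$ (k, b))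
      (\<lambda>\<omega>. \<Sum>k<N. T $$ (a, k) * X i \<omega> $$ (k, b) + h 0 $$ (a, k) * 0)"
    by (intro expands_sum expands_mult h_expands X_expands_const) (use ab in auto)
  then show ?thesis
    by (rule expands_cong)
      (use ab form_groupD(1)[OF X] form_groupD(1)[OF h(1)] T(1) in \<open>simp_all add: mat_mult_index[of _ N] del: index_mult_mat\<close>)
qed

text \<open>For an inverse letter, \<open>star (T X) = star X * star T = - (star X * T)\<close>: the
  variation moves to the right of the letter and changes sign. This is where the two kinds of cuts
  come from.\<close>

lemma letter_expands:
  assumes ab: "a < N" "b < N"
  shows "expands (space M) (\<lambda>t \<omega>. letter_val (Y t \<omega>) l $$ (a, b))
    (\<lambda>\<omega>. (if l = (i, True) then T * letter_val (gens \<omega>) l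
      else if l = (i, False) then - (letter_val (gens \<omega>) l * T) else 0\<^sub>m N N) $$ (a, b))"
proof -
  note XC = form_groupD(1)[OF X] and hC = form_groupD(1)[OF h(1)]
  consider "l = (i, True)" | "l = (i, False)" | "fst l \<noteq> i" by (cases l) auto
  then show ?thesis
  proof cases
    case 1
    then show ?thesis using hX_expands[OF ab] by (simp add: letter_val_def Y_def)
  next
    case 2
    have "expands (space M)
        (\<lambda>t \<omega>. \<Sum>p<N. \<Sum>q<N. (K $$ (a, p) * K $$ (b, q)) * (h t * X i \<omega>) $$ (q, p))
        (\<lambda>\<omega>. \<Sum>p<N. \<Sum>q<N. (K $$ (a, p) * K $$ (b, q)) * (T * X i \<omega>) $$ (q, p))"
      by (intro expands_sum expands_cmult hX_expands) auto
    then show ?thesis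
    proof (rule expands_cong)
      fix t \<omega> assume \<omega>: "\<omega> \<in> space M"
      show "letter_val (Y t \<omega>) l $$ (a, b) =
          (\<Sum>p<N. \<Sum>q<N. (K $$ (a, p) * K $$ (b, q)) * (h t * X i \<omega>) $$ (q, p))"
        using 2 by (simp add: letter_val_def Y_def star_index[OF mult_closed[OF hC XC[OF \<omega>]] ab] mult_ac
            del: index_mult_mat)
    next
      fix \<omega> assume \<omega>: "\<omega> \<in> space M"
      have "(\<Sum>p<N. \<Sum>q<N. (K $$ (a, p) * K $$ (b, q)) * (T * X i \<omega>) $$ (q, p)) = star (T * X i \<omega>) $$ (a, b)"
        by (simp add: star_index[OF mult_closed[OF T(1) XC[OF \<omega>]] ab] mult_ac del: index_mult_mat)
      also have "star (T * X i \<omega>) = - (star (X i \<omega>) * T)"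
        using T XC[OF \<omega>] by (simp add: star_mult)
      finally show "(if l = (i, True) then T * letter_val (gens \<omega>) l
          else if l = (i, False) then - (letter_val (gens \<omega>) l * T) else 0\<^sub>m N N) $$ (a, b) =
        (\<Sum>p<N. \<Sum>q<N. (K $$ (a, p) * K $$ (b, q)) * (T * X i \<omega>) $$ (q, p))"
        using 2 by (simp add: letter_val_def)
    qed
  next
    case 3
    have "expands (space M) (\<lambda>t \<omega>. letter_val (gens \<omega>) l $$ (a, b)) (\<lambda>_. 0)"
      using form_group_entry_le[OF letter_val_form_group ab] X by (intro expands_const[where C = 1]) auto
    then show ?thesis by (rule expands_cong) (use 3 ab in \<open>auto simp: letter_val_def Y_def\<close>)
  qed
qed

lemma word_expands:
  assumes "a < N" "b < N"
  shows "expands (space M) (\<lambda>t \<omega>. word_val (Y t \<omega>) w $$ (a, b))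
    (\<lambda>\<omega>. word_deriv i T (gens \<omega>) w a b)"
  using assms
proof (induction w arbitrary: a b)
  case Nil
  then show ?case
    using expands_const[of "space M" "\<lambda>_. 1\<^sub>m N $$ (a, b)" 1] by (simp add: word_deriv_def)
next
  case (Cons l w)
  note ab = Cons(2,3)
  let ?L = "\<lambda>\<omega>. if l = (i, True) then T * letter_val (gens \<omega>) l
      else if l = (i, False) then - (letter_val (gens \<omega>) l * T) else 0\<^sub>m N N"
  have L: "?L \<omega> \<in> MN" if "\<omega> \<in> space M" for \<omega>
    using letter_val_carrier[OF X] T(1) that by auto
  have "expands (space M) (\<lambda>t \<omega>. \<Sum>k<N. letter_val (Y t \<omega>) l $$ (a, k) * word_val (Y t \<omega>) w $$ (k, b))
      (\<lambda>\<omega>. \<Sum>k<N. ?L \<omega> $$ (a, k) * word_val (Y 0 \<omega>) w $$ (k, b) +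
         letter_val (Y 0 \<omega>) l $$ (a, k) * word_deriv i T (gens \<omega>) w k b)"
    by (intro expands_sum expands_mult letter_expands Cons.IH) (use ab in auto)
  then show ?case
  proof (rule expands_cong)
    fix t \<omega> assume \<omega>: "\<omega> \<in> space M"
    show "word_val (Y t \<omega>) (l # w) $$ (a, b) = (\<Sum>k<N. letter_val (Y t \<omega>) l $$ (a, k) * word_val (Y t \<omega>) w $$ (k, b))"
      using mat_mult_index[OF letter_val_carrier word_val_carrier ab, OF Y[OF \<omega>] Y[OF \<omega>]]
      by (simp del: index_mult_mat)
  next
    fix \<omega> assume \<omega>: "\<omega> \<in> space M"
    show "word_deriv i T (gens \<omega>) (l # w) a b =
      (\<Sum>k<N. ?L \<omega> $$ (a, k) * word_val (Y 0 \<omega>) w $$ (k, b) +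
         letter_val (Y 0 \<omega>) l $$ (a, k) * word_deriv i T (gens \<omega>) w k b)"
      unfolding word_deriv_Cons[OF X[OF \<omega>] T(1) ab] Y_0[OF \<omega>] sum.distrib
      using mat_mult_index[OF L[OF \<omega>] V_carrier[OF \<omega>] ab] by simp
  qed
qed

lemma trace_expands:
  "expands (space M) (\<lambda>t \<omega>. trace_mat (word_val (Y t \<omega>) w))
    (\<lambda>\<omega>. \<Sum>a<N. word_deriv i T (gens \<omega>) w a a)"
proof -
  have "expands (space M) (\<lambda>t \<omega>. \<Sum>a<N. word_val (Y t \<omega>) w $$ (a, a))
      (\<lambda>\<omega>. \<Sum>a<N. word_deriv i T (gens \<omega>) w a a)"
    by (intro expands_sum word_expands) auto
  then show ?thesis
    by (rule expands_cong) (use word_val_carrier Y in \<open>auto simp: trace_mat_eq[of _ N]\<close>)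
qed

lemma family_expands:
  "expands (space M) (\<lambda>t \<omega>. family_val (Y t \<omega>) ws) (\<lambda>\<omega>. family_deriv i T (gens \<omega>) ws)"
proof (induction ws)
  case Nil
  then show ?case
    using expands_const[of "space M" "\<lambda>_. 1" 1] by (simp add: family_deriv_def family_val_def)
next
  case (Cons v ws)
  from expands_mult[OF trace_expands[of v] Cons] show ?case
  proof (rule expands_cong)
    fix \<omega> assume \<omega>: "\<omega> \<in> space M"
    have "(\<Sum>a<N. word_deriv i T (gens \<omega>) v a a) =
        (\<Sum>(P, Q, s)\<leftarrow>cuts i v. s * trace_mat (V \<omega> P * T * V \<omega> Q))"
      using \<omega> T(1) by (simp add: word_deriv_def trace_mat_eq[of _ N] split_def sum_sum_list_swap
          sum_distrib_left del: index_mult_mat)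
    then show "family_deriv i T (gens \<omega>) (v # ws) =
        (\<Sum>a<N. word_deriv i T (gens \<omega>) v a a) * family_val (Y 0 \<omega>) ws +
        trace_mat (word_val (Y 0 \<omega>) v) * family_deriv i T (gens \<omega>) ws"
      by (simp add: family_deriv_def family_val_def Y_0[OF \<omega>] split_def comp_def mult_ac
          flip: sum_list_const_mult)
  qed (simp add: family_val_def)
qed

end

text \<open>Substitution along the measure-preserving map. The integrand is given as a function
  \<open>\<Phi>\<close> of the generators, so that it can be evaluated at the translated ones;
  measurability there follows by composition.\<close>

lemma invariant_integral:
  assumes "i < r" "h \<in> form_group" "F \<in> borel_measurable M"
    "\<And>\<omega>. F \<omega> = \<Phi> (gens \<omega>)"
  shows "(\<lambda>\<omega>. \<Phi> ((gens \<omega>)(i := h * X i \<omega>))) \<in> borel_measurable M"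
    "(LINT \<omega>|M. (\<Phi> ((gens \<omega>)(i := h * X i \<omega>)) :: complex)) = (LINT \<omega>|M. F \<omega>)"
proof -
  obtain \<tau> where \<tau>: "\<tau> \<in> measurable M M" "distr M M \<tau> = M"
    "\<And>\<omega>. \<omega> \<in> space M \<Longrightarrow> (\<lambda>j. X j (\<tau> \<omega>)) = (gens \<omega>)(i := h * X i \<omega>)"
    using X_invariant[OF assms(1,2)] by blast
  have eq: "\<Phi> ((gens \<omega>)(i := h * X i \<omega>)) = F (\<tau> \<omega>)" if "\<omega> \<in> space M" for \<omega>
    by (simp add: assms(4) \<tau>(3)[OF that])
  have "(\<lambda>\<omega>. F (\<tau> \<omega>)) \<in> borel_measurable M"
    by (rule measurable_compose[OF \<tau>(1) assms(3)])
  then show "(\<lambda>\<omega>. \<Phi> ((gens \<omega>)(i := h * X i \<omega>))) \<in> borel_measurable M"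
    using eq by (subst measurable_cong[of M _ "\<lambda>\<omega>. F (\<tau> \<omega>)"]) auto
  have "(LINT \<omega>|M. \<Phi> ((gens \<omega>)(i := h * X i \<omega>))) = (LINT \<omega>|M. F (\<tau> \<omega>))"
    using eq by (intro Bochner_Integration.integral_cong) auto
  also have "\<dots> = (LINT \<omega>|distr M M \<tau>. F \<omega>)"
    by (rule integral_distr[OF \<tau>(1) assms(3), symmetric])
  finally show "(LINT \<omega>|M. \<Phi> ((gens \<omega>)(i := h * X i \<omega>))) = (LINT \<omega>|M. F \<omega>)"
    by (simp add: \<tau>(2))
qed

text \<open>The coefficient of \<open>T $$ (c, d)\<close> in the derivative of the (a, b) entry of
  \<open>w\<close> times the traces of \<open>vs\<close>, when the \<open>i\<close>-th generator
  moves in the direction \<open>T\<close>.\<close>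

definition deriv_coeff :: "nat \<Rightarrow> letter list \<Rightarrow> letter list list \<Rightarrow> nat \<Rightarrow> nat \<Rightarrow> nat \<Rightarrow> nat \<Rightarrow> 'w \<Rightarrow> complex" where
  "deriv_coeff i w vs a b c d \<omega> =
    (\<Sum>(P, Q, s)\<leftarrow>cuts i w. s * (V \<omega> P $$ (a, c) * V \<omega> Q $$ (d, b))) * family_val (gens \<omega>) vs +
    V \<omega> w $$ (a, b) * (\<Sum>(P, Q, s, us)\<leftarrow>family_cuts i vs.
      s * (\<Sum>e<N. V \<omega> P $$ (e, c) * V \<omega> Q $$ (d, e)) * family_val (gens \<omega>) us)"

lemma deriv_eq_coeffs:
  assumes "\<omega> \<in> space M" "T \<in> MN" "a < N" "b < N"
  shows "word_deriv i T (gens \<omega>) w a b * family_val (gens \<omega>) vs +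
    V \<omega> w $$ (a, b) * family_deriv i T (gens \<omega>) vs =
    (\<Sum>c<N. \<Sum>d<N. T $$ (c, d) * deriv_coeff i w vs a b c d \<omega>)"
  unfolding word_deriv_coeffs[OF X[OF assms(1)] assms(2-4)] family_deriv_coeffs[OF X[OF assms(1)] assms(2)]
    deriv_coeff_def
  by (simp add: sum_distrib_left sum_distrib_right sum.distrib distrib_left mult_ac)

lemma bounded_measurable_deriv_coeff:
  assumes "a < N" "b < N" "c < N" "d < N"
  shows "bounded_measurable (deriv_coeff i w vs a b c d)"
  unfolding deriv_coeff_def split_def
  by (intro bounded_measurable_add bounded_measurable_mult bounded_measurable_sum_list bounded_measurable_const
      bounded_measurable_word bounded_measurable_family bounded_measurable_sum) (use assms in auto)

lemma integral_sum_bounded_measurable: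
  "(\<And>k. k \<in> A \<Longrightarrow> bounded_measurable (F k)) \<Longrightarrow>
    (LINT \<omega>|M. (\<Sum>k\<in>A. F k \<omega>)) = (\<Sum>k\<in>A. (LINT \<omega>|M. F k \<omega>))"
  by (intro Bochner_Integration.integral_sum bounded_measurable_integrable)

lemma bounded_measurable_deriv_coeffs:
  assumes "a < N" "b < N"
  shows "bounded_measurable (\<lambda>\<omega>. \<Sum>c<N. \<Sum>d<N. T $$ (c, d) * deriv_coeff i w vs a b c d \<omega>)"
  using assms
  by (intro bounded_measurable_sum bounded_measurable_mult bounded_measurable_const bounded_measurable_deriv_coeff) auto

lemma integral_deriv_coeffs:
  assumes ab: "a < N" "b < N"
  shows "(LINT \<omega>|M. (\<Sum>c<N. \<Sum>d<N. T $$ (c, d) * deriv_coeff i w vs a b c d \<omega>)) =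
    (\<Sum>c<N. \<Sum>d<N. T $$ (c, d) * (LINT \<omega>|M. deriv_coeff i w vs a b c d \<omega>))"
proof -
  have bm: "bounded_measurable (\<lambda>\<omega>. T $$ (c, d) * deriv_coeff i w vs a b c d \<omega>)" if "c < N" "d < N" for c d
    by (intro bounded_measurable_mult bounded_measurable_const bounded_measurable_deriv_coeff ab that)
  have "(LINT \<omega>|M. (\<Sum>c<N. \<Sum>d<N. T $$ (c, d) * deriv_coeff i w vs a b c d \<omega>)) =
      (\<Sum>c<N. (LINT \<omega>|M. (\<Sum>d<N. T $$ (c, d) * deriv_coeff i w vs a b c d \<omega>)))"
    by (intro integral_sum_bounded_measurable bounded_measurable_sum bm) auto
  also have "\<dots> = (\<Sum>c<N. \<Sum>d<N. (LINT \<omega>|M. T $$ (c, d) * deriv_coeff i w vs a b c d \<omega>))"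
    by (intro sum.cong refl integral_sum_bounded_measurable bm) auto
  finally show ?thesis by simp
qed

text \<open>Translating the \<open>i\<close>-th generator along the Cayley path leaves the integral
  constant, so its derivative vanishes. This argument is confined to directions in the real Lie
  algebra.\<close>

lemma integral_deriv_coeff_skew:
  assumes i: "i < r" and H: "H \<in> MN" "mat_adjoint H = - H" "star H = - H" and ab: "a < N" "b < N"
  shows "(\<Sum>c<N. \<Sum>d<N. H $$ (c, d) * (LINT \<omega>|M. deriv_coeff i w vs a b c d \<omega>)) = 0"
proof -
  \<comment> \<open>The velocity of the Cayley path of \<open>H\<close>.\<close>
  define T where "T = 2 \<cdot>\<^sub>m H"
  have T: "T \<in> MN" "star T = - T"
    using H by (auto simp: T_def star_smult intro!: eq_matI)
  obtain h where h: "\<And>t. h t \<in> form_group" "h 0 = 1\<^sub>m N"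
    "\<And>a b. a < N \<Longrightarrow> b < N \<Longrightarrow> expands (space M) (\<lambda>t _. h t $$ (a, b)) (\<lambda>_. 2 * H $$ (a, b))"
    by (rule skew_path[OF H, of "space M"]) (rule that)
  have hT: "expands (space M) (\<lambda>t _. h t $$ (a, b)) (\<lambda>_. T $$ (a, b))" if "a < N" "b < N" for a b
    using h(3)[OF that] that H(1) by (simp add: T_def)
  define Y where "Y = (\<lambda>t \<omega>. (gens \<omega>)(i := h t * X i \<omega>))"
  have Y: "\<And>t \<omega>. Y t \<omega> = (gens \<omega>)(i := h t * X i \<omega>)" by (simp add: Y_def)
  note Y0 = Y_0[OF T h(1,2) hT Y]
  define F where "F = (\<lambda>t \<omega>. word_val (Y t \<omega>) w $$ (a, b) * family_val (Y t \<omega>) vs)"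
  define F' where "F' = (\<lambda>\<omega>. \<Sum>c<N. \<Sum>d<N. T $$ (c, d) * deriv_coeff i w vs a b c d \<omega>)"
  have bm: "bounded_measurable F'"
    unfolding F'_def by (rule bounded_measurable_deriv_coeffs[OF ab])
  have "expands (space M) F F'"
  proof (rule expands_cong)
    show "expands (space M) F (\<lambda>\<omega>. word_deriv i T (gens \<omega>) w a b * family_val (Y 0 \<omega>) vs +
       word_val (Y 0 \<omega>) w $$ (a, b) * family_deriv i T (gens \<omega>) vs)"
      unfolding F_def
      by (rule expands_mult[OF word_expands[OF T h(1,2) hT Y ab] family_expands[OF T h(1,2) hT Y]])
  qed (use Y0 in \<open>simp_all add: F'_def deriv_eq_coeffs[OF _ T(1) ab, symmetric]\<close>)
  moreover have bm0: "bounded_measurable (\<lambda>\<omega>. V \<omega> w $$ (a, b) * family_val (gens \<omega>) vs)"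
    by (intro bounded_measurable_mult bounded_measurable_word bounded_measurable_family ab)
  then have m0: "(\<lambda>\<omega>. V \<omega> w $$ (a, b) * family_val (gens \<omega>) vs) \<in> borel_measurable M"
    by (simp add: bounded_measurable_def)
  note inv = invariant_integral[OF i h(1) m0, of "\<lambda>g. word_val g w $$ (a, b) * family_val g vs", OF refl]
  have "F t \<in> borel_measurable M" for t
    using inv(1)[of t] by (simp add: F_def Y)
  moreover have "(LINT \<omega>|M. F t \<omega>) = (LINT \<omega>|M. V \<omega> w $$ (a, b) * family_val (gens \<omega>) vs)" for t
    using inv(2)[of t] by (simp add: F_def Y)
  ultimately have "(LINT \<omega>|M. F' \<omega>) = 0"
    using bm by (intro integral_expands_zero[of F]) (auto simp: bounded_measurable_def)
  moreover have "(LINT \<omega>|M. F' \<omega>) = (\<Sum>c<N. \<Sum>d<N. T $$ (c, d) * (LINT \<omega>|M. deriv_coeff i w vs a b c d \<omega>))"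
    unfolding F'_def by (rule integral_deriv_coeffs[OF ab])
  ultimately have "2 * (\<Sum>c<N. \<Sum>d<N. H $$ (c, d) * (LINT \<omega>|M. deriv_coeff i w vs a b c d \<omega>)) = 0"
    using H(1) by (simp add: T_def sum_distrib_left mult.assoc)
  then show ?thesis by simp
qed

text \<open>With \<open>A\<close> the adjoint of \<open>T\<close>, both \<open>H1 = T - A\<close>
  and \<open>H2 = \<i> (T + A)\<close> belong to the real Lie algebra, and
  \<open>T = (H1 - \<i> H2) / 2\<close>. The sum is complex linear in \<open>T\<close>.\<close>

lemma integral_deriv_coeff:
  assumes i: "i < r" and T: "T \<in> MN" "star T = - T" and ab: "a < N" "b < N"
  shows "(\<Sum>c<N. \<Sum>d<N. T $$ (c, d) * (LINT \<omega>|M. deriv_coeff i w vs a b c d \<omega>)) = 0"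
proof -
  define A where "A = mat_adjoint T"
  have A: "A \<in> MN" using T by (simp add: A_def)
  have sA: "star A = - A"
  proof -
    have "star A = mat_adjoint (- T)" using T by (simp add: A_def flip: adjoint_star)
    also have "\<dots> = - A"
      using T carrier_matD[OF A] carrier_matD[OF adjoint_closed[of "- T"]]
      by (intro eq_matI) (auto simp: A_def adjoint_index[of _ N])
    finally show ?thesis .
  qed
  have A_index: "A $$ (c, d) = cnj (T $$ (d, c))" if "c < N" "d < N" for c d
    using T that by (simp add: A_def adjoint_index[of _ N])
  define H1 where "H1 = T - A"
  define H2 where "H2 = \<i> \<cdot>\<^sub>m (T + A)"
  have C: "H1 \<in> MN" "H2 \<in> MN" using T A by (auto simp: H1_def H2_def)
  have adj: "mat_adjoint H1 = - H1" "mat_adjoint H2 = - H2"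
    using T(1) A C carrier_matD[OF adjoint_closed[OF C(1)]] carrier_matD[OF adjoint_closed[OF C(2)]]
      carrier_matD[OF C(1)] carrier_matD[OF C(2)]
    by (auto intro!: eq_matI simp: adjoint_index[OF C(1)] adjoint_index[OF C(2)])
      (auto simp: H1_def H2_def A_index algebra_simps)
  have "H1 = T + - A" unfolding H1_def using T A by (intro eq_matI) auto
  then have st: "star H1 = - H1" "star H2 = - H2"
    using T A sA by (auto intro!: eq_matI simp: H1_def H2_def star_add star_uminus star_smult algebra_simps)
  let ?I = "\<lambda>c d. LINT \<omega>|M. deriv_coeff i w vs a b c d \<omega>"
  have T_eq: "T $$ (c, d) = (H1 $$ (c, d) - \<i> * H2 $$ (c, d)) / 2" if "c < N" "d < N" for c d
    using T A that by (simp add: H1_def H2_def algebra_simps)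
  have half: "(x - \<i> * y) / 2 * z = (1/2) * (x * z) - (\<i>/2) * (y * z)" for x y z :: complex
    by (simp add: algebra_simps diff_divide_distrib)
  have "(\<Sum>c<N. \<Sum>d<N. T $$ (c, d) * ?I c d) =
      (\<Sum>c<N. \<Sum>d<N. (1/2) * (H1 $$ (c, d) * ?I c d) - (\<i>/2) * (H2 $$ (c, d) * ?I c d))"
    by (intro sum.cong refl) (simp only: T_eq half lessThan_iff)
  also have "\<dots> = (1/2) * (\<Sum>c<N. \<Sum>d<N. H1 $$ (c, d) * ?I c d) - (\<i>/2) * (\<Sum>c<N. \<Sum>d<N. H2 $$ (c, d) * ?I c d)"
    by (simp only: sum_subtractf sum_distrib_left)
  also have "\<dots> = 0"
    using integral_deriv_coeff_skew[OF i C(1) adj(1) st(1) ab]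
      integral_deriv_coeff_skew[OF i C(2) adj(2) st(2) ab] by simp
  finally show ?thesis .
qed

text \<open>The vanishing integrals are summed over a and b, with the direction
  \<open>lie_unit a b\<close> paired with the (a, b) entry of \<open>w\<close>; only this diagonal
  pairing closes up to traces of words.\<close>

theorem loop_equation:
  assumes i: "i < r"
  shows "(\<Sum>(P, Q, s)\<leftarrow>cuts i w. s * (moment (P # Q # vs) - eps * moment ((P @ word_inv Q) # vs))) +
    (\<Sum>(P, Q, s, us)\<leftarrow>family_cuts i vs. s * (moment ((P @ w @ Q) # us) -
      moment ((P @ word_inv w @ Q) # us))) = 0"
proof -
  let ?f = "\<lambda>\<omega>. family_val (gens \<omega>)"
  have int: "integrable M (\<lambda>\<omega>. ?f \<omega> ws)" for ws
    by (intro bounded_measurable_integrable bounded_measurable_family)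
  have bm1: "bounded_measurable (\<lambda>\<omega>. s * (?f \<omega> us - eps * ?f \<omega> ws))" for s us ws
    using bounded_measurable_mult[OF bounded_measurable_const[of s]
        bounded_measurable_add[OF bounded_measurable_family[of us]
          bounded_measurable_mult[OF bounded_measurable_const[of "- eps"] bounded_measurable_family[of ws]]]]
    by simp
  have bm2: "bounded_measurable (\<lambda>\<omega>. s * (?f \<omega> us - ?f \<omega> ws))" for s us ws
    using bounded_measurable_mult[OF bounded_measurable_const[of s]
        bounded_measurable_add[OF bounded_measurable_family[of us]
          bounded_measurable_mult[OF bounded_measurable_const[of "- 1"] bounded_measurable_family[of ws]]]]
    by simp
  let ?S = "\<lambda>a b \<omega>. \<Sum>c<N. \<Sum>d<N. lie_unit a b $$ (c, d) * deriv_coeff i w vs a b c d \<omega>"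
  let ?D1 = "\<lambda>\<omega>. (\<Sum>(P, Q, s)\<leftarrow>cuts i w. s * (?f \<omega> (P # Q # vs) - eps * ?f \<omega> ((P @ word_inv Q) # vs)))"
  let ?D2 = "\<lambda>\<omega>. (\<Sum>(P, Q, s, us)\<leftarrow>family_cuts i vs. s * (?f \<omega> ((P @ w @ Q) # us) - ?f \<omega> ((P @ word_inv w @ Q) # us)))"
  have bmD: "bounded_measurable ?D1" "bounded_measurable ?D2"
    unfolding split_def by (intro bounded_measurable_sum_list bm1 bm2)+
  have "0 = (\<Sum>a<N. \<Sum>b<N. \<Sum>c<N. \<Sum>d<N. lie_unit a b $$ (c, d) * (LINT \<omega>|M. deriv_coeff i w vs a b c d \<omega>))"
    using integral_deriv_coeff[OF i lie_unit_carrier star_lie_unit] by simp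
  also have "\<dots> = (LINT \<omega>|M. (\<Sum>a<N. \<Sum>b<N. ?S a b \<omega>))"
  proof -
    have "(LINT \<omega>|M. (\<Sum>a<N. \<Sum>b<N. ?S a b \<omega>)) =
        (\<Sum>a<N. (LINT \<omega>|M. (\<Sum>b<N. ?S a b \<omega>)))"
      by (intro integral_sum_bounded_measurable, rule bounded_measurable_sum,
          rule bounded_measurable_deriv_coeffs) auto
    also have "\<dots> = (\<Sum>a<N. \<Sum>b<N. (LINT \<omega>|M. (?S a b \<omega>)))"
      by (intro sum.cong refl integral_sum_bounded_measurable bounded_measurable_deriv_coeffs) auto
    finally show ?thesis by (simp add: integral_deriv_coeffs)
  qed
  also have "\<dots> = (LINT \<omega>|M. ?D1 \<omega> + ?D2 \<omega>)"
  proof (rule Bochner_Integration.integral_cong[OF refl])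
    fix \<omega> assume \<omega>: "\<omega> \<in> space M"
    have "(\<Sum>a<N. \<Sum>b<N. ?S a b \<omega>) =
      (\<Sum>a<N. \<Sum>b<N. word_deriv i (lie_unit a b) (gens \<omega>) w a b * ?f \<omega> vs +
        V \<omega> w $$ (a, b) * family_deriv i (lie_unit a b) (gens \<omega>) vs)"
      by (intro sum.cong refl deriv_eq_coeffs[symmetric] \<omega> lie_unit_carrier) auto
    then show "(\<Sum>a<N. \<Sum>b<N. ?S a b \<omega>) =
        ?D1 \<omega> + ?D2 \<omega>"
      by (simp only: sum_lie_unit_derivs[OF X[OF \<omega>]])
  qed
  also have "\<dots> = (LINT \<omega>|M. ?D1 \<omega>) + (LINT \<omega>|M. ?D2 \<omega>)"
    by (intro Bochner_Integration.integral_add bounded_measurable_integrable bmD)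
  also have "(LINT \<omega>|M. ?D1 \<omega>) = (\<Sum>(P, Q, s)\<leftarrow>cuts i w. s * (moment (P # Q # vs) - eps * moment ((P @ word_inv Q) # vs)))"
    unfolding split_def by (subst integral_sum_list) (auto simp: int moment_def intro: bm1)
  also have "(LINT \<omega>|M. ?D2 \<omega>) = (\<Sum>(P, Q, s, us)\<leftarrow>family_cuts i vs. s * (moment ((P @ w @ Q) # us) - moment ((P @ word_inv w @ Q) # us)))"
    unfolding split_def by (subst integral_sum_list) (auto simp: int moment_def intro: bm2)
  finally show ?thesis by simp
qed

end

section \<open>Consequences of the loop equation\<close>

text \<open>The families of words on the right hand side of the loop equation for \<open>(x u, vs)\<close>, where
  \<open>x\<close> is the \<open>i\<close>-th generator. If the cut is behind an inverse of \<open>x\<close>, then the part before it is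
  conjugated by \<open>x\<close>, which makes it shorter.\<close>

definition loop_terms :: "nat \<Rightarrow> letter list \<Rightarrow> letter list list \<Rightarrow> letter list list list" where
  "loop_terms i u vs =
     map (\<lambda>(P, Q, s). (if s = 1 then (i, True) # P else butlast P) # Q # vs) (cuts i u) @
     map (\<lambda>(P, Q, s). ((i, True) # P @ word_inv Q) # vs) (cuts i u) @
     map (\<lambda>(P, Q, s, us). (P @ ((i, True) # u) @ Q) # us) (family_cuts i vs) @
     map (\<lambda>(P, Q, s, us). (P @ word_inv ((i, True) # u) @ Q) # us) (family_cuts i vs)"

lemma word_energy_simps [simp]:
  "word_energy [] = 0" "word_energy (w # ws) = length w ^ 2 + word_energy ws"
  by (simp_all add: word_energy_def)

lemma word_energy_perm: "mset us = mset vs \<Longrightarrow> word_energy us = word_energy vs"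
  by (simp add: word_energy_def flip: sum_mset_sum_list)

lemma loop_terms_split:
  assumes "(P, Q, s, us) \<in> set (family_cuts i vs)" and x: "x = w \<or> x = word_inv w"
    and "\<forall>v\<in>set (w # vs). word_in r v"
  shows "(\<forall>v\<in>set ((P @ x @ Q) # us). word_in r v) \<and>
    (\<forall>e. word_bounds r ((P @ x @ Q) # us) e \<longrightarrow> word_bounds r (w # vs) (e - 1)) \<and>
    length ((P @ x @ Q) # us) \<le> length (w # vs)"
proof -
  have ms: "mset ((P @ Q) # us) = mset vs" using family_cutsD[OF assms(1)] by simp
  then have st: "insert (P @ Q) (set us) = set vs" by (metis list.simps(15) set_mset_mset)
  have wi: "word_in r P" "word_in r Q" "word_in r w" "\<forall>v\<in>set us. word_in r v"
    using assms(3) st[symmetric] by auto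
  have "word_bounds r (w # vs) (e - 1)" if "word_bounds r ((P @ x @ Q) # us) e" for e
    using word_bounds_split[OF that x wi(1,2,3)] word_bounds_perm[of "w # (P @ Q) # us" "w # vs" r] ms
    by simp
  moreover have "length ((P @ x @ Q) # us) \<le> length (w # vs)"
    using mset_eq_length[OF ms] by simp
  ultimately show ?thesis using wi x by auto
qed

text \<open>One strip leads back from each term: a split is undone by a join, a twist by a crosscap,
  a merger by splitting \<open>w\<close> off. Only splits lengthen the family. Their energy drops
  because both parts are nonempty and \<open>a^2 + b^2 < (a + b)^2\<close>, or because two letters
  have cancelled behind an inverse of the generator.\<close>

lemma loop_terms_props:
  assumes i: "i < r" and valid: "\<forall>v\<in>set (((i, True) # u) # vs). word_in r v"
    and ws: "ws \<in> set (loop_terms i u vs)"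
  shows "(\<forall>v\<in>set ws. word_in r v) \<and>
    (\<forall>e. word_bounds r ws e \<longrightarrow> word_bounds r (((i, True) # u) # vs) (e - 1)) \<and>
    (length ws \<le> length (((i, True) # u) # vs) \<or>
      length ws = Suc (length (((i, True) # u) # vs)) \<and>
      word_energy ws < word_energy (((i, True) # u) # vs))"
proof -
  let ?x = "(i, True)"
  have split_rule: "(a ^ 2 + b ^ 2 :: nat) < (a + b) ^ 2" if "a > 0" "b > 0" for a b
    using that by (simp add: power2_sum)
  have "(\<exists>P Q s. (P, Q, s) \<in> set (cuts i u) \<and> ws = (if s = 1 then ?x # P else butlast P) # Q # vs) \<or>
      (\<exists>P Q s. (P, Q, s) \<in> set (cuts i u) \<and> ws = (?x # P @ word_inv Q) # vs) \<or>
      (\<exists>P Q s us x. (P, Q, s, us) \<in> set (family_cuts i vs) \<and> ws = (P @ x @ Q) # us \<and>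
        (x = ?x # u \<or> x = word_inv (?x # u)))"
    using ws unfolding loop_terms_def set_append set_map Un_iff image_iff Bex_def case_prod_unfold
    by (elim disjE exE conjE) (metis prod.collapse)+
  then consider P Q s where "(P, Q, s) \<in> set (cuts i u)" "ws = (if s = 1 then ?x # P else butlast P) # Q # vs"
    | P Q s where "(P, Q, s) \<in> set (cuts i u)" "ws = (?x # P @ word_inv Q) # vs"
    | P Q s us x where "(P, Q, s, us) \<in> set (family_cuts i vs)" "ws = (P @ x @ Q) # us"
        "x = ?x # u \<or> x = word_inv (?x # u)"
    by blast
  then show ?thesis
  proof cases
    case 1
    have PQ: "P @ Q = u" "s = 1 \<and> Q \<noteq> [] \<or> s = - 1 \<and> P \<noteq> [] \<and> last P = (i, False)"
      using cutsD[OF 1(1)] by auto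
    show ?thesis
    proof (cases "s = 1")
      case True
      have wi: "word_in r (?x # P)" "word_in r Q" "\<forall>v\<in>set vs. word_in r v" using PQ(1) valid by auto
      have ws: "ws = (?x # P) # Q # vs" using 1(2) True by simp
      have u: "?x # u = (?x # P) @ Q" using PQ(1) by simp
      have "word_bounds r ((?x # u) # vs) (e - 1)" if "word_bounds r ws e" for e
        unfolding u using word_bounds_join[OF _ wi(1,2)] that unfolding ws by blast
      moreover have "word_energy ws < word_energy ((?x # u) # vs)"
        using split_rule[of "length (?x # P)" "length Q"] PQ(2) True unfolding ws u
        by (simp del: length_Cons)
      ultimately show ?thesis using wi by (simp add: ws)
    next
      case False
      define p where "p = butlast P"
      have p: "P = p @ [(i, False)]"
        using PQ(2) False append_butlast_last_id[of P] by (auto simp: p_def)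
      have ws: "ws = p # Q # vs" using 1(2) False by (simp add: p_def)
      \<comment> \<open>The two cancelled letters return as a conjugation, which does not affect the
        surface.\<close>
      have u: "?x # u = ([?x] @ p @ word_inv [?x]) @ Q" using PQ(1) p by (simp add: inv_letter_def)
      have wi: "word_in r p" "word_in r Q" "word_in r [?x]" "\<forall>v\<in>set vs. word_in r v"
        using valid i PQ(1)[symmetric] p by auto
      have wi': "word_in r ([?x] @ p @ word_inv [?x])" using wi by simp
      have "word_bounds r ((?x # u) # vs) (e - 1)" if "word_bounds r ws e" for e
        unfolding u
        by (rule word_bounds_join[OF word_bounds_conj[OF that[unfolded ws] wi(1,3)] wi' wi(2)])
      moreover have "word_energy ws < word_energy ((?x # u) # vs)"
      proof -
        have "(length p)\<^sup>2 + (length Q)\<^sup>2 \<le> (length p + length Q)\<^sup>2" by (simp add: power2_sum)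
        also have "\<dots> < (length (?x # u))\<^sup>2" unfolding u by (intro power_strict_mono) auto
        finally show ?thesis by (simp add: ws)
      qed
      ultimately show ?thesis using wi by (simp add: ws)
    qed
  next
    case 2
    have u: "?x # u = (?x # P) @ Q" using cutsD[OF 2(1)] by simp
    have wi: "word_in r (?x # P)" "word_in r Q" "\<forall>v\<in>set vs. word_in r v" using cutsD[OF 2(1)] valid by auto
    have "word_bounds r ((?x # u) # vs) (e - 1)" if "word_bounds r ws e" for e
      unfolding u using that unfolding 2(2) by (intro word_bounds_crosscap wi) simp
    then show ?thesis using wi by (simp add: 2(2))
  next
    case 3
    show ?thesis
      unfolding 3(2) using loop_terms_split[OF 3(1,3) valid] by blast
  qed
qed

context haar_matrices
begin

lemma moment_Nil: "moment ([] # ws) = of_nat N * moment ws"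
proof -
  have "trace_mat (1\<^sub>m N :: complex mat) = of_nat N" by (simp add: trace_mat_def)
  then show ?thesis by (simp add: moment_def family_val_def)
qed

lemma norm_sum_list_le: "cmod (\<Sum>x\<leftarrow>L. f x) \<le> (\<Sum>x\<leftarrow>L. g x)" if "\<And>x. x \<in> set L \<Longrightarrow> cmod (f x) \<le> g x"
  using that by (induction L) (auto intro: norm_triangle_mono)

text \<open>The leading generator is itself a cut, with an empty word before it. Its two terms are
  \<open>N\<close> and \<open>- eps\<close> times the moment on the left, the second because
  inversion preserves the trace; the other cuts are estimated by the triangle inequality.\<close>

lemma moment_loop_bound:
  assumes i: "i < r"
  shows "cmod (of_nat N - eps) * cmod (moment (((i, True) # u) # vs)) \<le>
    (\<Sum>ws\<leftarrow>loop_terms i u vs. cmod (moment ws))"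
proof -
  let ?x = "(i, True)"
  let ?w = "?x # u"
  let ?m1 = "\<lambda>P Q. moment ((?x # P) # Q # vs)"
  let ?m2 = "\<lambda>P Q. moment ((?x # P @ word_inv Q) # vs)"
  let ?m3 = "\<lambda>P Q us. moment ((P @ ?w @ Q) # us)"
  let ?m4 = "\<lambda>P Q us. moment ((P @ word_inv ?w @ Q) # us)"
  let ?m5 = "\<lambda>P Q s. moment ((if s = 1 then ?x # P else butlast P) # Q # vs)"
  have eps1: "cmod eps = 1" using eps_cases by auto
  have conj: "?m1 P Q = ?m5 P Q s"
    if "(P, Q, s) \<in> set (cuts i u)" for P Q s
  proof (cases "s = 1")
    case False
    then have "P \<noteq> []" "last P = (i, False)" using cutsD[OF that] by auto
    then have "?x # P = [?x] @ butlast P @ word_inv [?x]"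
      by (cases P rule: rev_cases) (auto simp: inv_letter_def)
    then show ?thesis
      using False trace_word_val_conj[of _ "[?x]" "butlast P"]
      by (auto intro!: moment_trace_cong simp del: word_val.simps)
  qed simp
  define S1 where "S1 = (\<Sum>(P, Q, s)\<leftarrow>cuts i u. s * (?m1 P Q - eps * ?m2 P Q))"
  define S2 where "S2 = (\<Sum>(P, Q, s, us)\<leftarrow>family_cuts i vs. s * (?m3 P Q us - ?m4 P Q us))"
  have "moment (word_inv ?w # vs) = moment (?w # vs)"
    using trace_word_val_inv by (intro moment_trace_cong) blast
  then have "(of_nat N - eps) * moment (?w # vs) + S1 + S2 = 0"
    using loop_equation[OF i, where w = ?w and vs = vs]
    by (simp add: moment_Nil S1_def S2_def split_def comp_def left_diff_distrib)
  then have "(of_nat N - eps) * moment (?w # vs) = - (S1 + S2)"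
    by (simp only: eq_neg_iff_add_eq_0 add.assoc)
  then have "cmod (of_nat N - eps) * cmod (moment (?w # vs)) = cmod (S1 + S2)"
    by (metis norm_minus_cancel norm_mult)
  also have "\<dots> \<le> cmod S1 + cmod S2" by (rule norm_triangle_ineq)
  also have "cmod S1 \<le> (\<Sum>(P, Q, s)\<leftarrow>cuts i u.
      cmod (?m5 P Q s) + cmod (?m2 P Q))"
    unfolding S1_def
  proof (rule norm_sum_list_le, clarify)
    fix P Q s assume *: "(P, Q, s) \<in> set (cuts i u)"
    then have "cmod s = 1" using cutsD by fastforce
    then have "cmod (s * (?m1 P Q - eps * ?m2 P Q)) \<le>
        cmod (?m1 P Q) + cmod (eps * ?m2 P Q)"
      unfolding norm_mult[of s] by (simp add: norm_triangle_ineq4)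
    then show "cmod (s * (?m1 P Q - eps * ?m2 P Q)) \<le>
        cmod (?m5 P Q s) + cmod (?m2 P Q)"
      unfolding conj[OF *] norm_mult[of eps] eps1 by simp
  qed
  also have "cmod S2 \<le> (\<Sum>(P, Q, s, us)\<leftarrow>family_cuts i vs.
      cmod (?m3 P Q us) + cmod (?m4 P Q us))"
    unfolding S2_def
  proof (rule norm_sum_list_le, clarify)
    fix P Q s us assume "(P, Q, s, us) \<in> set (family_cuts i vs)"
    then have "cmod s = 1" using family_cutsD by fastforce
    then show "cmod (s * (?m3 P Q us - ?m4 P Q us)) \<le>
        cmod (?m3 P Q us) + cmod (?m4 P Q us)"
      unfolding norm_mult[of s] by (simp add: norm_triangle_ineq4)
  qed
  finally show ?thesis
    by (simp add: loop_terms_def comp_def split_def sum_list_addf add.assoc)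
qed

lemma moment_odd:
  assumes i: "i < r" and odd: "odd (length (filter (\<lambda>l. fst l = i) w))"
  shows "moment [w] = 0"
proof -
  define m where "m = (- 1\<^sub>m N :: complex mat)"
  have m: "m \<in> MN" by (simp add: m_def)
  have am: "mat_adjoint m = m"
  proof (rule eq_matI)
    fix i j assume "i < dim_row m" "j < dim_col m"
    then have ij: "i < N" "j < N" using m by auto
    show "mat_adjoint m $$ (i, j) = m $$ (i, j)"
      unfolding adjoint_index[OF m ij] using ij by (simp add: m_def)
  qed (use m carrier_matD[OF adjoint_closed[OF m]] in auto)
  have "m * m = 1\<^sub>m N" by (simp add: m_def)
  moreover have "star m = m" by (simp add: m_def star_uminus star_one)
  ultimately have mg: "m \<in> form_group" using m am by (simp add: form_group_def)
  \<comment> \<open>Inverse letters change their sign as well, since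
    \<open>star (- g) = - star g\<close>.\<close>
  have sign: "word_val (g(i := m * g i)) v = (-1) ^ length (filter (\<lambda>l. fst l = i) v) \<cdot>\<^sub>m word_val g v"
    if g: "\<And>j. g j \<in> form_group" for g v
  proof (induction v)
    case Nil
    show ?case by (auto intro!: eq_matI)
  next
    case (Cons l v)
    have mgi: "m * g i = - g i"
      using form_groupD(1)[OF g[of i]] by (simp add: m_def)
    have neg: "- A = (- 1) \<cdot>\<^sub>m A" for A :: "complex mat" by (intro eq_matI) auto
    have l: "letter_val (g(i := m * g i)) l = (if fst l = i then - 1 else 1) \<cdot>\<^sub>m letter_val g l"
    proof (cases "fst l = i")
      case True
      then show ?thesis
        unfolding mgi using form_groupD(1)[OF g[of i]] by (simp add: letter_val_def star_uminus flip: neg)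
    next
      case False
      then show ?thesis by (simp add: letter_val_def) (auto intro!: eq_matI)
    qed
    note [simp] = letter_val_carrier[of g, OF g] word_val_carrier[of g, OF g]
    have smult_mult: "(a \<cdot>\<^sub>m A) * (b \<cdot>\<^sub>m B) = (a * b) \<cdot>\<^sub>m (A * B)"
      if "A \<in> MN" "B \<in> MN" for a b and A B :: "complex mat"
      using that by (simp add: mult_smult_assoc_mat[of _ N N _ N] mult_smult_distrib[of _ N N _ N] smult_smult_assoc)
        (intro eq_matI, auto)
    define n where "n = length (filter (\<lambda>l. fst l = i) v)"
    have "word_val (g(i := m * g i)) (l # v) =
        ((if fst l = i then - 1 else 1) \<cdot>\<^sub>m letter_val g l) * ((-1) ^ n \<cdot>\<^sub>m word_val g v)"
      unfolding word_val.simps Cons l n_def ..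
    also have "\<dots> = ((if fst l = i then - 1 else 1) * (-1) ^ n) \<cdot>\<^sub>m (letter_val g l * word_val g v)"
      by (rule smult_mult) simp_all
    also have "(if fst l = i then - 1 else 1) * (-1) ^ n = ((-1) ^ length (filter (\<lambda>l. fst l = i) (l # v)) :: complex)"
      by (simp add: n_def)
    finally show ?case unfolding word_val.simps .
  qed
  have m0: "(\<lambda>\<omega>. family_val (gens \<omega>) [w]) \<in> borel_measurable M"
    using bounded_measurable_family[of "[w]"] by (simp add: bounded_measurable_def)
  have "moment [w] = (LINT \<omega>|M. family_val ((gens \<omega>)(i := m * X i \<omega>)) [w])"
    using invariant_integral(2)[OF i mg m0, of "\<lambda>g. family_val g [w]", OF refl]
    by (simp add: moment_def)
  also have "\<dots> = (LINT \<omega>|M. - family_val (gens \<omega>) [w])"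
  proof (rule Bochner_Integration.integral_cong[OF refl])
    fix \<omega> assume \<omega>: "\<omega> \<in> space M"
    show "family_val ((gens \<omega>)(i := m * X i \<omega>)) [w] = - family_val (gens \<omega>) [w]"
    proof -
      have "word_val ((gens \<omega>)(i := m * X i \<omega>)) w =
          (-1) ^ length (filter (\<lambda>l. fst l = i) w) \<cdot>\<^sub>m V \<omega> w"
        by (rule sign) (rule X[OF \<omega>])
      then show ?thesis using odd \<omega> by (simp add: family_val_def trace_mat_smult[of _ N])
    qed
  qed
  also have "\<dots> = - moment [w]" by (simp add: moment_def)
  finally show ?thesis by simp
qed

end

text \<open>Inversion and rotation preserve both traces and surfaces, so a nonempty word can be made
  to begin with a generator. The equality of moments is quantified over all matrix models, because
  one normal form must serve for every \<open>n\<close>.\<close>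

lemma normalize_family:
  assumes valid: "\<forall>v\<in>set ws. word_in r v" and w: "w \<in> set ws" "w \<noteq> []"
  obtains i u vs where "i < r" "\<forall>v\<in>set (((i, True) # u) # vs). word_in r v"
    "\<And>N K eps (M :: 'w measure) X. haar_matrices N K eps M r X \<Longrightarrow>
      haar_matrices.moment N K M X ws = haar_matrices.moment N K M X (((i, True) # u) # vs)"
    "\<And>e. word_bounds r (((i, True) # u) # vs) e \<Longrightarrow> word_bounds r ws e"
    "length (((i, True) # u) # vs) = length ws" "word_energy (((i, True) # u) # vs) = word_energy ws"
proof -
  define vs where "vs = remove1 w ws"
  have ms: "mset (w # vs) = mset ws" using w by (simp add: vs_def)
  have valid': "\<forall>v\<in>set (w # vs). word_in r v" using valid mset_eq_setD[OF ms] by simp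
  obtain i b v where v: "w = (i, b) # v" using w(2) by (cases w) auto
  have i: "i < r" using valid' v by auto
  define u where "u = (if b then v else word_inv v)"
  have valid'': "\<forall>v\<in>set (((i, True) # u) # vs). word_in r v" using valid' v by (auto simp: u_def)
  have mom: "haar_matrices.moment N K M X ws = haar_matrices.moment N K M X (((i, True) # u) # vs)"
    if "haar_matrices N K eps M r X" for N K eps and M :: "'w measure" and X
  proof -
    interpret haar_matrices N K eps M r X by fact
    have "trace_mat (word_val g w) = trace_mat (word_val g ((i, True) # u))"
      if g: "\<And>i. g i \<in> form_group" for g
    proof (cases b)
      case False
      have "trace_mat (word_val g w) = trace_mat (word_val g (word_inv v @ [(i, True)]))"
        using trace_word_val_inv[of g w, OF g] False v by (simp add: inv_letter_def)
      then show ?thesis using trace_word_val_rotate[of g "word_inv v" "[(i, True)]", OF g] False by (simp add: u_def)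
    qed (use v in \<open>simp add: u_def\<close>)
    then have "moment (w # vs) = moment (((i, True) # u) # vs)" by (rule moment_trace_cong)
    then show ?thesis using moment_perm[OF ms] by simp
  qed
  have wb: "word_bounds r ws e" if "word_bounds r (((i, True) # u) # vs) e" for e
  proof -
    have "word_bounds r (w # vs) e"
    proof (cases b)
      case False
      have "word_bounds r ((word_inv v @ [(i, True)]) # vs) e"
        using word_bounds_rotate[of r "[(i, True)]" "word_inv v" vs e] that False valid' v i by (simp add: u_def)
      then show ?thesis
        using word_bounds_inv[of r w vs e] valid' False v by (simp add: inv_letter_def)
    qed (use that v in \<open>simp add: u_def\<close>)
    then show ?thesis using word_bounds_perm[OF ms] by blast
  qed
  have len: "length (((i, True) # u) # vs) = length ws" using mset_eq_length[OF ms] by simp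
  have en: "word_energy (((i, True) # u) # vs) = word_energy ws"
    using word_energy_perm[OF ms] v by (simp add: u_def)
  show thesis by (rule that[OF i valid'' mom wb len en])
qed

text \<open>The upper bound on \<open>N n\<close> puts the trivial estimate into the shape required
  by the induction; the lower bound on \<open>N - eps\<close> allows division by it. The latter
  fails for orthogonal matrices of size 1, whence the range \<open>n \<ge> 2\<close>.\<close>

theorem haar_matrices_asymptotics:
  fixes M :: "nat \<Rightarrow> 'w measure"
  assumes haar: "\<And>n. n \<ge> 2 \<Longrightarrow> haar_matrices (N n) (K n) eps (M n) r (X n)"
    and N: "\<And>n. n \<ge> 2 \<Longrightarrow> N n \<le> 2 * n" "\<And>n. n \<ge> 2 \<Longrightarrow> real n / 2 \<le> cmod (of_nat (N n) - eps)"
    and w: "w \<in> carrier (free_group r)" "sql r w \<noteq> \<infinity>"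
  shows "\<exists>C. \<forall>n\<ge>2. cmod (haar_matrices.moment (N n) (K n) (M n) (X n) [w]) \<le>
    C * real n powi (1 - int (the_enat (min (sql r w) (2 * cl r w))))"
proof (rule asymptotics_of_loop_equation[where B = "word_bounds r" and valid = "\<lambda>ws. \<forall>v\<in>set ws. word_in r v"])
  fix n :: nat and ws :: "letter list list" assume n: "n \<ge> 2"
  interpret haar_matrices "N n" "K n" eps "M n" r "X n" by (rule haar[OF n])
  have "cmod (moment ws) \<le> real (N n) ^ length ws" by (rule moment_le)
  also have "\<dots> \<le> (2 * real n) ^ length ws" using N(1)[OF n] by (intro power_mono) linarith+
  finally show "cmod (moment ws) \<le> (2 * real n) ^ length ws" .
next
  fix ws :: "letter list list" and v
  assume valid: "\<forall>v\<in>set ws. word_in r v" "v \<in> set ws" "v \<noteq> []"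
  obtain i u vs where nf: "i < r" "\<forall>v\<in>set (((i, True) # u) # vs). word_in r v"
    "\<And>N K eps (M :: 'w measure) X. haar_matrices N K eps M r X \<Longrightarrow>
      haar_matrices.moment N K M X ws = haar_matrices.moment N K M X (((i, True) # u) # vs)"
    "\<And>e. word_bounds r (((i, True) # u) # vs) e \<Longrightarrow> word_bounds r ws e"
    "length (((i, True) # u) # vs) = length ws" "word_energy (((i, True) # u) # vs) = word_energy ws"
    by (rule normalize_family[where 'w = 'w, OF valid]) (rule that)
  let ?m = "\<lambda>n. haar_matrices.moment (N n) (K n) (M n) (X n)"
  have "real n / 2 * cmod (?m n ws) \<le> (\<Sum>ws'\<leftarrow>loop_terms i u vs. cmod (?m n ws'))" if n: "n \<ge> 2" for n
  proof -
    interpret haar_matrices "N n" "K n" eps "M n" r "X n" by (rule haar[OF n])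
    have "real n / 2 * cmod (moment ws) \<le> cmod (of_nat (N n) - eps) * cmod (moment (((i, True) # u) # vs))"
      unfolding nf(3)[OF haar[OF n]] using N(2)[OF n] by (intro mult_right_mono) auto
    also have "\<dots> \<le> (\<Sum>ws'\<leftarrow>loop_terms i u vs. cmod (moment ws'))"
      by (rule moment_loop_bound[OF nf(1)])
    finally show ?thesis .
  qed
  moreover have "(\<forall>v\<in>set ws'. word_in r v) \<and> (\<forall>e. word_bounds r ws' e \<longrightarrow> word_bounds r ws (e - 1)) \<and>
      (length ws' \<le> length ws \<or> length ws' = Suc (length ws) \<and> word_energy ws' < word_energy ws)"
    if "ws' \<in> set (loop_terms i u vs)" for ws'
    using loop_terms_props[OF nf(1,2) that] nf(4-6) by metis
  ultimately show "\<exists>A. (\<forall>n\<ge>2. real n / 2 * cmod (?m n ws) \<le> (\<Sum>ws'\<leftarrow>A. cmod (?m n ws'))) \<and>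
      (\<forall>ws'\<in>set A. (\<forall>v\<in>set ws'. word_in r v) \<and> (\<forall>e. word_bounds r ws' e \<longrightarrow> word_bounds r ws (e - 1)) \<and>
        (length ws' \<le> length ws \<or> length ws' = Suc (length ws) \<and> word_energy ws' < word_energy ws))"
    by blast
next
  show "\<forall>v\<in>set [w]. word_in r v" using w(1) by (simp add: free_group_def word_in_def)
qed (use w in \<open>auto intro: word_bounds_Nils word_bounds_le\<close>)

section \<open>Haar measures on matrix groups\<close>

abbreviation haar_product :: "nat \<Rightarrow> 'a measure \<Rightarrow> (nat \<Rightarrow> 'a) measure" where
  "haar_product r \<mu> \<equiv> Pi\<^sub>M {..<r} (\<lambda>_. \<mu>)"

context
  fixes G :: "'a::{real_normed_field, second_countable_topology} mat monoid" and N :: nat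
    and \<mu> :: "'a mat measure"
  assumes haar: "haar_prob N G \<mu>" and G: "group G" "carrier G \<subseteq> carrier_mat N N"
    "monoid.mult G = (*)" "monoid.one G = 1\<^sub>m N"
begin

lemma space_haar: "space \<mu> = carrier G"
proof -
  have "space \<mu> = space (restrict_space (borel_mat N) (carrier G))"
    using haar by (intro sets_eq_imp_space_eq) (simp add: haar_prob_def)
  then show ?thesis using G(2) by (auto simp: space_restrict_space borel_mat_def)
qed

lemma prob_space_haar: "prob_space \<mu>"
  using haar by (simp add: haar_prob_def)

section \<open>Measurability in terms of entries, and invariance of products of Haar
  measures\<close>

lemma measurable_haarI:
  assumes "f \<in> space M \<rightarrow> carrier G"
    and "\<And>a b. a < N \<Longrightarrow> b < N \<Longrightarrow> (\<lambda>x. f x $$ (a, b)) \<in> borel_measurable M"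
  shows "f \<in> measurable M \<mu>"
proof -
  have "f \<in> measurable M (restrict_space (borel_mat N) (carrier G))"
  proof (intro measurable_restrict_space2)
    show "f \<in> measurable M (borel_mat N)"
      unfolding borel_mat_def
    proof (rule measurable_vimage_algebra2)
      show "(\<lambda>x. \<lambda>ij\<in>{..<N} \<times> {..<N}. f x $$ ij) \<in> measurable M (Pi\<^sub>M ({..<N} \<times> {..<N}) (\<lambda>_. borel))"
        using assms(2) by (intro measurable_restrict) auto
    qed (use assms(1) G(2) in auto)
  qed fact
  then show ?thesis
    using haar by (simp add: haar_prob_def cong: measurable_cong_sets)
qed

lemma measurable_haar_entry:
  assumes "a < N" "b < N"
  shows "(\<lambda>A. A $$ (a, b)) \<in> borel_measurable \<mu>"
proof -
  have "(\<lambda>A. \<lambda>ij\<in>{..<N} \<times> {..<N}. A $$ ij) \<in>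
      measurable (borel_mat N :: 'a mat measure) (Pi\<^sub>M ({..<N} \<times> {..<N}) (\<lambda>_. borel))"
    unfolding borel_mat_def by (rule measurable_vimage_algebra1) (auto simp: space_PiM)
  then have "(\<lambda>A. (\<lambda>ij\<in>{..<N} \<times> {..<N}. A $$ ij) (a, b)) \<in> borel_measurable (borel_mat N :: 'a mat measure)"
    by (rule measurable_compose[OF _ measurable_component_singleton]) (use assms in auto)
  then have "(\<lambda>A. A $$ (a, b)) \<in> borel_measurable (borel_mat N :: 'a mat measure)"
    using assms by simp
  then have "(\<lambda>A. A $$ (a, b)) \<in> borel_measurable (restrict_space (borel_mat N) (carrier G))"
    by (rule measurable_restrict_space1)
  then show ?thesis
    using haar by (simp add: haar_prob_def cong: measurable_cong_sets)
qed

lemma measurable_haar_mult: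
  assumes h: "h \<in> carrier G"
  shows "(\<lambda>g. h * g) \<in> measurable \<mu> \<mu>"
proof (rule measurable_haarI)
  interpret group G by (rule G(1))
  show "(\<lambda>g. h * g) \<in> space \<mu> \<rightarrow> carrier G"
    using m_closed[OF h] by (auto simp: space_haar G(3))
  fix a b assume ab: "a < N" "b < N"
  have "(\<lambda>g. \<Sum>k<N. h $$ (a, k) * g $$ (k, b)) \<in> borel_measurable \<mu>"
    using ab by (intro borel_measurable_sum borel_measurable_times measurable_haar_entry) auto
  moreover have "(h * g) $$ (a, b) = (\<Sum>k<N. h $$ (a, k) * g $$ (k, b))" if "g \<in> space \<mu>" for g
    by (rule mat_mult_index) (use h that ab G(2) in \<open>auto simp: space_haar\<close>)
  ultimately show "(\<lambda>g. (h * g) $$ (a, b)) \<in> borel_measurable \<mu>"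
    by (subst measurable_cong) auto
qed

lemma haar_left_invariant:
  assumes h: "h \<in> carrier G" and A: "A \<in> sets \<mu>"
  shows "emeasure \<mu> ((\<lambda>g. h * g) -` A \<inter> space \<mu>) = emeasure \<mu> A"
proof -
  have "distr \<mu> \<mu> (\<lambda>g. h * g) = \<mu>" using haar h by (simp add: haar_prob_def G(3))
  then show ?thesis using emeasure_distr[OF measurable_haar_mult[OF h] A] by simp
qed

text \<open>A product measure is determined by its values on boxes, and the preimage of a box is a
  box with only the \<open>i\<close>-th side translated. The restriction to \<open>{..<r}\<close>
  keeps \<open>\<tau> \<omega>\<close> extensional, as points of the product space are.\<close>

lemma product_haar_left_invariant:
  fixes r :: nat
  assumes i: "i < r" and h: "h \<in> carrier G"
  defines "\<tau> \<equiv> (\<lambda>\<omega>. \<lambda>j\<in>{..<r}. if j = i then h * \<omega> j else \<omega> j)"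
  shows "\<tau> \<in> measurable (haar_product r \<mu>) (haar_product r \<mu>)"
    "distr (haar_product r \<mu>) (haar_product r \<mu>) \<tau> = haar_product r \<mu>"
proof -
  interpret prob_space \<mu> by (rule prob_space_haar)
  interpret P: product_prob_space "\<lambda>_. \<mu>" "{..<r}"
    by (intro product_prob_spaceI) (rule prob_space_haar)
  let ?M = "haar_product r \<mu>"
  show \<tau>: "\<tau> \<in> measurable ?M ?M"
    unfolding \<tau>_def
  proof (rule measurable_restrict)
    fix j assume j: "j \<in> {..<r}"
    have "(\<lambda>\<omega>. \<omega> j) \<in> measurable ?M \<mu>" using j by (intro measurable_component_singleton)
    then show "(\<lambda>\<omega>. if j = i then h * \<omega> j else \<omega> j) \<in> measurable ?M \<mu>"
      using measurable_compose[OF _ measurable_haar_mult[OF h]] by (cases "j = i") auto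
  qed
  show "distr ?M ?M \<tau> = ?M"
  proof (rule P.PiM_eqI)
    fix A assume A: "\<And>j. j \<in> {..<r} \<Longrightarrow> A j \<in> sets \<mu>"
    define B where "B = (\<lambda>j. if j = i then (\<lambda>g. h * g) -` A j \<inter> space \<mu> else A j)"
    have B: "B j \<in> sets \<mu>" if "j < r" for j
      using A[of j] that measurable_sets[OF measurable_haar_mult[OF h]] by (auto simp: B_def)
    have box: "Pi\<^sub>E {..<r} A \<in> sets ?M" using A by (intro sets_PiM_I_finite) auto
    have "\<tau> -` Pi\<^sub>E {..<r} A \<inter> space ?M = Pi\<^sub>E {..<r} B"
    proof (intro equalityI subsetI)
      fix \<omega> assume "\<omega> \<in> \<tau> -` Pi\<^sub>E {..<r} A \<inter> space ?M"
      then have *: "\<tau> \<omega> \<in> Pi\<^sub>E {..<r} A" "\<omega> \<in> Pi\<^sub>E {..<r} (\<lambda>_. space \<mu>)" by (auto simp: space_PiM)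
      have "\<omega> j \<in> B j" if "j < r" for j
        using PiE_mem[OF *(1), of j] PiE_mem[OF *(2), of j] that by (auto simp: \<tau>_def B_def split: if_splits)
      then show "\<omega> \<in> Pi\<^sub>E {..<r} B" using *(2) by (auto simp: PiE_iff)
    next
      fix \<omega> assume \<omega>: "\<omega> \<in> Pi\<^sub>E {..<r} B"
      have "\<omega> j \<in> space \<mu>" if "j < r" for j
        using PiE_mem[OF \<omega>, of j] sets.sets_into_space[OF B[OF that]] that by auto
      moreover have "\<tau> \<omega> j \<in> A j" if "j < r" for j
        using PiE_mem[OF \<omega>, of j] that by (auto simp: \<tau>_def B_def split: if_splits)
      ultimately show "\<omega> \<in> \<tau> -` Pi\<^sub>E {..<r} A \<inter> space ?M"
        using \<omega> by (auto simp: space_PiM PiE_iff \<tau>_def)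
    qed
    then have "emeasure (distr ?M ?M \<tau>) (Pi\<^sub>E {..<r} A) = emeasure ?M (Pi\<^sub>E {..<r} B)"
      by (simp add: emeasure_distr[OF \<tau> box])
    also have "\<dots> = (\<Prod>j<r. emeasure \<mu> (B j))" using B by (intro P.emeasure_PiM) auto
    also have "\<dots> = (\<Prod>j<r. emeasure \<mu> (A j))"
      using haar_left_invariant[OF h] A by (intro prod.cong) (auto simp: B_def)
    finally show "emeasure (distr ?M ?M \<tau>) (Pi\<^sub>E {..<r} A) = (\<Prod>j<r. emeasure \<mu> (A j))" .
  qed auto
qed

lemma space_product_haarD: "\<omega> \<in> space (haar_product r \<mu>) \<Longrightarrow> i < r \<Longrightarrow> \<omega> i \<in> carrier G" for r :: nat
  using PiE_mem[of \<omega> "{..<r}" "\<lambda>_. space \<mu>" i] by (simp add: space_PiM space_haar)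

lemma word_eval_Cons:
  "word_eval G (l # w) \<omega> =
    (if snd l then \<omega> (fst l) else inv\<^bsub>G\<^esub> (\<omega> (fst l))) * word_eval G w \<omega>"
  by (simp add: word_eval_def G(3) split_def)

lemma word_eval_carrier:
  assumes "\<omega> \<in> space (haar_product r \<mu>)" "word_in r w"
  shows "word_eval G w \<omega> \<in> carrier G"
  using assms(2)
proof (induction w)
  case Nil
  interpret group G by (rule G(1))
  show ?case by (simp add: word_eval_def)
next
  case (Cons l w)
  interpret group G by (rule G(1))
  show ?case
    using Cons space_product_haarD[OF assms(1)] m_closed inv_closed by (simp add: word_eval_Cons G(3))
qed

text \<open>\<open>\<phi>\<close> stands for complexification in the orthogonal case and for the
  identity in the symplectic case. It must be onto the form group, because invariance is required
  under each of its elements.\<close>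

context
  fixes K :: "complex mat" and eps :: complex and \<phi> :: "'a mat \<Rightarrow> complex mat"
  assumes form: "matrix_form N K eps"
    and \<phi>_image: "\<phi> ` carrier G = matrix_form.form_group N K"
    and \<phi>_mult: "\<And>A B. A \<in> carrier G \<Longrightarrow> B \<in> carrier G \<Longrightarrow> \<phi> (A * B) = \<phi> A * \<phi> B"
    and \<phi>_one: "\<phi> (1\<^sub>m N) = 1\<^sub>m N"
    and \<phi>_measurable: "\<And>a b. a < N \<Longrightarrow> b < N \<Longrightarrow> (\<lambda>A. \<phi> A $$ (a, b)) \<in> borel_measurable \<mu>"
begin

lemma haar_matrices_of_haar_prob:
  "haar_matrices N K eps (haar_product r \<mu>) r (\<lambda>i \<omega>. if i < r then \<phi> (\<omega> i) else 1\<^sub>m N)"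
proof -
  interpret matrix_form N K eps by (rule form)
  interpret P: product_prob_space "\<lambda>_. \<mu>" "{..<r}"
    by (intro product_prob_spaceI) (rule prob_space_haar)
  let ?M = "haar_product r \<mu>"
  interpret M: prob_space ?M by (intro prob_space_PiM) (rule prob_space_haar)
  note mem = space_product_haarD[where r = r]
  show ?thesis
  proof
    show "(if i < r then \<phi> (\<omega> i) else 1\<^sub>m N) \<in> form_group" if "\<omega> \<in> space ?M" for \<omega> i
      using mem[OF that] \<phi>_image form_group_one by auto
  next
    fix a b i assume ab: "a < N" "b < N"
    show "(\<lambda>\<omega>. (if i < r then \<phi> (\<omega> i) else 1\<^sub>m N) $$ (a, b)) \<in> borel_measurable ?M"
    proof (cases "i < r")
      case True
      have "(\<lambda>\<omega>. \<omega> i) \<in> measurable ?M \<mu>" using True by (intro measurable_component_singleton) simp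
      from measurable_compose[OF this \<phi>_measurable[OF ab]] True show ?thesis by simp
    qed simp
  next
    fix i h assume i: "i < r" and "h \<in> form_group"
    then have "h \<in> \<phi> ` carrier G" by (simp add: \<phi>_image)
    then obtain h' where h': "h' \<in> carrier G" "\<phi> h' = h" by auto
    define \<tau> where "\<tau> = (\<lambda>\<omega>. \<lambda>j\<in>{..<r}. if j = i then h' * \<omega> j else \<omega> j)"
    have "(\<lambda>j. if j < r then \<phi> (\<tau> \<omega> j) else 1\<^sub>m N) =
        (\<lambda>j. if j < r then \<phi> (\<omega> j) else 1\<^sub>m N)(i := h * (if i < r then \<phi> (\<omega> i) else 1\<^sub>m N))"
      if "\<omega> \<in> space ?M" for \<omega>
      using i h' mem[OF that] \<phi>_mult by (auto simp: \<tau>_def)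
    then show "\<exists>\<tau>. \<tau> \<in> measurable ?M ?M \<and> distr ?M ?M \<tau> = ?M \<and> (\<forall>\<omega>\<in>space ?M.
        (\<lambda>j. if j < r then \<phi> (\<tau> \<omega> j) else 1\<^sub>m N) =
        (\<lambda>j. if j < r then \<phi> (\<omega> j) else 1\<^sub>m N)(i := h * (if i < r then \<phi> (\<omega> i) else 1\<^sub>m N)))"
      using product_haar_left_invariant[OF i h'(1)] by (intro exI[of _ \<tau>]) (simp add: \<tau>_def)
  qed
qed

lemma moment_eq_integral:
  assumes w: "word_in r w"
  shows "haar_matrices.moment N K (haar_product r \<mu>) (\<lambda>i \<omega>. if i < r then \<phi> (\<omega> i) else 1\<^sub>m N) [w] =
    (LINT \<omega>|haar_product r \<mu>. trace_mat (\<phi> (word_eval G w \<omega>)))"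
proof -
  interpret group G by (rule G(1))
  let ?X = "\<lambda>i \<omega>. if i < r then \<phi> (\<omega> i) else 1\<^sub>m N"
  let ?M = "haar_product r \<mu>"
  interpret H: haar_matrices N K eps ?M r ?X by (rule haar_matrices_of_haar_prob)
  \<comment> \<open>A homomorphism preserves inverses, and on the form group the inverse is
    \<open>star\<close>.\<close>
  have \<phi>_inv: "\<phi> (inv\<^bsub>G\<^esub> A) = H.star (\<phi> A)" if A: "A \<in> carrier G" for A
  proof -
    have A': "inv\<^bsub>G\<^esub> A \<in> carrier G" using A by simp
    have \<phi>A: "\<phi> A \<in> H.form_group" "\<phi> (inv\<^bsub>G\<^esub> A) \<in> H.form_group" using A A' \<phi>_image by auto
    have "\<phi> (inv\<^bsub>G\<^esub> A) * \<phi> A = 1\<^sub>m N"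
      using l_inv[OF A] \<phi>_mult[OF A' A] \<phi>_one by (simp add: G(3,4))
    then have "H.star (\<phi> A) = (\<phi> (inv\<^bsub>G\<^esub> A) * \<phi> A) * H.star (\<phi> A)"
      using H.form_groupD(1)[OF \<phi>A(1)] by simp
    also have "\<dots> = \<phi> (inv\<^bsub>G\<^esub> A)"
      using H.form_groupD(1)[OF \<phi>A(1)] H.form_groupD(1)[OF \<phi>A(2)] H.form_groupD(5)[OF \<phi>A(1)]
      by (simp add: H.assoc)
    finally show ?thesis by simp
  qed
  have "\<phi> (word_eval G w \<omega>) = H.word_val (\<lambda>i. ?X i \<omega>) w" if \<omega>: "\<omega> \<in> space ?M" for \<omega>
    using w
  proof (induction w)
    case Nil
    show ?case by (simp add: word_eval_def G(4) \<phi>_one)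
  next
    case (Cons l w)
    define g where "g = (if snd l then \<omega> (fst l) else inv\<^bsub>G\<^esub> (\<omega> (fst l)))"
    have g: "g \<in> carrier G" "\<phi> g = H.letter_val (\<lambda>i. ?X i \<omega>) l"
      using space_product_haarD[OF \<omega>, of "fst l"] Cons(2) \<phi>_inv by (auto simp: g_def H.letter_val_def)
    have "\<phi> (word_eval G (l # w) \<omega>) = \<phi> g * \<phi> (word_eval G w \<omega>)"
      using \<phi>_mult[OF g(1) word_eval_carrier[OF \<omega>, of w]] Cons(2) by (simp add: word_eval_Cons g_def)
    then show ?case using Cons g by simp
  qed
  then show ?thesis
    unfolding H.moment_def by (intro Bochner_Integration.integral_cong) (auto simp: H.family_val_def)
qed

end

end

section \<open>The orthogonal and symplectic cases\<close>

abbreviation complex_mat :: "real mat \<Rightarrow> complex mat" where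
  "complex_mat \<equiv> map_mat complex_of_real"

lemma complex_mat_mult:
  assumes "A \<in> carrier_mat n n" "B \<in> carrier_mat n n"
  shows "complex_mat (A * B) = complex_mat A * complex_mat B"
  using assms by (intro eq_matI) (auto simp: mat_mult_index[of _ n] simp del: index_mult_mat(1))

lemma complex_mat_transpose:
  "complex_mat (transpose_mat A) = transpose_mat (complex_mat A)"
  by (intro eq_matI) auto

lemma matrix_form_orthogonal: "matrix_form n (1\<^sub>m n) 1"
  by unfold_locales (auto intro!: eq_matI)

text \<open>For \<open>K = 1\<close> the map \<open>star\<close> is transposition, so a matrix whose
  \<open>star\<close> is its adjoint has real entries, and \<open>Re\<close> recovers the orthogonal
  matrix.\<close>

lemma form_group_orthogonal:
  "complex_mat ` carrier (orthogonal_group n) = matrix_form.form_group n (1\<^sub>m n)"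
proof -
  interpret matrix_form n "1\<^sub>m n" 1 by (rule matrix_form_orthogonal)
  have star: "star B = transpose_mat B" if "B \<in> MN" for B
    using that by (simp add: star_def)
  show ?thesis
  proof (intro equalityI subsetI)
    fix B assume "B \<in> complex_mat ` carrier (orthogonal_group n)"
    then obtain A where A: "A \<in> carrier_mat n n" "transpose_mat A * A = 1\<^sub>m n" and B: "B = complex_mat A"
      by (auto simp: orthogonal_group_def)
    have BC: "B \<in> MN" using A B by simp
    have adj: "mat_adjoint B = transpose_mat B"
    proof (rule eq_matI)
      fix i j assume "i < dim_row (transpose_mat B)" "j < dim_col (transpose_mat B)"
      then have ij: "i < n" "j < n" using BC by auto
      show "mat_adjoint B $$ (i, j) = transpose_mat B $$ (i, j)"
        unfolding adjoint_index[OF BC ij] using ij A(1) by (simp add: B)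
    qed (use BC carrier_matD[OF adjoint_closed[OF BC]] in auto)
    have "transpose_mat B * B = complex_mat (transpose_mat A * A)"
      using A(1) by (subst complex_mat_mult[of _ n]) (auto simp: B complex_mat_transpose)
    also have "\<dots> = 1\<^sub>m n" unfolding A(2) by (intro eq_matI) auto
    finally show "B \<in> form_group" using BC star[OF BC] by (simp add: form_group_def adj)
  next
    fix B assume "B \<in> form_group"
    note B = form_groupD[OF this]
    have real: "cnj (B $$ (i, j)) = B $$ (i, j)" if "i < n" "j < n" for i j
      using arg_cong[OF B(3), of "\<lambda>M. M $$ (j, i)"] that B(1)
      by (simp add: star adjoint_index[of _ n])
    define A where "A = map_mat Re B"
    have A: "A \<in> carrier_mat n n" using B(1) by (simp add: A_def)
    have cA: "complex_mat A = B"
      using B(1) real by (intro eq_matI) (auto simp: A_def complex_eq_iff)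
    have "complex_mat (transpose_mat A * A) = transpose_mat B * B"
      using A by (subst complex_mat_mult[of _ n]) (auto simp: complex_mat_transpose cA)
    also have "\<dots> = 1\<^sub>m n" using B(4) star[OF B(1)] by simp
    finally have "complex_mat (transpose_mat A * A) = complex_mat (1\<^sub>m n)" by (simp add: of_real_hom.mat_hom_one)
    then have "transpose_mat A * A = 1\<^sub>m n"
      using A by (metis of_real_hom.mat_hom_inj)
    then show "B \<in> complex_mat ` carrier (orthogonal_group n)"
      using A cA by (auto simp: orthogonal_group_def)
  qed
qed

section \<open>The symplectic form as an instance\<close>

lemma J_mat_index:
  "i < 2 * n \<Longrightarrow> j < 2 * n \<Longrightarrow>
    J_mat n $$ (i, j) = (if j = i + n then 1 else if i = j + n then -1 else 0)"
  by (auto simp: J_mat_def)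

lemma J_mat_transpose: "transpose_mat (J_mat n) = - J_mat n"
  using J_mat_carrier[of n] by (intro eq_matI) (auto simp: J_mat_index)

lemma J_mat_orthogonal: "J_mat n * transpose_mat (J_mat n) = 1\<^sub>m (2 * n)"
proof (rule eq_matI)
  fix i j assume "i < dim_row (1\<^sub>m (2 * n))" "j < dim_col (1\<^sub>m (2 * n))"
  then have ij: "i < 2 * n" "j < 2 * n" by auto
  \<comment> \<open>The column of the only nonzero entry in row \<open>i\<close> of
    \<open>J_mat n\<close>.\<close>
  define i' where "i' = (if i < n then i + n else i - n)"
  have i': "i' < 2 * n" using ij by (auto simp: i'_def)
  have "(J_mat n * transpose_mat (J_mat n)) $$ (i, j) = (\<Sum>k<2 * n. J_mat n $$ (i, k) * J_mat n $$ (j, k))"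
    using J_mat_carrier[of n] ij
    by (subst mat_mult_index[of _ "2 * n"]) (auto intro!: sum.cong)
  also have "\<dots> = (\<Sum>k<2 * n. if k = i' then J_mat n $$ (i, i') * J_mat n $$ (j, i') else 0)"
    using ij by (intro sum.cong) (auto simp: J_mat_index i'_def split: if_splits)
  also have "\<dots> = 1\<^sub>m (2 * n) $$ (i, j)"
    using ij i' by (auto simp: J_mat_index i'_def split: if_splits)
  finally show "(J_mat n * transpose_mat (J_mat n)) $$ (i, j) = 1\<^sub>m (2 * n) $$ (i, j)" .
qed (use J_mat_carrier[of n] in auto)

lemma matrix_form_symplectic: "matrix_form (2 * n) (J_mat n) (-1)"
proof
  show "transpose_mat (J_mat n) = - 1 \<cdot>\<^sub>m J_mat n"
    unfolding J_mat_transpose by (intro eq_matI) auto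
qed (auto simp: J_mat_carrier J_mat_index J_mat_orthogonal)

text \<open>For unitary \<open>A\<close>, multiplying \<open>A^T J A = J\<close> on the right by the
  adjoint \<open>A'\<close> gives \<open>A^T J = J A'\<close>. As \<open>J^T = - J\<close>, this is
  equivalent to \<open>J A^T J^T = A'\<close>.\<close>

lemma form_group_symplectic: "carrier (symplectic_group n) = matrix_form.form_group (2 * n) (J_mat n)"
proof -
  interpret matrix_form "2 * n" "J_mat n" "-1" by (rule matrix_form_symplectic)
  let ?J = "J_mat n" and ?T = "transpose_mat (J_mat n)"
  have J: "?T = - ?J" by (rule J_mat_transpose)
  have "transpose_mat A * ?J * A = ?J \<longleftrightarrow> star A = mat_adjoint A"
    if A: "A \<in> MN" "mat_adjoint A * A = 1\<^sub>m (2 * n)" for A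
  proof
    have A': "A * mat_adjoint A = 1\<^sub>m (2 * n)"
      using mat_mult_left_right_inverse[of "mat_adjoint A" "2 * n" A] A by simp
    assume *: "transpose_mat A * ?J * A = ?J"
    have "transpose_mat A * ?J = transpose_mat A * ?J * (A * mat_adjoint A)" using A(1) by (simp add: A')
    also have "\<dots> = (transpose_mat A * ?J * A) * mat_adjoint A" using A(1) by (simp add: assoc)
    finally have "transpose_mat A * ?T = ?T * mat_adjoint A" using A(1) carrier_matD[OF A(1)] carrier_matD[OF adjoint_closed[OF A(1)]]
      carrier_matD[OF K_carrier] by (simp add: * J)
    then have "star A = (?J * ?T) * mat_adjoint A" using A(1) by (simp add: star_def assoc)
    then show "star A = mat_adjoint A" using A(1) by (simp add: K_orthogonal)
  next
    assume *: "star A = mat_adjoint A"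
    have "?T * mat_adjoint A = (?T * ?J) * (transpose_mat A * ?T)"
      unfolding *[symmetric] using A(1) by (simp add: star_def assoc)
    then have "?T * mat_adjoint A = transpose_mat A * ?T"
      using A(1) by (simp add: K_orthogonal' del: assoc_mult_mat)
    then have "transpose_mat A * ?T * A = ?T * (mat_adjoint A * A)"
      using A(1) by (metis assoc K_transpose_closed adjoint_closed)
    then show "transpose_mat A * ?J * A = ?J"
      using A carrier_matD[OF A(1)] carrier_matD[OF K_carrier] by (simp add: J)
  qed
  then show ?thesis by (auto simp: symplectic_group_def form_group_def)
qed

lemma orthogonal_moment:
  fixes \<mu> :: "real mat measure" and r :: nat
  assumes haar: "haar_prob n (orthogonal_group n) \<mu>"
  defines "X \<equiv> (\<lambda>i \<omega>. if i < r then complex_mat (\<omega> i) else 1\<^sub>m n)"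
  shows "haar_matrices n (1\<^sub>m n) 1 (haar_product r \<mu>) r X"
    "word_in r w \<Longrightarrow> haar_matrices.moment n (1\<^sub>m n) (haar_product r \<mu>) X [w] =
      of_real (expected_trace (orthogonal_group n) \<mu> r w)"
proof -
  let ?G = "orthogonal_group n"
  have G: "group ?G" "carrier ?G \<subseteq> carrier_mat n n" "monoid.mult ?G = (*)" "monoid.one ?G = 1\<^sub>m n"
    by (simp_all add: group_orthogonal_group) (auto simp: orthogonal_group_def)
  have hom: "complex_mat (A * B) = complex_mat A * complex_mat B"
    if "A \<in> carrier ?G" "B \<in> carrier ?G" for A B
    using that G(2) by (intro complex_mat_mult) auto
  have meas: "(\<lambda>A. complex_mat A $$ (a, b)) \<in> borel_measurable \<mu>" if ab: "a < n" "b < n" for a b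
  proof -
    have "(\<lambda>A. complex_of_real (A $$ (a, b))) \<in> borel_measurable \<mu>"
      using measurable_haar_entry[OF haar G ab] by measurable
    moreover have "complex_mat A $$ (a, b) = complex_of_real (A $$ (a, b))" if "A \<in> space \<mu>" for A
    proof -
      have "A \<in> carrier_mat n n" using that G(2) by (auto simp: space_haar[OF haar G])
      then show ?thesis using ab by simp
    qed
    ultimately show ?thesis by (subst measurable_cong) auto
  qed
  note props = haar G matrix_form_orthogonal form_group_orthogonal hom of_real_hom.mat_hom_one meas
  show "haar_matrices n (1\<^sub>m n) 1 (haar_product r \<mu>) r X"
    unfolding X_def by (rule haar_matrices_of_haar_prob[OF props])
  assume w: "word_in r w"
  have tr: "trace_mat (complex_mat A) = of_real (trace_mat A)" if "A \<in> carrier_mat n n" for A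
    using that by (simp add: trace_mat_def)
  have "word_eval ?G w \<omega> \<in> carrier_mat n n" if "\<omega> \<in> space (haar_product r \<mu>)" for \<omega>
    using word_eval_carrier[OF haar G that w] G(2) by blast
  then have "(LINT \<omega>|haar_product r \<mu>. trace_mat (complex_mat (word_eval ?G w \<omega>))) =
      (LINT \<omega>|haar_product r \<mu>. complex_of_real (trace_mat (word_eval ?G w \<omega>)))"
    by (intro Bochner_Integration.integral_cong refl tr)
  then  show "haar_matrices.moment n (1\<^sub>m n) (haar_product r \<mu>) X [w] =
      of_real (expected_trace ?G \<mu> r w)"
    using moment_eq_integral[OF props w, folded X_def] by (simp add: expected_trace_def)
qed

lemma symplectic_moment:
  fixes \<mu> :: "complex mat measure" and r :: nat
  assumes haar: "haar_prob (2 * n) (symplectic_group n) \<mu>"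
  defines "X \<equiv> (\<lambda>i \<omega>. if i < r then \<omega> i else 1\<^sub>m (2 * n))"
  shows "haar_matrices (2 * n) (J_mat n) (-1) (haar_product r \<mu>) r X"
    "word_in r w \<Longrightarrow> haar_matrices.moment (2 * n) (J_mat n) (haar_product r \<mu>) X [w] =
      expected_trace (symplectic_group n) \<mu> r w"
proof -
  let ?G = "symplectic_group n"
  have G: "group ?G" "carrier ?G \<subseteq> carrier_mat (2 * n) (2 * n)" "monoid.mult ?G = (*)"
      "monoid.one ?G = 1\<^sub>m (2 * n)"
    by (simp_all add: group_symplectic_group) (auto simp: symplectic_group_def)
  have image: "(\<lambda>A. A) ` carrier ?G = matrix_form.form_group (2 * n) (J_mat n)"
    by (simp add: form_group_symplectic)
  note props = haar G matrix_form_symplectic image refl refl measurable_haar_entry[OF haar G]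
  show "haar_matrices (2 * n) (J_mat n) (-1) (haar_product r \<mu>) r X"
    unfolding X_def by (rule haar_matrices_of_haar_prob[OF props])
  assume w: "word_in r w"
  show "haar_matrices.moment (2 * n) (J_mat n) (haar_product r \<mu>) X [w] =
      expected_trace ?G \<mu> r w"
    using moment_eq_integral[OF props w, folded X_def] by (simp add: expected_trace_def)
qed

theorem corollary1p11:
  fixes r :: nat and w :: "letter list"
  assumes "w \<in> carrier (free_group r)"
  shows "(\<forall>\<mu> :: nat \<Rightarrow> real mat measure.
            (\<forall>n\<ge>1. haar_prob n (orthogonal_group n) (\<mu> n)) \<longrightarrow>
            (if sql r w = \<infinity>
             then \<forall>n\<ge>1. expected_trace (orthogonal_group n) (\<mu> n) r w = 0
             else (\<lambda>n. expected_trace (orthogonal_group n) (\<mu> n) r w) \<in>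
               O(\<lambda>n. real n powi (1 - int (the_enat (min (sql r w) (2 * cl r w)))))))
       \<and> (\<forall>\<mu> :: nat \<Rightarrow> complex mat measure.
            (\<forall>n\<ge>1. haar_prob (2 * n) (symplectic_group n) (\<mu> n)) \<longrightarrow>
            (if sql r w = \<infinity>
             then \<forall>n\<ge>1. expected_trace (symplectic_group n) (\<mu> n) r w = 0
             else (\<lambda>n. expected_trace (symplectic_group n) (\<mu> n) r w) \<in>
               O(\<lambda>n. of_nat n powi (1 - int (the_enat (min (sql r w) (2 * cl r w)))))))"
proof (intro conjI allI impI)
  have w: "word_in r w" using assms by (simp add: free_group_def word_in_def)
  \<comment> \<open>The exponent is used only for finite \<open>sql r w\<close>; the minimum is then
    finite and \<open>the_enat\<close> returns its value.\<close>
  let ?e = "1 - int (the_enat (min (sql r w) (2 * cl r w)))"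
  {
    fix \<mu> :: "nat \<Rightarrow> real mat measure"
    assume haar: "\<forall>n\<ge>1. haar_prob n (orthogonal_group n) (\<mu> n)"
    let ?X = "\<lambda>n i \<omega>. if i < r then complex_mat (\<omega> i) else 1\<^sub>m n"
    let ?M = "\<lambda>n. haar_product r (\<mu> n)"
    let ?m = "\<lambda>n. haar_matrices.moment n (1\<^sub>m n) (?M n) (?X n) [w]"
    have hm: "haar_matrices n (1\<^sub>m n) 1 (?M n) r (?X n)"
      and mom: "?m n =
        of_real (expected_trace (orthogonal_group n) (\<mu> n) r w)" if "n \<ge> 1" for n
      using orthogonal_moment[of n "\<mu> n"] haar that w by blast+
    show "if sql r w = \<infinity> then \<forall>n\<ge>1. expected_trace (orthogonal_group n) (\<mu> n) r w = 0
        else (\<lambda>n. expected_trace (orthogonal_group n) (\<mu> n) r w) \<in> O(\<lambda>n. real n powi ?e)"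
    proof (cases "sql r w = \<infinity>")
      case True
      then obtain i where "i < r" "odd (length (filter (\<lambda>l. fst l = i) w))"
        using odd_letter_if_sql_infinite[OF assms] by blast
      then have "?m n = 0" if "n \<ge> 1" for n
        by (rule haar_matrices.moment_odd[OF hm[OF that]])
      with mom show ?thesis unfolding if_P[OF True] by simp
    next
      case False
      \<comment> \<open>Here \<open>N - eps = n - 1\<close>, which is zero for
        \<open>n = 1\<close>.\<close>
      have "real n / 2 \<le> cmod (of_nat n - 1)" if "n \<ge> 2" for n
      proof -
        have "of_nat n - 1 = complex_of_real (real n - 1)" by simp
        then have "cmod (of_nat n - 1) = \<bar>real n - 1\<bar>" by (simp only: norm_of_real)
        then show ?thesis using that by simp
      qed
      then have "\<exists>C. \<forall>n\<ge>2. cmod (?m n) \<le> C * real n powi ?e"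
        using hm assms False
        by (intro haar_matrices_asymptotics[where N = "\<lambda>n. n" and K = "\<lambda>n. 1\<^sub>m n" and M = ?M and X = ?X and eps = 1]) auto
      then obtain C where C: "\<And>n. n \<ge> 2 \<Longrightarrow> cmod (?m n) \<le> C * real n powi ?e"
        by blast
      have "norm (expected_trace (orthogonal_group n) (\<mu> n) r w) \<le> C * norm (real n powi ?e)" if "n \<ge> 2" for n
        using C[OF that] mom[of n] that by simp
      then have "(\<lambda>n. expected_trace (orthogonal_group n) (\<mu> n) r w) \<in> O(\<lambda>n. real n powi ?e)"
        by (intro bigoI[of _ C] eventually_at_top_linorderI[of 2])
      then show ?thesis unfolding if_not_P[OF False] .
    qed
  }
  {
    fix \<mu> :: "nat \<Rightarrow> complex mat measure"
    assume haar: "\<forall>n\<ge>1. haar_prob (2 * n) (symplectic_group n) (\<mu> n)"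
    let ?X = "\<lambda>n i \<omega>. if i < r then \<omega> i else 1\<^sub>m (2 * n)"
    let ?M = "\<lambda>n. haar_product r (\<mu> n)"
    let ?m = "\<lambda>n. haar_matrices.moment (2 * n) (J_mat n) (?M n) (?X n) [w]"
    have hm: "haar_matrices (2 * n) (J_mat n) (-1) (?M n) r (?X n)"
      and mom: "?m n =
        expected_trace (symplectic_group n) (\<mu> n) r w" if "n \<ge> 1" for n
      using symplectic_moment[of n "\<mu> n"] haar that w by blast+
    show "if sql r w = \<infinity> then \<forall>n\<ge>1. expected_trace (symplectic_group n) (\<mu> n) r w = 0
        else (\<lambda>n. expected_trace (symplectic_group n) (\<mu> n) r w) \<in> O(\<lambda>n. of_nat n powi ?e)"
    proof (cases "sql r w = \<infinity>")
      case True
      then obtain i where "i < r" "odd (length (filter (\<lambda>l. fst l = i) w))"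
        using odd_letter_if_sql_infinite[OF assms] by blast
      then have "?m n = 0" if "n \<ge> 1" for n
        by (rule haar_matrices.moment_odd[OF hm[OF that]])
      with mom show ?thesis unfolding if_P[OF True] by simp
    next
      case False
      \<comment> \<open>Here \<open>N = 2 n\<close> and \<open>eps = - 1\<close>, so that
        \<open>N - eps = 2 n + 1\<close>.\<close>
      have "real n / 2 \<le> cmod (of_nat (2 * n) - (- 1))" for n
      proof -
        have "of_nat (2 * n) - (- 1) = complex_of_real (real (2 * n) + 1)" by simp
        then have "cmod (of_nat (2 * n) - (- 1)) = \<bar>real (2 * n) + 1\<bar>" by (simp only: norm_of_real)
        then show ?thesis by simp
      qed
      then have "\<exists>C. \<forall>n\<ge>2. cmod (?m n) \<le> C * real n powi ?e"
        using hm assms False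
        by (intro haar_matrices_asymptotics[where N = "\<lambda>n. 2 * n" and K = J_mat and M = ?M and X = ?X and eps = "-1"]) auto
      then obtain C where C: "\<And>n. n \<ge> 2 \<Longrightarrow> cmod (?m n) \<le> C * real n powi ?e"
        by blast
      have "norm (expected_trace (symplectic_group n) (\<mu> n) r w) \<le> C * norm (of_nat n powi ?e :: complex)" if "n \<ge> 2" for n
        using C[OF that] mom[of n] that by (simp add: norm_power_int)
      then have "(\<lambda>n. expected_trace (symplectic_group n) (\<mu> n) r w) \<in> O(\<lambda>n. of_nat n powi ?e)"
        by (intro bigoI[of _ C] eventually_at_top_linorderI[of 2])
      then show ?thesis unfolding if_not_P[OF False] .
    qed
  }
qed

end
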